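(* Let $1\leq p<\infty$ and let $T\in B(\mathfrak{C}_p)_+$ be a positive operator. The following are equivalent: (1) $T$ is compact. (2) $T$ is strictly singular. (3) There is no subspace $E\subset\mathfrak{C}_p$, isomorphic to $\ell_p$, such that $T|_E$ is an isomorphism onto its image and both $E$ and $T(E)$ are complemented in $\mathfrak{C}_p$.
   Context: "Subspace" means closed infinite-dimensional subspace. For $1\leq p<\infty$, $\mathfrak{C}_p$ is the Schatten space of compact operators $A$ on a separable infinite-dimensional Hilbert space with singular values satisfying $\sum_i s_i(A)^p<\infty$, with norm $(\sum_i s_i(A)^p)^{1/p}$; its positive cone consists of the positive semidefinite operators in $\mathfrak{C}_p$. $B(\mathfrak{C}_p)_+$ is the set of bounded linear operators on $\mathfrak{C}_p$ mapping the positive cone into itself. An operator is strictly singular if it is not an isomorphism (onto its image) on any infinite-dimensional subspace of its domain. *)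

theory Defs
  imports "HOL-Analysis.Analysis" "HOL-Library.Function_Algebras" "HOL-Library.Nonpos_Ints"
begin

section \<open>Complex vector spaces and complex Hilbert spaces\<close>

class scaleC =
  fixes scaleC :: "complex \<Rightarrow> 'a \<Rightarrow> 'a" (infixr \<open>*\<^sub>C\<close> 75)

class complex_vector = scaleC + ab_group_add +
  assumes scaleC_add_right: "a *\<^sub>C (x + y) = a *\<^sub>C x + a *\<^sub>C y"
    and scaleC_add_left: "(a + b) *\<^sub>C x = a *\<^sub>C x + b *\<^sub>C x"
    and scaleC_scaleC: "a *\<^sub>C b *\<^sub>C x = (a * b) *\<^sub>C x"
    and scaleC_one: "1 *\<^sub>C x = x"

global_interpretation cvs: vector_space "scaleC :: complex \<Rightarrow> 'a \<Rightarrow> 'a::complex_vector"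
  by unfold_locales (simp_all add: scaleC_add_right scaleC_add_left scaleC_scaleC scaleC_one)

instantiation complex :: complex_vector
begin
definition "a *\<^sub>C x = a * x" for a x :: complex
instance
  by standard (simp_all add: scaleC_complex_def algebra_simps)
end

instantiation "fun" :: (type, complex_vector) complex_vector
begin
definition "a *\<^sub>C f = (\<lambda>x. a *\<^sub>C f x)" for f :: "'a \<Rightarrow> 'b"
instance
  by standard
    (simp_all add: scaleC_fun_def fun_eq_iff scaleC_add_right scaleC_add_left scaleC_scaleC scaleC_one)
end

text \<open>The inner product is antilinear in the first and linear in the second argument.\<close>

class complex_inner = complex_vector + real_normed_vector +
  fixes cinner :: "'a \<Rightarrow> 'a \<Rightarrow> complex"
  assumes scaleR_scaleC: "r *\<^sub>R x = complex_of_real r *\<^sub>C x"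
    and cinner_commute: "cinner x y = cnj (cinner y x)"
    and cinner_add_right: "cinner x (y + z) = cinner x y + cinner x z"
    and cinner_scaleC_right: "cinner x (a *\<^sub>C y) = a * cinner x y"
    and cinner_self_nonneg: "cinner x x \<in> \<real>\<^sub>\<ge>\<^sub>0"
    and cinner_self_eq_0: "cinner x x = 0 \<longleftrightarrow> x = 0"
    and norm_eq_sqrt_cinner: "norm x = sqrt (Re (cinner x x))"

class chilbert_space = complex_inner + complete_space

section \<open>Normed spaces given by a carrier and a norm\<close>

text \<open>
  The Schatten spaces and their subspaces are treated as linear subspaces \<open>X\<close> of a complex vector
  space type, equipped with a norm \<open>nX\<close> that is only relevant on \<open>X\<close>. An operator between two such
  spaces is a function whose values outside its domain are irrelevant.
\<close>

definition finite_dimensional :: "'v::complex_vector set \<Rightarrow> bool" where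
  "finite_dimensional E \<longleftrightarrow> (\<exists>B. finite B \<and> E \<subseteq> cvs.span B)"

text \<open>The case distinction makes the distance symmetric and nonnegative on the whole type, as
  \<^locale>\<open>Metric_space\<close> demands.\<close>

definition norm_topology :: "'v::complex_vector set \<Rightarrow> ('v \<Rightarrow> real) \<Rightarrow> 'v topology" where
  "norm_topology X nX =
     Metric_space.mtopology X (\<lambda>x y. if x \<in> X \<and> y \<in> X then nX (x - y) else 0)"

definition closed_inf_dim_subspace ::
    "'v::complex_vector set \<Rightarrow> ('v \<Rightarrow> real) \<Rightarrow> 'v set \<Rightarrow> bool" where
  "closed_inf_dim_subspace X nX E \<longleftrightarrow>
     E \<subseteq> X \<and> cvs.subspace E \<and> closedin (norm_topology X nX) E \<and> \<not> finite_dimensional E"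

definition bounded_operator ::
    "'v::complex_vector set \<Rightarrow> ('v \<Rightarrow> real) \<Rightarrow> 'w::complex_vector set \<Rightarrow> ('w \<Rightarrow> real)
      \<Rightarrow> ('v \<Rightarrow> 'w) \<Rightarrow> bool" where
  "bounded_operator X nX Y nY T \<longleftrightarrow>
     T \<in> X \<rightarrow> Y \<and>
     (\<forall>x\<in>X. \<forall>y\<in>X. T (x + y) = T x + T y) \<and>
     (\<forall>a. \<forall>x\<in>X. T (a *\<^sub>C x) = a *\<^sub>C T x) \<and>
     (\<exists>K. \<forall>x\<in>X. nY (T x) \<le> K * nX x)"

definition isomorphism ::
    "'v::complex_vector set \<Rightarrow> ('v \<Rightarrow> real) \<Rightarrow> 'w::complex_vector set \<Rightarrow> ('w \<Rightarrow> real)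
      \<Rightarrow> ('v \<Rightarrow> 'w) \<Rightarrow> bool" where
  "isomorphism X nX Y nY T \<longleftrightarrow>
     bij_betw T X Y \<and> bounded_operator X nX Y nY T \<and> bounded_operator Y nY X nX (inv_into X T)"

definition isomorphic ::
    "'v::complex_vector set \<Rightarrow> ('v \<Rightarrow> real) \<Rightarrow> 'w::complex_vector set \<Rightarrow> ('w \<Rightarrow> real) \<Rightarrow> bool" where
  "isomorphic X nX Y nY \<longleftrightarrow> (\<exists>T. isomorphism X nX Y nY T)"

definition compact_operator ::
    "'v::complex_vector set \<Rightarrow> ('v \<Rightarrow> real) \<Rightarrow> 'w::complex_vector set \<Rightarrow> ('w \<Rightarrow> real)
      \<Rightarrow> ('v \<Rightarrow> 'w) \<Rightarrow> bool" where
  "compact_operator X nX Y nY T \<longleftrightarrow>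
     bounded_operator X nX Y nY T \<and>
     compactin (norm_topology Y nY) (norm_topology Y nY closure_of (T ` {x\<in>X. nX x \<le> 1}))"

definition strictly_singular ::
    "'v::complex_vector set \<Rightarrow> ('v \<Rightarrow> real) \<Rightarrow> 'w::complex_vector set \<Rightarrow> ('w \<Rightarrow> real)
      \<Rightarrow> ('v \<Rightarrow> 'w) \<Rightarrow> bool" where
  "strictly_singular X nX Y nY T \<longleftrightarrow>
     bounded_operator X nX Y nY T \<and>
     \<not> (\<exists>E. closed_inf_dim_subspace X nX E \<and> isomorphism E nX (T ` E) nY T)"

definition complemented :: "'v::complex_vector set \<Rightarrow> ('v \<Rightarrow> real) \<Rightarrow> 'v set \<Rightarrow> bool" where
  "complemented X nX E \<longleftrightarrow>
     (\<exists>P. bounded_operator X nX X nX P \<and> (\<forall>x\<in>X. P (P x) = P x) \<and> P ` X = E)"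

section \<open>The sequence spaces\<close>

definition lp_space :: "real \<Rightarrow> (nat \<Rightarrow> complex) set" where
  "lp_space p = {x. summable (\<lambda>i. cmod (x i) powr p)}"

definition lp_norm :: "real \<Rightarrow> (nat \<Rightarrow> complex) \<Rightarrow> real" where
  "lp_norm p x = (\<Sum>i. cmod (x i) powr p) powr (1 / p)"

section \<open>The Schatten spaces\<close>

definition compact_hilbert_operator :: "('h::chilbert_space \<Rightarrow> 'h) \<Rightarrow> bool" where
  "compact_hilbert_operator A \<longleftrightarrow>
     bounded_linear A \<and> (\<forall>a x. A (a *\<^sub>C x) = a *\<^sub>C A x) \<and> compact (closure (A ` cball 0 1))"

definition cadjoint :: "('h::chilbert_space \<Rightarrow> 'h) \<Rightarrow> 'h \<Rightarrow> 'h" where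
  "cadjoint A = (THE B. \<forall>x y. cinner (A x) y = cinner x (B y))"

text \<open>
  The singular values of a compact operator \<open>A\<close> are the square roots of the eigenvalues of
  \<open>A\<^sup>* A\<close>, listed in nonincreasing order and repeated according to multiplicity, with zeros
  appended if there are only finitely many positive ones. If there are infinitely many positive
  ones, then the value 0 does not occur in the list, which is why only the multiplicities of
  positive values are prescribed. The eigenspaces for positive eigenvalues are finite-dimensional,
  so \<open>cvs.dim\<close> is their true dimension.
\<close>

definition singular_value_sequence :: "('h::chilbert_space \<Rightarrow> 'h) \<Rightarrow> (nat \<Rightarrow> real) \<Rightarrow> bool" where
  "singular_value_sequence A s \<longleftrightarrow>
     decseq s \<and> (\<forall>i. 0 \<le> s i) \<and>
     (\<forall>\<sigma>>0. finite {i. s i = \<sigma>} \<and>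
        card {i. s i = \<sigma>} = cvs.dim {x. cadjoint A (A x) = complex_of_real (\<sigma>\<^sup>2) *\<^sub>C x})"

definition singular_value :: "('h::chilbert_space \<Rightarrow> 'h) \<Rightarrow> nat \<Rightarrow> real" where
  "singular_value A = (THE s. singular_value_sequence A s)"

definition schatten_space :: "real \<Rightarrow> ('h::chilbert_space \<Rightarrow> 'h) set" where
  "schatten_space p =
     {A. compact_hilbert_operator A \<and> summable (\<lambda>i. singular_value A i powr p)}"

definition schatten_norm :: "real \<Rightarrow> ('h::chilbert_space \<Rightarrow> 'h) \<Rightarrow> real" where
  "schatten_norm p A = (\<Sum>i. singular_value A i powr p) powr (1 / p)"

definition schatten_cone :: "real \<Rightarrow> ('h::chilbert_space \<Rightarrow> 'h) set" where
  "schatten_cone p = {A \<in> schatten_space p. \<forall>x. cinner x (A x) \<in> \<real>\<^sub>\<ge>\<^sub>0}"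

definition positive_operators :: "real \<Rightarrow> (('h::chilbert_space \<Rightarrow> 'h) \<Rightarrow> ('h \<Rightarrow> 'h)) set" where
  "positive_operators p =
     {T. bounded_operator (schatten_space p) (schatten_norm p)
           (schatten_space p) (schatten_norm p) T \<and>
         T ` schatten_cone p \<subseteq> schatten_cone p}"

end

theory Submission
  imports Defs "HOL-Library.Diagonal_Subsequence"
begin

text \<open>
  Two implications are soft. A compact operator that is bounded below on an infinite-dimensional
  subspace would map a separated bounded sequence of that subspace to a sequence without Cauchy
  subsequences, and a subspace on which \<open>T\<close> is an isomorphism contradicts strict singularity at
  once. The substance is that a positive operator \<open>T\<close> that is not compact is an isomorphism on a
  complemented copy of \<open>\<ell>\<^sub>p\<close> whose image is complemented as well.

  For this it suffices to factor the identity of \<open>\<ell>\<^sub>p\<close> as \<open>L T J\<close> with bounded \<open>J\<close> and \<open>L\<close>. Then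
  \<open>E = J(\<ell>\<^sub>p)\<close> is the range of the projection \<open>J L T\<close>, its image \<open>T(E)\<close> is the range of the
  projection \<open>T J L\<close>, and \<open>J L\<close> inverts \<open>T\<close> on \<open>E\<close>; this is
  \<open>factorisation_fixes_complemented_lp\<close>.

  The factorisation is assembled from blocks. Let \<open>P\<^sub>m\<close> be the projections onto the first \<open>m\<close>
  vectors of a basis of the Hilbert space. In a positive operator written as a 2 by 2 block matrix
  the two diagonal corners control the off-diagonal ones. Because \<open>T\<close> is positive, this can be used
  both before and after applying \<open>T\<close>: the number \<open>\<langle>e, T(g g\<^sup>*) e\<rangle>\<close> is a nonnegative quadratic form
  in \<open>g\<close> as well as in \<open>e\<close>. Hence, if for suitable \<open>m\<close> and \<open>n\<close> the positive operators in the
  corner of \<open>I - P\<^sub>m\<close> are mapped by \<open>T\<close> to operators whose compression to the corner of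
  \<open>I - P\<^sub>n\<close> is small, then \<open>T\<close> is close to the finite rank operators \<open>x \<mapsto> P\<^sub>k T(x) P\<^sub>k\<close>, and
  \<open>T\<close> is compact (\<open>small_at_imp_compact\<close>). If \<open>T\<close> is not compact, a gliding hump therefore
  yields a number \<open>\<epsilon> > 0\<close>, finite rank positive operators \<open>c\<^sub>k\<close> of norm at most 1 in pairwise
  orthogonal corners, and functionals \<open>\<phi>\<^sub>k\<close> of norm at most 1 living on the same corners, with
  \<open>\<phi>\<^sub>k(T c\<^sub>k) \<ge> \<epsilon>\<close>. The \<open>c\<^sub>k\<close> span a copy of \<open>\<ell>\<^sub>p\<close>, the \<open>\<phi>\<^sub>k\<close> define a contraction to
  \<open>\<ell>\<^sub>p\<close>, and all entries \<open>\<phi>\<^sub>k(T c\<^sub>l)\<close> are nonnegative. Along a subsequence the off-diagonal part of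
  this matrix is small: for \<open>p > 1\<close> since the rows and columns of a bounded matrix tend to zero, for
  \<open>p = 1\<close> by the disjointification argument of Rosenthal (\<open>almost_diagonal_subsequence\<close>). A Neumann
  series then inverts the matrix (\<open>positive_blocks_factorisation\<close>).

  All norm estimates rest on one description of the Schatten norm: it is the supremum of
  \<open>(\<Sum>\<^sub>j |\<langle>e\<^sub>j, A f\<^sub>j\<rangle>|\<^sup>p)\<^sup>1\<^sup>/\<^sup>p\<close> over pairs of finite families that satisfy the Bessel
  inequality (\<open>schatten_pairing_le\<close>, \<open>schattenI\<close>). Admitting all such families, instead of
  orthonormal ones only, makes the description stable under projections. The supremum is attained in
  the limit by the Schmidt decomposition, whose coefficients are the singular values
  (\<open>schmidt_decomposition_exists\<close>, \<open>singular_value_schmidt\<close>).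
\<close>

section \<open>Finite p-norms\<close>

text \<open>The graph of a convex power lies above its tangent at \<open>c\<close>; after scaling to \<open>c = 1\<close> this is
  Young's inequality.\<close>

lemma powr_tangent_le:
  fixes x c p :: real
  assumes "1 \<le> p" "0 \<le> x" "0 < c"
  shows "c powr p + p * c powr (p - 1) * (x - c) \<le> x powr p"
proof -
  define y where "y = x / c"
  have y: "0 \<le> y" using assms by (simp add: y_def)
  have young: "y \<le> y powr p / p + (1 - 1 / p)"
  proof (cases "y = 0")
    case False
    then show ?thesis
      using Youngs_inequality_0[of "1 / p" "1 - 1 / p" "y powr p" 1] assms y
      by (simp add: powr_powr)
  qed (use assms in simp)
  have "1 + p * (y - 1) \<le> y powr p"
  proof -
    have "p * y \<le> p * (y powr p / p + (1 - 1 / p))"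
      using young assms by (intro mult_left_mono) auto
    also have "\<dots> = y powr p + p - 1" using assms by (simp add: field_simps)
    finally show ?thesis by (simp add: algebra_simps)
  qed
  then have "c powr p * (1 + p * (y - 1)) \<le> c powr p * y powr p"
    by (simp add: mult_left_mono)
  moreover have "c powr p * y powr p = x powr p"
    using assms by (simp add: y_def powr_divide)
  moreover have "c powr p * (1 + p * (y - 1)) = c powr p + p * c powr (p - 1) * (x - c)"
    using assms by (simp add: y_def powr_diff field_simps)
  ultimately show ?thesis by simp
qed

text \<open>Summing the tangent inequality at the weighted mean \<open>c\<close> gives the claim for total mass 1. A smaller
  mass only helps, because the constant term of the tangent is \<open>(1 - p) c\<^sup>p \<le> 0\<close>.\<close>

lemma powr_jensen_subprobability:
  fixes m t :: "'i \<Rightarrow> real"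
  assumes p: "1 \<le> p" and m: "\<And>i. i \<in> I \<Longrightarrow> 0 \<le> m i" "(\<Sum>i\<in>I. m i) \<le> 1"
    and t: "\<And>i. i \<in> I \<Longrightarrow> 0 \<le> t i"
  shows "(\<Sum>i\<in>I. m i * t i) powr p \<le> (\<Sum>i\<in>I. m i * t i powr p)"
proof -
  define c where "c = (\<Sum>i\<in>I. m i * t i)"
  have c0: "0 \<le> c" unfolding c_def using m t by (intro sum_nonneg) auto
  show ?thesis
  proof (cases "c = 0")
    case True
    then show ?thesis using m t p unfolding c_def by (auto intro!: sum_nonneg)
  next
    case False
    then have c: "0 < c" using c0 by simp
    have "c powr p \<le> c powr p * ((1 - p) * (\<Sum>i\<in>I. m i) + p)"
    proof -
      have "(p - 1) * (\<Sum>i\<in>I. m i) \<le> (p - 1) * 1" using p m by (intro mult_left_mono) auto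
      then have "1 \<le> (1 - p) * (\<Sum>i\<in>I. m i) + p" by (simp add: algebra_simps)
      then show ?thesis by (metis mult.right_neutral mult_left_mono powr_ge_zero)
    qed
    also have "\<dots> = (\<Sum>i\<in>I. m i * (c powr p + p * c powr (p - 1) * (t i - c)))"
    proof -
      have 1: "p * c powr (p - 1) * c = p * c powr p" using c by (simp add: powr_diff)
      have 2: "(\<Sum>i\<in>I. m i * (c powr p + p * c powr (p - 1) * (t i - c)))
         = (c powr p - p * c powr (p - 1) * c) * (\<Sum>i\<in>I. m i)
           + p * c powr (p - 1) * (\<Sum>i\<in>I. m i * t i)"
      proof -
        have "(\<Sum>i\<in>I. m i * (c powr p + p * c powr (p - 1) * (t i - c)))
          = (\<Sum>i\<in>I. (c powr p - p * c powr (p - 1) * c) * m i + p * c powr (p - 1) * (m i * t i))"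
          by (intro sum.cong) (auto simp: algebra_simps)
        then show ?thesis by (simp only: sum.distrib sum_distrib_left)
      qed
      show ?thesis unfolding 2 c_def[symmetric] 1 by (simp only: algebra_simps)
    qed
    also have "\<dots> \<le> (\<Sum>i\<in>I. m i * t i powr p)"
      using m t c p by (intro sum_mono mult_left_mono powr_tangent_le) auto
    finally show ?thesis by (simp add: c_def)
  qed
qed

text \<open>The absolute values make this a seminorm on arbitrary real families, so that no sign conditions
  have to be carried along.\<close>

definition pnorm :: "real \<Rightarrow> 'i set \<Rightarrow> ('i \<Rightarrow> real) \<Rightarrow> real" where
  "pnorm p I x = (\<Sum>i\<in>I. \<bar>x i\<bar> powr p) powr (1 / p)"

lemma pnorm_nonneg [simp]: "0 \<le> pnorm p I x"
  by (simp add: pnorm_def)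

lemma pnorm_powr: "0 < p \<Longrightarrow> pnorm p I x powr p = (\<Sum>i\<in>I. \<bar>x i\<bar> powr p)"
  by (simp add: pnorm_def powr_powr sum_nonneg)

lemma pnorm_le_iff:
  assumes "0 < p" "0 \<le> K"
  shows "pnorm p I x \<le> K \<longleftrightarrow> (\<Sum>i\<in>I. \<bar>x i\<bar> powr p) \<le> K powr p"
proof -
  have "pnorm p I x \<le> K \<longleftrightarrow> pnorm p I x powr p \<le> K powr p"
    using assms by (metis pnorm_nonneg linorder_not_less powr_less_mono2 powr_mono2 less_imp_le)
  then show ?thesis using assms by (simp add: pnorm_powr)
qed

lemma pnorm_cong: "(\<And>i. i \<in> I \<Longrightarrow> \<bar>x i\<bar> = \<bar>y i\<bar>) \<Longrightarrow> pnorm p I x = pnorm p I y"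
  by (simp add: pnorm_def)

lemma pnorm_mono:
  assumes "0 < p" "\<And>i. i \<in> I \<Longrightarrow> \<bar>x i\<bar> \<le> \<bar>y i\<bar>"
  shows "pnorm p I x \<le> pnorm p I y"
  unfolding pnorm_def using assms by (intro powr_mono2 sum_mono sum_nonneg) auto

lemma pnorm_mono_set:
  assumes "0 < p" "finite J" "I \<subseteq> J"
  shows "pnorm p I x \<le> pnorm p J x"
  unfolding pnorm_def using assms by (intro powr_mono2 sum_mono2 sum_nonneg) auto

lemma pnorm_scale: "0 < p \<Longrightarrow> pnorm p I (\<lambda>i. c * x i) = \<bar>c\<bar> * pnorm p I x"
  by (simp add: pnorm_def abs_mult powr_mult sum_distrib_left[symmetric] powr_powr)

lemma pnorm_reindex: "inj_on h I \<Longrightarrow> pnorm p (h ` I) x = pnorm p I (\<lambda>i. x (h i))"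
  by (simp add: pnorm_def sum.reindex)

lemma abs_le_pnorm:
  assumes "0 < p" "finite I" "i \<in> I"
  shows "\<bar>x i\<bar> \<le> pnorm p I x"
proof -
  have "\<bar>x i\<bar> = pnorm p {i} x" using assms by (simp add: pnorm_def powr_powr)
  also have "\<dots> \<le> pnorm p I x" using assms by (intro pnorm_mono_set) auto
  finally show ?thesis .
qed

lemma pnorm_zero [simp]: "pnorm p I (\<lambda>i. 0) = 0" by (simp add: pnorm_def)

text \<open>Minkowski's inequality: normalise both families and apply convexity with the weights
  \<open>a / (a + b)\<close> and \<open>b / (a + b)\<close>.\<close>

lemma pnorm_triangle:
  assumes p: "1 \<le> p" and I: "finite I"
  shows "pnorm p I (\<lambda>i. x i + y i) \<le> pnorm p I x + pnorm p I y"
proof -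
  define a where "a = pnorm p I x"
  define b where "b = pnorm p I y"
  have ab: "0 \<le> a" "0 \<le> b" by (auto simp: a_def b_def)
  consider "a = 0" | "b = 0" | "0 < a" "0 < b" using ab by linarith
  then show ?thesis
  proof cases
    case 1
    then have "x i = 0" if "i \<in> I" for i using abs_le_pnorm[of p I i x] that p I by (simp add: a_def)
    then have "pnorm p I (\<lambda>i. x i + y i) = pnorm p I y" by (intro pnorm_cong) auto
    then show ?thesis by simp
  next
    case 2
    then have "y i = 0" if "i \<in> I" for i using abs_le_pnorm[of p I i y] that p I by (simp add: b_def)
    then have "pnorm p I (\<lambda>i. x i + y i) = pnorm p I x" by (intro pnorm_cong) auto
    then show ?thesis by simp
  next
    case 3
    define l where "l = a / (a + b)"
    have l: "0 \<le> l" "l \<le> 1" "1 - l = b / (a + b)" using 3 by (auto simp: l_def field_simps)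
    have pt: "\<bar>x i + y i\<bar> powr p \<le> (a + b) powr p *
        (l * (\<bar>x i\<bar> powr p / a powr p) + (1 - l) * (\<bar>y i\<bar> powr p / b powr p))" for i
    proof -
      have "\<bar>x i + y i\<bar> \<le> (a + b) * (l * (\<bar>x i\<bar> / a) + (1 - l) * (\<bar>y i\<bar> / b))"
      proof -
        have "(a + b) * l = a" "(a + b) * (1 - l) = b" using 3 unfolding l(3) by (auto simp: l_def)
        moreover have "(a + b) * (l * (\<bar>x i\<bar> / a) + (1 - l) * (\<bar>y i\<bar> / b))
          = ((a + b) * l) * (\<bar>x i\<bar> / a) + ((a + b) * (1 - l)) * (\<bar>y i\<bar> / b)"
          by (simp only: distrib_left mult.assoc)
        ultimately show ?thesis using 3 by simp
      qed
      then have "\<bar>x i + y i\<bar> powr p \<le> ((a + b) * (l * (\<bar>x i\<bar> / a) + (1 - l) * (\<bar>y i\<bar> / b))) powr p"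
        using p by (intro powr_mono2) auto
      also have "\<dots> = (a + b) powr p * (l * (\<bar>x i\<bar> / a) + (1 - l) * (\<bar>y i\<bar> / b)) powr p"
        using 3 l by (intro powr_mult)
      also have "(l * (\<bar>x i\<bar> / a) + (1 - l) * (\<bar>y i\<bar> / b)) powr p
          \<le> l * (\<bar>x i\<bar> / a) powr p + (1 - l) * (\<bar>y i\<bar> / b) powr p"
        using powr_jensen_subprobability[of p "UNIV :: bool set" "\<lambda>z. if z then l else 1 - l"
            "\<lambda>z. if z then \<bar>x i\<bar> / a else \<bar>y i\<bar> / b"] p l(1,2) 3
        by (simp add: UNIV_bool add.commute)
      finally show ?thesis using 3 by (simp add: powr_divide mult_left_mono)
    qed
    have "(\<Sum>i\<in>I. \<bar>x i + y i\<bar> powr p) \<le> (\<Sum>i\<in>I. (a + b) powr p *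
        (l * (\<bar>x i\<bar> powr p / a powr p) + (1 - l) * (\<bar>y i\<bar> powr p / b powr p)))"
      by (intro sum_mono pt)
    also have "\<dots> = (a + b) powr p * (l * (a powr p / a powr p) + (1 - l) * (b powr p / b powr p))"
      using p by (simp add: a_def b_def pnorm_powr sum_distrib_left[symmetric] sum.distrib
          sum_divide_distrib[symmetric])
    also have "\<dots> = (a + b) powr p" using 3 by simp
    finally show ?thesis using p 3 by (subst pnorm_le_iff) (auto simp: a_def b_def)
  qed
qed

lemma pnorm_sum_le:
  assumes "1 \<le> p" "finite I" "finite J"
  shows "pnorm p I (\<lambda>i. \<Sum>j\<in>J. x j i) \<le> (\<Sum>j\<in>J. pnorm p I (x j))"
  using assms(3)
proof (induction J rule: finite_induct)
  case (insert j J)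
  then show ?case
    using pnorm_triangle[OF assms(1,2), of "x j" "\<lambda>i. \<Sum>j\<in>J. x j i"] by simp
qed simp

lemma pnorm_le_sum:
  assumes p: "1 \<le> p" and "finite I"
  shows "pnorm p I x \<le> (\<Sum>i\<in>I. \<bar>x i\<bar>)"
  using assms(2)
proof (induction I rule: finite_induct)
  case (insert j I)
  have "pnorm p (insert j I) x =
    pnorm p (insert j I) (\<lambda>i. (if i = j then x j else 0) + (if i = j then 0 else x i))"
    by (intro pnorm_cong) auto
  also have "\<dots> \<le> pnorm p (insert j I) (\<lambda>i. (if i = j then x j else 0))
      + pnorm p (insert j I) (\<lambda>i. (if i = j then 0 else x i))"
    using insert p by (intro pnorm_triangle) auto
  also have "pnorm p (insert j I) (\<lambda>i. (if i = j then x j else 0)) = \<bar>x j\<bar>"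
  proof -
    have "(\<Sum>i\<in>I. \<bar>if i = j then x j else 0\<bar> powr p) = 0"
      using insert by (intro sum.neutral) auto
    then show ?thesis using insert p by (simp add: pnorm_def powr_powr)
  qed
  also have "pnorm p (insert j I) (\<lambda>i. (if i = j then 0 else x i)) = pnorm p I x"
  proof -
    have "(\<Sum>i\<in>I. \<bar>if i = j then 0 else x i\<bar> powr p) = (\<Sum>i\<in>I. \<bar>x i\<bar> powr p)"
      using insert by (intro sum.cong) auto
    then show ?thesis using insert by (simp add: pnorm_def)
  qed
  finally show ?case using insert by simp
qed (simp add: pnorm_def)

text \<open>A doubly substochastic matrix contracts every p-norm: Jensen along the rows, then the column
  sums. This is what turns the Bessel inequality into bounds for singular values.\<close>

lemma pnorm_substochastic:
  fixes m :: "'j \<Rightarrow> 'i \<Rightarrow> real"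
  assumes p: "1 \<le> p" and I: "finite I" and J: "finite J"
    and m: "\<And>j i. j \<in> J \<Longrightarrow> i \<in> I \<Longrightarrow> 0 \<le> m j i"
    and rows: "\<And>j. j \<in> J \<Longrightarrow> (\<Sum>i\<in>I. m j i) \<le> 1"
    and cols: "\<And>i. i \<in> I \<Longrightarrow> (\<Sum>j\<in>J. m j i) \<le> 1"
  shows "pnorm p J (\<lambda>j. \<Sum>i\<in>I. m j i * \<bar>t i\<bar>) \<le> pnorm p I t"
proof -
  have "(\<Sum>j\<in>J. \<bar>\<Sum>i\<in>I. m j i * \<bar>t i\<bar>\<bar> powr p) \<le> (\<Sum>j\<in>J. \<Sum>i\<in>I. m j i * \<bar>t i\<bar> powr p)"
  proof (rule sum_mono)
    fix j assume j: "j \<in> J"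
    have "\<bar>\<Sum>i\<in>I. m j i * \<bar>t i\<bar>\<bar> = (\<Sum>i\<in>I. m j i * \<bar>t i\<bar>)"
      using m j by (intro abs_of_nonneg sum_nonneg) auto
    then show "\<bar>\<Sum>i\<in>I. m j i * \<bar>t i\<bar>\<bar> powr p \<le> (\<Sum>i\<in>I. m j i * \<bar>t i\<bar> powr p)"
      using powr_jensen_subprobability[of p I "m j" "\<lambda>i. \<bar>t i\<bar>"] m j p rows by simp
  qed
  also have "\<dots> = (\<Sum>i\<in>I. (\<Sum>j\<in>J. m j i) * \<bar>t i\<bar> powr p)"
    by (subst sum.swap) (simp add: sum_distrib_right)
  also have "\<dots> \<le> (\<Sum>i\<in>I. 1 * \<bar>t i\<bar> powr p)"
    using cols by (intro sum_mono mult_right_mono) auto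
  finally show ?thesis using p by (subst pnorm_le_iff) (auto simp: pnorm_powr)
qed

text \<open>Both the Schatten norm and the norm of \<open>\<ell>\<^sub>p\<close> are defined by series; this reduces them to finite
  p-norms.\<close>

lemma summable_powr_iff_pnorm_bounded:
  fixes x :: "nat \<Rightarrow> real"
  assumes p: "0 < p" and K: "0 \<le> K"
  shows "summable (\<lambda>i. \<bar>x i\<bar> powr p) \<and> (\<Sum>i. \<bar>x i\<bar> powr p) powr (1 / p) \<le> K
    \<longleftrightarrow> (\<forall>n. pnorm p {..<n} x \<le> K)"
proof safe
  fix n
  assume s: "summable (\<lambda>i. \<bar>x i\<bar> powr p)" and le: "(\<Sum>i. \<bar>x i\<bar> powr p) powr (1 / p) \<le> K"
  have "pnorm p {..<n} x \<le> (\<Sum>i. \<bar>x i\<bar> powr p) powr (1 / p)"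
    unfolding pnorm_def using p s by (intro powr_mono2 sum_le_suminf sum_nonneg) auto
  then show "pnorm p {..<n} x \<le> K" using le by simp
next
  assume *: "\<forall>n. pnorm p {..<n} x \<le> K"
  then have b: "(\<Sum>i<n. \<bar>x i\<bar> powr p) \<le> K powr p" for n
    using p K by (simp add: pnorm_le_iff)
  show s: "summable (\<lambda>i. \<bar>x i\<bar> powr p)"
    using b by (intro summableI_nonneg_bounded) auto
  have "(\<Sum>i. \<bar>x i\<bar> powr p) \<le> K powr p" using b s by (intro suminf_le_const) auto
  then have "(\<Sum>i. \<bar>x i\<bar> powr p) powr (1 / p) \<le> (K powr p) powr (1 / p)"
    using p by (intro powr_mono2 suminf_nonneg s) auto
  then show "(\<Sum>i. \<bar>x i\<bar> powr p) powr (1 / p) \<le> K" using p K by (simp add: powr_powr)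
qed

lemma tendsto_pnorm:
  assumes p: "0 < p" and I: "finite I" and lim: "\<And>i. i \<in> I \<Longrightarrow> (\<lambda>n. x n i) \<longlonglongrightarrow> y i"
  shows "(\<lambda>n. pnorm p I (x n)) \<longlonglongrightarrow> pnorm p I y"
  unfolding pnorm_def
proof (rule tendsto_powr')
  show "(\<lambda>n. \<Sum>i\<in>I. \<bar>x n i\<bar> powr p) \<longlonglongrightarrow> (\<Sum>i\<in>I. \<bar>y i\<bar> powr p)"
  proof (rule tendsto_sum, rule tendsto_powr')
    fix i assume "i \<in> I"
    then show "(\<lambda>n. \<bar>x n i\<bar>) \<longlonglongrightarrow> \<bar>y i\<bar>" using lim by (intro tendsto_rabs)
  qed (use p in auto)
qed (use p in \<open>auto intro!: always_eventually sum_nonneg\<close>)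

lemma pnorm_Sigma:
  assumes p: "0 < p" and F: "finite F" and I: "\<And>k. k \<in> F \<Longrightarrow> finite (I k)"
  shows "pnorm p (Sigma F I) (\<lambda>(k, i). x k i) = pnorm p F (\<lambda>k. pnorm p (I k) (x k))"
proof -
  have "(\<Sum>(k, i)\<in>Sigma F I. \<bar>x k i\<bar> powr p) = (\<Sum>k\<in>F. \<Sum>i\<in>I k. \<bar>x k i\<bar> powr p)"
    using F I by (subst sum.Sigma) auto
  also have "\<dots> = (\<Sum>k\<in>F. \<bar>pnorm p (I k) (x k)\<bar> powr p)" using p by (simp add: pnorm_powr)
  finally show ?thesis by (simp add: pnorm_def[of p "Sigma F I"] pnorm_def[of p F] case_prod_unfold)
qed

text \<open>The weights \<open>a\<^sub>i\<^sup>p\<^sup>-\<^sup>1\<close>, suitably normalised, form a norming functional of \<open>a\<close>. That its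
  norm is 1 follows from Jensen's inequality with the probabilities \<open>(a\<^sub>i / n)\<^sup>p\<close>, uniformly in
  \<open>p \<ge> 1\<close>.\<close>

lemma norming_weights:
  fixes a :: "'i \<Rightarrow> real"
  assumes p: "1 \<le> p" and I: "finite I" and a: "\<And>i. i \<in> I \<Longrightarrow> 0 \<le> a i" and pos: "0 < pnorm p I a"
  shows "\<exists>w. (\<forall>i. 0 \<le> w i) \<and> (\<Sum>i\<in>I. w i * a i) = pnorm p I a \<and>
     (\<forall>z. (\<Sum>i\<in>I. w i * \<bar>z i\<bar>) \<le> pnorm p I z)"
proof -
  define n where "n = pnorm p I a"
  have n: "0 < n" using pos by (simp add: n_def)
  have np: "n powr p = (\<Sum>i\<in>I. a i powr p)" unfolding n_def using p a by (simp add: pnorm_powr)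
  define w where "w i = a i powr (p - 1) / n powr (p - 1)" for i
  have w0: "0 \<le> w i" for i by (simp add: w_def)
  have "w i * a i = a i powr p / n powr (p - 1)" if "i \<in> I" for i
    using a[OF that] by (cases "a i = 0") (auto simp: w_def powr_diff)
  then have "(\<Sum>i\<in>I. w i * a i) = n powr p / n powr (p - 1)"
    by (simp add: np sum_divide_distrib)
  also have "\<dots> = n" using n by (simp add: powr_diff)
  finally have 1: "(\<Sum>i\<in>I. w i * a i) = n" .
  have 2: "(\<Sum>i\<in>I. w i * \<bar>z i\<bar>) \<le> pnorm p I z" for z
  proof -
    define t where "t i = (if a i = 0 then 0 else n * \<bar>z i\<bar> / a i)" for i
    define l where "l i = (a i / n) powr p" for i
    have l: "0 \<le> l i" "(\<Sum>i\<in>I. l i) \<le> 1" for i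
    proof -
      show "0 \<le> l i" by (simp add: l_def)
      have "(\<Sum>i\<in>I. l i) = (\<Sum>i\<in>I. a i powr p / n powr p)"
        using a n by (intro sum.cong) (auto simp: l_def powr_divide)
      also have "\<dots> = 1" using n by (simp flip: sum_divide_distrib np)
      finally show "(\<Sum>i\<in>I. l i) \<le> 1" by simp
    qed
    have t0: "0 \<le> t i" if "i \<in> I" for i using a[OF that] n by (simp add: t_def)
    have eq: "w i * \<bar>z i\<bar> = l i * t i" if "i \<in> I" for i
    proof (cases "a i = 0")
      case False
      then have ai: "0 < a i" using a[OF that] by simp
      have "l i * t i = a i powr p / n powr p * (n * \<bar>z i\<bar> / a i)"
        using ai n by (simp add: l_def t_def powr_divide)
      also have "\<dots> = (a i powr p / a i) / (n powr p / n) * \<bar>z i\<bar>" by (simp add: mult_ac)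
      also have "\<dots> = w i * \<bar>z i\<bar>" using ai n by (simp add: w_def powr_diff)
      finally show ?thesis by simp
    qed (simp add: w_def t_def)
    have le: "l i * t i powr p \<le> \<bar>z i\<bar> powr p" if "i \<in> I" for i
    proof (cases "a i = 0")
      case False
      then have ai: "0 < a i" using a[OF that] by simp
      have "l i * t i powr p = (a i / n * t i) powr p"
        by (simp only: l_def powr_mult)
      also have "a i / n * t i = \<bar>z i\<bar>" using ai n by (simp add: t_def)
      finally show ?thesis by simp
    qed (use p in \<open>simp add: t_def\<close>)
    have "(\<Sum>i\<in>I. w i * \<bar>z i\<bar>) powr p = (\<Sum>i\<in>I. l i * t i) powr p" using eq by simp
    also have "\<dots> \<le> (\<Sum>i\<in>I. l i * t i powr p)"
      using l t0 by (intro powr_jensen_subprobability p) auto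
    also have "\<dots> \<le> (\<Sum>i\<in>I. \<bar>z i\<bar> powr p)" by (intro sum_mono le)
    finally have "((\<Sum>i\<in>I. w i * \<bar>z i\<bar>) powr p) powr (1 / p) \<le> pnorm p I z"
      unfolding pnorm_def using p by (intro powr_mono2) auto
    moreover have "0 \<le> (\<Sum>i\<in>I. w i * \<bar>z i\<bar>)" using w0 by (intro sum_nonneg) auto
    ultimately show ?thesis using p by (simp add: powr_powr)
  qed
  show ?thesis using w0 1 2 unfolding n_def by (intro exI[of _ w]) simp
qed

section \<open>Complex inner product spaces\<close>

instance chilbert_space \<subseteq> banach ..

definition clinear :: "('a::complex_vector \<Rightarrow> 'b::complex_vector) \<Rightarrow> bool" where
  "clinear A \<longleftrightarrow> (\<forall>x y. A (x + y) = A x + A y) \<and> (\<forall>a x. A (a *\<^sub>C x) = a *\<^sub>C A x)"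

lemma clinear_add: "clinear A \<Longrightarrow> A (x + y) = A x + A y"
  and clinear_scaleC: "clinear A \<Longrightarrow> A (a *\<^sub>C x) = a *\<^sub>C A x"
  by (auto simp: clinear_def)

lemma scaleC_minus_one: "(-1) *\<^sub>C x = - (x::'a::complex_vector)"
  using cvs.scale_minus_left[of 1 x] by simp

lemma clinear_zero: "clinear A \<Longrightarrow> A 0 = 0"
  using clinear_scaleC[of A 0 0] by simp

lemma clinear_minus: "clinear A \<Longrightarrow> A (- x) = - A x"
  using clinear_scaleC[of A "-1" x] by (simp add: scaleC_minus_one)

lemma clinear_diff: "clinear A \<Longrightarrow> A (x - y) = A x - A y"
  using clinear_add[of A x "- y"] by (simp add: clinear_minus)

lemma clinear_sum: "clinear A \<Longrightarrow> A (\<Sum>i\<in>I. f i) = (\<Sum>i\<in>I. A (f i))"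
  by (induction I rule: infinite_finite_induct) (auto simp: clinear_zero clinear_add)

lemma cinner_add_left: "cinner (x + y) z = cinner x z + cinner (y::'h::complex_inner) z"
  by (metis cinner_commute cinner_add_right complex_cnj_add)

lemma cinner_scaleC_left: "cinner (a *\<^sub>C x) y = cnj a * cinner (x::'h::complex_inner) y"
  by (metis cinner_commute cinner_scaleC_right complex_cnj_mult)

lemma cinner_zero_right [simp]: "cinner (x::'h::complex_inner) 0 = 0"
  using cinner_scaleC_right[of x 0 0] by simp

lemma cinner_zero_left [simp]: "cinner 0 (x::'h::complex_inner) = 0"
  using cinner_scaleC_left[of 0 0 x] by simp

lemma cinner_minus_right [simp]: "cinner (x::'h::complex_inner) (- y) = - cinner x y"
  using cinner_scaleC_right[of x "-1" y] by (simp add: scaleC_minus_one)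

lemma cinner_minus_left [simp]: "cinner (- x) (y::'h::complex_inner) = - cinner x y"
  using cinner_scaleC_left[of "-1" x y] by (simp add: scaleC_minus_one)

lemma cinner_diff_right: "cinner (x::'h::complex_inner) (y - z) = cinner x y - cinner x z"
  using cinner_add_right[of x y "- z"] by simp

lemma cinner_diff_left: "cinner (x - y) (z::'h::complex_inner) = cinner x z - cinner y z"
  using cinner_add_left[of x "- y" z] by simp

lemma cinner_sum_right: "cinner (x::'h::complex_inner) (\<Sum>i\<in>I. f i) = (\<Sum>i\<in>I. cinner x (f i))"
  by (induction I rule: infinite_finite_induct) (auto simp: cinner_add_right)

lemma cinner_sum_left: "cinner (\<Sum>i\<in>I. f i) (x::'h::complex_inner) = (\<Sum>i\<in>I. cinner (f i) x)"
  by (induction I rule: infinite_finite_induct) (auto simp: cinner_add_left)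

lemma nonneg_Reals_complexD:
  assumes "z \<in> \<real>\<^sub>\<ge>\<^sub>0" shows "Im z = 0" "0 \<le> Re z" "z = complex_of_real (Re z)"
  using assms by (auto simp: nonneg_Reals_def complex_eq_iff)

lemma cinner_self: "cinner x x = complex_of_real ((norm (x::'h::complex_inner))\<^sup>2)"
proof -
  have "(norm x)\<^sup>2 = Re (cinner x x)"
    using nonneg_Reals_complexD(2)[OF cinner_self_nonneg[of x]] by (simp add: norm_eq_sqrt_cinner)
  then show ?thesis using nonneg_Reals_complexD(3)[OF cinner_self_nonneg[of x]] by simp
qed

lemma norm_square_eq: "(norm (x::'h::complex_inner))\<^sup>2 = Re (cinner x x)"
  by (simp add: cinner_self)

lemma norm_scaleC: "norm (a *\<^sub>C (x::'h::complex_inner)) = cmod a * norm x"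
proof -
  have "(norm (a *\<^sub>C x))\<^sup>2 = Re (cnj a * a * complex_of_real ((norm x)\<^sup>2))"
    by (simp only: norm_square_eq[of "a *\<^sub>C x"] cinner_scaleC_left cinner_scaleC_right
        cinner_self[of x] mult_ac)
  also have "cnj a * a = complex_of_real ((cmod a)\<^sup>2)"
    by (metis complex_norm_square mult.commute)
  also have "Re (complex_of_real ((cmod a)\<^sup>2) * complex_of_real ((norm x)\<^sup>2)) = (cmod a * norm x)\<^sup>2"
    by (simp add: power_mult_distrib flip: of_real_mult of_real_power)
  finally show ?thesis by (simp add: power2_eq_iff_nonneg)
qed

lemma positive_form_hermitian:
  assumes A: "clinear A" and pos: "\<And>x. cinner x (A x) \<in> \<real>\<^sub>\<ge>\<^sub>0"
  shows "cinner f (A e) = cnj (cinner (e::'h::complex_inner) (A f))"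
proof -
  have *: "Im (cinner (e + t *\<^sub>C f) (A (e + t *\<^sub>C f))) = 0" for t
    using nonneg_Reals_complexD(1)[OF pos] .
  have e: "Im (cinner e (A e)) = 0" and f: "Im (cinner f (A f)) = 0"
    using nonneg_Reals_complexD(1)[OF pos] by auto
  show ?thesis
    using *[of 1] *[of \<i>] e f
    by (simp add: clinear_add[OF A] clinear_scaleC[OF A] cinner_add_left cinner_add_right
        cinner_scaleC_left cinner_scaleC_right complex_eq_iff)
qed

text \<open>Stated for the form of a positive operator, since it serves twice: with the identity it is the
  Cauchy-Schwarz inequality of the space, and for positive operators it bounds the off-diagonal
  corners of a block matrix by the diagonal ones.\<close>

lemma positive_form_Cauchy_Schwarz:
  assumes A: "clinear A" and pos: "\<And>x. cinner x (A x) \<in> \<real>\<^sub>\<ge>\<^sub>0"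
  shows "(cmod (cinner (e::'h::complex_inner) (A f)))\<^sup>2 \<le> Re (cinner e (A e)) * Re (cinner f (A f))"
proof -
  define a where "a = Re (cinner e (A e))"
  define c where "c = Re (cinner f (A f))"
  define z where "z = cinner e (A f)"
  have ea: "cinner e (A e) = of_real a" and fc: "cinner f (A f) = of_real c"
    using nonneg_Reals_complexD(3)[OF pos] by (auto simp: a_def c_def)
  have a0: "0 \<le> a" and c0: "0 \<le> c" using nonneg_Reals_complexD(2)[OF pos] by (auto simp: a_def c_def)
  have zz: "z * cnj z = of_real ((cmod z)\<^sup>2)" by (rule complex_norm_square[symmetric])
  \<comment> \<open>Positivity at \<open>e - t z\<^sup>* f\<close>, where \<open>z\<^sup>*\<close> is the conjugate of \<open>z\<close>; the choice of
    the phase makes both cross terms equal to \<open>- t |z|\<^sup>2\<close>.\<close>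
  have key: "0 \<le> a - 2 * t * (cmod z)\<^sup>2 + t\<^sup>2 * (cmod z)\<^sup>2 * c" for t :: real
  proof -
    define s where "s = - of_real t * cnj z"
    have "0 \<le> Re (cinner (e + s *\<^sub>C f) (A (e + s *\<^sub>C f)))"
      using nonneg_Reals_complexD(2)[OF pos] .
    also have "cinner (e + s *\<^sub>C f) (A (e + s *\<^sub>C f))
      = of_real a + s * z + cnj s * cnj z + cnj s * s * of_real c"
      using positive_form_hermitian[OF A pos, of f e]
      by (simp add: clinear_add[OF A] clinear_scaleC[OF A] cinner_add_left cinner_add_right
        cinner_scaleC_left cinner_scaleC_right ea fc z_def algebra_simps)
    also have "s * z = - of_real (t * (cmod z)\<^sup>2)" using zz by (simp add: s_def mult.commute)
    also have "cnj s * cnj z = - of_real (t * (cmod z)\<^sup>2)" using zz by (simp add: s_def)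
    also have "cnj s * s = of_real (t\<^sup>2 * (cmod z)\<^sup>2)"
    proof -
      have "cnj s * s = of_real t * of_real t * (z * cnj z)" by (simp add: s_def mult_ac)
      then show ?thesis unfolding zz by (simp add: power2_eq_square)
    qed
    finally show ?thesis by (simp flip: of_real_mult of_real_power)
  qed
  have "(cmod z)\<^sup>2 \<le> a * c"
  proof (cases "c = 0")
    case True
    have "(cmod z)\<^sup>2 = 0"
    proof (rule ccontr)
      assume nz: "(cmod z)\<^sup>2 \<noteq> 0"
      have "0 \<le> a - 2 * ((a + 1) / (cmod z)\<^sup>2) * (cmod z)\<^sup>2"
        using key[of "(a + 1) / (cmod z)\<^sup>2"] True by simp
      then have "0 \<le> a - 2 * (a + 1)" using nz by simp
      then show False using a0 by simp
    qed
    then show ?thesis using True by simp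
  next
    case False
    then have c: "0 < c" using c0 by simp
    have "0 \<le> a - 2 * (1 / c) * (cmod z)\<^sup>2 + (1 / c)\<^sup>2 * (cmod z)\<^sup>2 * c" by (rule key)
    also have "\<dots> = a - (cmod z)\<^sup>2 / c" using c by (simp add: field_simps power2_eq_square)
    finally show ?thesis using c by (simp add: field_simps)
  qed
  then show ?thesis by (simp add: a_def c_def z_def)
qed

lemma cinner_Cauchy_Schwarz: "cmod (cinner x y) \<le> norm x * norm (y::'h::complex_inner)"
proof -
  have "(cmod (cinner x y))\<^sup>2 \<le> Re (cinner x x) * Re (cinner y y)"
    using positive_form_Cauchy_Schwarz[of "\<lambda>x. x" x y] by (simp add: clinear_def cinner_self_nonneg)
  also have "\<dots> = (norm x * norm y)\<^sup>2" by (simp add: norm_square_eq power_mult_distrib)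
  finally show ?thesis by (rule power2_le_imp_le) simp
qed

lemma bounded_bilinear_cinner: "bounded_bilinear (cinner :: 'h::complex_inner \<Rightarrow> 'h \<Rightarrow> complex)"
proof
  show "\<exists>K. \<forall>a b. cmod (cinner a b) \<le> norm a * norm (b::'h) * K"
    by (rule exI[of _ 1]) (simp add: cinner_Cauchy_Schwarz)
qed (auto simp: cinner_add_left cinner_add_right cinner_scaleC_left cinner_scaleC_right
    scaleR_scaleC scaleR_conv_of_real[where 'a=complex])

lemma bounded_bilinear_scaleC: "bounded_bilinear (scaleC :: complex \<Rightarrow> 'h \<Rightarrow> 'h::complex_inner)"
proof
  show "\<exists>K. \<forall>a b. norm (a *\<^sub>C b) \<le> norm a * norm (b::'h) * K"
    by (rule exI[of _ 1]) (simp add: norm_scaleC)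
qed (auto simp: scaleC_add_left scaleC_add_right scaleC_scaleC scaleR_scaleC
    scaleR_conv_of_real[where 'a=complex] mult.commute)

lemmas tendsto_cinner [tendsto_intros] = bounded_bilinear.tendsto[OF bounded_bilinear_cinner]
lemmas tendsto_scaleC [tendsto_intros] = bounded_bilinear.tendsto[OF bounded_bilinear_scaleC]

lemma parallelogram_law:
  "(norm (x + y))\<^sup>2 + (norm (x - y))\<^sup>2 = 2 * (norm x)\<^sup>2 + 2 * (norm (y::'h::complex_inner))\<^sup>2"
  by (simp add: norm_square_eq cinner_add_left cinner_add_right cinner_diff_left cinner_diff_right)

lemma norm_add_orthogonal:
  "cinner x y = 0 \<Longrightarrow> (norm (x + y))\<^sup>2 = (norm x)\<^sup>2 + (norm (y::'h::complex_inner))\<^sup>2"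
  using cinner_commute[of y x] by (simp add: norm_square_eq cinner_add_left cinner_add_right)

lemma cinner_eq_0_all: "(\<And>x. cinner x y = 0) \<Longrightarrow> y = (0::'h::complex_inner)"
  using cinner_self_eq_0 by blast

section \<open>Bessel systems and orthogonal projections\<close>

text \<open>Finite families that satisfy the Bessel inequality replace orthonormal families throughout. They
  are stable under projections, under truncation and under averages, none of which preserves
  orthonormality.\<close>

definition bessel :: "'i set \<Rightarrow> ('i \<Rightarrow> 'h::complex_inner) \<Rightarrow> bool" where
  "bessel I e \<longleftrightarrow> finite I \<and> (\<forall>x. (\<Sum>i\<in>I. (cmod (cinner (e i) x))\<^sup>2) \<le> (norm x)\<^sup>2)"

lemma besselD: "bessel I e \<Longrightarrow> (\<Sum>i\<in>I. (cmod (cinner (e i) x))\<^sup>2) \<le> (norm x)\<^sup>2"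
  and bessel_finite: "bessel I e \<Longrightarrow> finite I"
  by (auto simp: bessel_def)

lemma bessel_norm_le: assumes "bessel I e" "i \<in> I" shows "norm (e i) \<le> 1"
proof -
  have "(cmod (cinner (e i) (e i)))\<^sup>2 \<le> (\<Sum>j\<in>I. (cmod (cinner (e j) (e i)))\<^sup>2)"
    using assms by (intro member_le_sum) (auto simp: bessel_def)
  also have "\<dots> \<le> (norm (e i))\<^sup>2" using besselD[OF assms(1)] .
  finally have "((norm (e i))\<^sup>2)\<^sup>2 \<le> (norm (e i))\<^sup>2" by (simp add: cinner_self norm_power)
  then have "(norm (e i))\<^sup>2 * ((norm (e i))\<^sup>2 - 1) \<le> 0"
    by (simp add: power2_eq_square algebra_simps)
  then have "(norm (e i))\<^sup>2 \<le> 1"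
    unfolding mult_le_0_iff by auto
  then show ?thesis by (simp add: power_le_one_iff)
qed

lemma bessel_subset: "bessel I e \<Longrightarrow> J \<subseteq> I \<Longrightarrow> bessel J e"
  unfolding bessel_def
  by (meson finite_subset order_trans sum_mono2 zero_le_power2)

text \<open>Used for polarisation, where the four vectors \<open>(v + \<i>\<^sup>k u) / 2\<close> must again form Bessel families.\<close>

lemma bessel_half_sum:
  assumes "bessel I u" "bessel I v" "cmod a = 1"
  shows "bessel I (\<lambda>i. (1/2) *\<^sub>C (v i + a *\<^sub>C u i))"
  unfolding bessel_def
proof safe
  show "finite I" using assms bessel_finite by blast
  fix x
  have "(cmod (cinner ((1/2) *\<^sub>C (v i + a *\<^sub>C u i)) x))\<^sup>2
      \<le> ((cmod (cinner (v i) x))\<^sup>2 + (cmod (cinner (u i) x))\<^sup>2) / 2" for i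
  proof -
    have "cmod (cinner ((1/2) *\<^sub>C (v i + a *\<^sub>C u i)) x)
        \<le> (cmod (cinner (v i) x) + cmod (cinner (u i) x)) / 2"
      using norm_triangle_ineq[of "cinner (v i) x" "cnj a * cinner (u i) x"] assms(3)
      by (simp add: cinner_scaleC_left cinner_add_left norm_mult norm_divide)
    then have "(cmod (cinner ((1/2) *\<^sub>C (v i + a *\<^sub>C u i)) x))\<^sup>2
        \<le> ((cmod (cinner (v i) x) + cmod (cinner (u i) x)) / 2)\<^sup>2" by (rule power_mono) simp
    also have "\<dots> \<le> ((cmod (cinner (v i) x))\<^sup>2 + (cmod (cinner (u i) x))\<^sup>2) / 2"
      using zero_le_power2[of "cmod (cinner (v i) x) - cmod (cinner (u i) x)"]
      by (simp add: power2_eq_square algebra_simps)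
    finally show ?thesis .
  qed
  then have "(\<Sum>i\<in>I. (cmod (cinner ((1/2) *\<^sub>C (v i + a *\<^sub>C u i)) x))\<^sup>2)
      \<le> (\<Sum>i\<in>I. ((cmod (cinner (v i) x))\<^sup>2 + (cmod (cinner (u i) x))\<^sup>2) / 2)"
    by (intro sum_mono)
  also have "\<dots> = ((\<Sum>i\<in>I. (cmod (cinner (v i) x))\<^sup>2) + (\<Sum>i\<in>I. (cmod (cinner (u i) x))\<^sup>2)) / 2"
    by (simp add: sum.distrib flip: sum_divide_distrib)
  also have "\<dots> \<le> (norm x)\<^sup>2" using besselD[OF assms(1), of x] besselD[OF assms(2), of x] by simp
  finally show "(\<Sum>i\<in>I. (cmod (cinner ((1/2) *\<^sub>C (v i + a *\<^sub>C u i)) x))\<^sup>2) \<le> (norm x)\<^sup>2" .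
qed

text \<open>An orthonormal sequence in which some vectors may be zero. This lets finite-dimensional and
  infinite-dimensional situations, and operators of finite rank, be treated alike.\<close>

definition orthosys :: "(nat \<Rightarrow> 'h::complex_inner) \<Rightarrow> bool" where
  "orthosys b \<longleftrightarrow> (\<forall>i j. cinner (b i) (b j) = (if i = j \<and> b i \<noteq> 0 then 1 else 0))"

definition proj :: "(nat \<Rightarrow> 'h::complex_inner) \<Rightarrow> nat \<Rightarrow> 'h \<Rightarrow> 'h" where
  "proj b n x = (\<Sum>i<n. cinner (b i) x *\<^sub>C b i)"

lemma orthosys_cinner: "orthosys b \<Longrightarrow> i \<noteq> j \<Longrightarrow> cinner (b i) (b j) = 0"
  by (simp add: orthosys_def)

lemma orthosys_self: "orthosys b \<Longrightarrow> cinner (b i) (b i) *\<^sub>C b i = b i"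
  by (simp add: orthosys_def)

lemma cinner_orthosys_sum:
  assumes "orthosys b" "finite I"
  shows "cinner (b k) (\<Sum>i\<in>I. c i *\<^sub>C b i) = (if k \<in> I \<and> b k \<noteq> 0 then c k else 0)"
proof -
  have "cinner (b k) (\<Sum>i\<in>I. c i *\<^sub>C b i) = (\<Sum>i\<in>I. c i * (if k = i \<and> b k \<noteq> 0 then 1 else 0))"
    using assms(1) by (simp add: cinner_sum_right cinner_scaleC_right orthosys_def)
  also have "\<dots> = (\<Sum>i\<in>I. if i = k then (if b k \<noteq> 0 then c k else 0) else 0)"
    by (intro sum.cong) auto
  finally show ?thesis using assms(2) by (auto simp: sum.delta)
qed

lemma norm_orthosys_sum_le:
  assumes "orthosys b" "finite I"
  shows "(norm (\<Sum>i\<in>I. c i *\<^sub>C b i))\<^sup>2 \<le> (\<Sum>i\<in>I. (cmod (c i))\<^sup>2)"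
proof -
  have "cinner (\<Sum>i\<in>I. c i *\<^sub>C b i) (\<Sum>i\<in>I. c i *\<^sub>C b i)
      = (\<Sum>i\<in>I. cnj (c i) * (if b i \<noteq> 0 then c i else 0))"
    using assms by (simp add: cinner_sum_left cinner_scaleC_left cinner_orthosys_sum)
  also have "Re \<dots> \<le> (\<Sum>i\<in>I. (cmod (c i))\<^sup>2)"
  proof -
    have "Re (cnj z * z) = (cmod z)\<^sup>2" for z by (simp add: cmod_power2) (simp add: power2_eq_square)
    then show ?thesis by (auto simp: Re_sum simp del: times_complex.simps intro!: sum_mono)
  qed
  finally show ?thesis by (simp add: norm_square_eq)
qed

lemma proj_clinear: "clinear (proj b n)"
  unfolding clinear_def proj_def
  by (auto simp: cinner_add_right scaleC_add_left sum.distrib cinner_scaleC_right scaleC_scaleC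
      cvs.scale_sum_right)

lemma cinner_proj: "orthosys b \<Longrightarrow> cinner (b k) (proj b n x) = (if k < n then cinner (b k) x else 0)"
  unfolding proj_def by (subst cinner_orthosys_sum) auto

lemma proj_selfadjoint: "cinner (proj b n x) y = cinner x (proj b n y)"
  unfolding proj_def
  by (simp add: cinner_sum_left cinner_sum_right cinner_scaleC_left cinner_scaleC_right
      cinner_commute[of x "b _"] mult.commute)

lemma proj_proj: "orthosys b \<Longrightarrow> proj b m (proj b n x) = proj b (min m n) x"
proof -
  assume b: "orthosys b"
  have "proj b m (proj b n x) = (\<Sum>i<m. (if i < n then cinner (b i) x *\<^sub>C b i else 0))"
    unfolding proj_def[of b m] using cinner_proj[OF b] by (intro sum.cong) auto
  also have "\<dots> = (\<Sum>i\<in>{i\<in>{..<m}. i < n}. cinner (b i) x *\<^sub>C b i)"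
    by (rule sum.inter_filter[symmetric]) simp
  also have "{i\<in>{..<m}. i < n} = {..<min m n}" by auto
  finally show ?thesis by (simp add: proj_def)
qed

lemma norm_proj_pythagoras:
  assumes "orthosys b" shows "(norm x)\<^sup>2 = (norm (proj b n x))\<^sup>2 + (norm (x - proj b n x))\<^sup>2"
proof -
  have "cinner (proj b n x) (x - proj b n x) = 0"
    using assms by (simp add: proj_selfadjoint clinear_diff[OF proj_clinear] proj_proj)
  from norm_add_orthogonal[OF this] show ?thesis by simp
qed

lemma norm_proj_le: assumes "orthosys b" shows "norm (proj b n x) \<le> norm x"
proof (rule power2_le_imp_le)
  show "(norm (proj b n x))\<^sup>2 \<le> (norm x)\<^sup>2"
    using norm_proj_pythagoras[OF assms, of x n] zero_le_power2[of "norm (x - proj b n x)"] by linarith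
qed simp

lemma norm_diff_proj_le: assumes "orthosys b" shows "norm (x - proj b n x) \<le> norm x"
proof (rule power2_le_imp_le)
  show "(norm (x - proj b n x))\<^sup>2 \<le> (norm x)\<^sup>2"
    using norm_proj_pythagoras[OF assms, of x n] zero_le_power2[of "norm (proj b n x)"] by linarith
qed simp

lemma bessel_orthosys:
  assumes b: "orthosys b" and I: "finite I" shows "bessel I b"
  unfolding bessel_def
proof safe
  fix x
  define y where "y = (\<Sum>i\<in>I. cinner (b i) x *\<^sub>C b i)"
  have bz: "cinner (b i) x = 0" if "b i = 0" for i using that by simp
  have 1: "cinner y z = (\<Sum>i\<in>I. cnj (cinner (b i) x) * cinner (b i) z)" for z
    by (simp add: y_def cinner_sum_left cinner_scaleC_left)
  have yx: "cinner y y = (\<Sum>i\<in>I. cnj (cinner (b i) x) * cinner (b i) x)"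
    unfolding 1 using bz by (intro sum.cong) (auto simp: y_def cinner_orthosys_sum[OF b I])
  then have yy: "cinner y y = cinner y x" by (simp add: 1)
  then have "cinner y (x - y) = 0" by (simp add: cinner_diff_right)
  from norm_add_orthogonal[OF this] have "(norm y)\<^sup>2 \<le> (norm x)\<^sup>2" by simp
  moreover have "(norm y)\<^sup>2 = (\<Sum>i\<in>I. (cmod (cinner (b i) x))\<^sup>2)"
    unfolding norm_square_eq yx by (simp add: cmod_power2) (simp add: power2_eq_square)
  ultimately show "(\<Sum>i\<in>I. (cmod (cinner (b i) x))\<^sup>2) \<le> (norm x)\<^sup>2" by simp
qed (rule I)

lemma bessel_selfadjoint_contraction:
  assumes "bessel I e" "\<And>x y. cinner (P x) y = cinner x (P y)" "\<And>x. norm (P x) \<le> norm x"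
  shows "bessel I (\<lambda>i. P (e i))"
  unfolding bessel_def
proof safe
  show "finite I" using assms bessel_finite by blast
  fix x
  have "(\<Sum>i\<in>I. (cmod (cinner (P (e i)) x))\<^sup>2) \<le> (norm (P x))\<^sup>2"
    unfolding assms(2) by (rule besselD[OF assms(1)])
  also have "\<dots> \<le> (norm x)\<^sup>2" using assms(3) by (simp add: power_mono)
  finally show "(\<Sum>i\<in>I. (cmod (cinner (P (e i)) x))\<^sup>2) \<le> (norm x)\<^sup>2" .
qed

lemma bessel_proj: "orthosys b \<Longrightarrow> bessel I e \<Longrightarrow> bessel I (\<lambda>i. proj b n (e i))"
  by (rule bessel_selfadjoint_contraction[where P = "proj b n"])
     (auto simp: norm_proj_le intro: proj_selfadjoint)

lemma bessel_diff_proj: "orthosys b \<Longrightarrow> bessel I e \<Longrightarrow> bessel I (\<lambda>i. e i - proj b n (e i))"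
  by (rule bessel_selfadjoint_contraction[where P = "\<lambda>x. x - proj b n x"])
     (simp_all add: proj_selfadjoint norm_diff_proj_le cinner_diff_left cinner_diff_right)

lemma orthosys_summable:
  fixes b :: "nat \<Rightarrow> 'h::chilbert_space"
  assumes b: "orthosys b" and c: "\<And>n. (\<Sum>i<n. (cmod (c i))\<^sup>2) \<le> K"
  shows "summable (\<lambda>i. c i *\<^sub>C b i)"
  unfolding summable_Cauchy
proof safe
  fix r :: real assume r: "0 < r"
  have "summable (\<lambda>i. (cmod (c i))\<^sup>2)" using c by (intro summableI_nonneg_bounded) auto
  then obtain N where N: "\<And>m n. m \<ge> N \<Longrightarrow> norm (\<Sum>i=m..<n. (cmod (c i))\<^sup>2) < r\<^sup>2"
    unfolding summable_Cauchy using r by (meson zero_less_power)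
  have "norm (\<Sum>i=m..<n. c i *\<^sub>C b i) < r" if "m \<ge> N" for m n
  proof -
    have "(norm (\<Sum>i=m..<n. c i *\<^sub>C b i))\<^sup>2 \<le> (\<Sum>i=m..<n. (cmod (c i))\<^sup>2)"
      using b by (intro norm_orthosys_sum_le) auto
    also have "\<dots> < r\<^sup>2" using N[OF that, of n] by (simp add: abs_of_nonneg sum_nonneg)
    finally show ?thesis using r by (simp add: power_less_imp_less_base)
  qed
  then show "\<exists>N. \<forall>m\<ge>N. \<forall>n. norm (\<Sum>i=m..<n. c i *\<^sub>C b i) < r" by blast
qed

text \<open>The families live in the ranges of the differences of successive projections, which are mutually
  orthogonal, so the Bessel inequalities add up by the theorem of Pythagoras.\<close>

lemma bessel_Sigma:
  assumes b: "orthosys b" and m: "mono m" and F: "finite F"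
    and g: "\<And>k. k \<in> F \<Longrightarrow> bessel (I k) (g k)"
    and off: "\<And>k i. k \<in> F \<Longrightarrow> i \<in> I k \<Longrightarrow> proj b (m k) (g k i) = 0"
    and on: "\<And>k i. k \<in> F \<Longrightarrow> i \<in> I k \<Longrightarrow> proj b (m (Suc k)) (g k i) = g k i"
  shows "bessel (Sigma F I) (\<lambda>(k, i). g k i)"
  unfolding bessel_def
proof safe
  show "finite (Sigma F I)" using F g bessel_finite by blast
  fix x
  define D where "D k = proj b (m (Suc k)) x - proj b (m k) x" for k
  have D: "(norm (proj b (m (Suc k)) x))\<^sup>2 = (norm (proj b (m k) x))\<^sup>2 + (norm (D k))\<^sup>2" for k
  proof -
    have "m k \<le> m (Suc k)" using m by (simp add: mono_def)
    then have "proj b (m k) (proj b (m (Suc k)) x) = proj b (m k) x"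
      using proj_proj[OF b, of "m k" "m (Suc k)" x] by (simp add: min_def)
    then show ?thesis using norm_proj_pythagoras[OF b, of "proj b (m (Suc k)) x" "m k"] by (simp add: D_def)
  qed
  have "(\<Sum>k<n. (norm (D k))\<^sup>2) \<le> (norm (proj b (m n) x))\<^sup>2" for n
    using D by (induction n) auto
  then have sumD: "(\<Sum>k<n. (norm (D k))\<^sup>2) \<le> (norm x)\<^sup>2" for n
    using norm_proj_le[OF b, of "m n" x] by (meson order_trans power_mono norm_ge_zero)
  obtain n where n: "F \<subseteq> {..<n}" using F finite_nat_iff_bounded by blast
  have "(\<Sum>(k, i)\<in>Sigma F I. (cmod (cinner (g k i) x))\<^sup>2) = (\<Sum>k\<in>F. \<Sum>i\<in>I k. (cmod (cinner (g k i) x))\<^sup>2)"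
    using F g bessel_finite by (subst sum.Sigma) auto
  also have "\<dots> \<le> (\<Sum>k\<in>F. (norm (D k))\<^sup>2)"
  proof (rule sum_mono)
    fix k assume k: "k \<in> F"
    have "cinner (g k i) x = cinner (g k i) (D k)" if i: "i \<in> I k" for i
    proof -
      have "cinner (g k i) (proj b (m (Suc k)) x) = cinner (g k i) x"
        using on[OF k i] proj_selfadjoint[of b "m (Suc k)" "g k i" x] by simp
      moreover have "cinner (g k i) (proj b (m k) x) = 0"
        using off[OF k i] proj_selfadjoint[of b "m k" "g k i" x] by simp
      ultimately show ?thesis by (simp add: D_def cinner_diff_right)
    qed
    then have "(\<Sum>i\<in>I k. (cmod (cinner (g k i) x))\<^sup>2) = (\<Sum>i\<in>I k. (cmod (cinner (g k i) (D k)))\<^sup>2)" by simp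
    also have "\<dots> \<le> (norm (D k))\<^sup>2" by (rule besselD[OF g[OF k]])
    finally show "(\<Sum>i\<in>I k. (cmod (cinner (g k i) x))\<^sup>2) \<le> (norm (D k))\<^sup>2" .
  qed
  also have "\<dots> \<le> (\<Sum>k<n. (norm (D k))\<^sup>2)" using n by (intro sum_mono2) auto
  also have "\<dots> \<le> (norm x)\<^sup>2" by (rule sumD)
  finally show "(\<Sum>i\<in>Sigma F I. (cmod (cinner (case i of (k, i) \<Rightarrow> g k i) x))\<^sup>2) \<le> (norm x)\<^sup>2"
    by (simp add: case_prod_unfold)
qed

section \<open>Countable bases and adjoints\<close>

text \<open>The convention \<open>sgn 0 = 0\<close> produces a zero vector whenever \<open>d n\<close> depends on its
  predecessors.\<close>

function gram_schmidt :: "(nat \<Rightarrow> 'h::complex_inner) \<Rightarrow> nat \<Rightarrow> 'h" where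
  "gram_schmidt d n = sgn (d n - (\<Sum>i<n. cinner (gram_schmidt d i) (d n) *\<^sub>C gram_schmidt d i))"
  by pat_completeness auto
termination by (relation "Wellfounded.measure (\<lambda>(d, n). n)") auto

declare gram_schmidt.simps [simp del]

lemma gram_schmidt_proj:
  "gram_schmidt d n = sgn (d n - proj (gram_schmidt d) n (d n))"
  unfolding proj_def by (rule gram_schmidt.simps)

lemma sgn_scaleC: "sgn x = complex_of_real (1 / norm x) *\<^sub>C (x::'h::complex_inner)"
  by (simp add: sgn_div_norm scaleR_scaleC divide_inverse)

lemma orthosys_gram_schmidt: "orthosys (gram_schmidt d)"
proof -
  let ?b = "gram_schmidt d"
  have self: "cinner (?b n) (?b n) = (if ?b n \<noteq> 0 then 1 else 0)" for n
    by (subst cinner_self) (auto simp: gram_schmidt_proj[of d n] norm_sgn sgn_zero_iff)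
  have less: "\<forall>i<n. cinner (?b i) (?b n) = 0" for n
  proof (induction n rule: less_induct)
    case (less n)
    show ?case
    proof safe
      fix i assume i: "i < n"
      have eq: "cinner (?b i) (?b j) = (if j = i \<and> ?b i \<noteq> 0 then 1 else 0)" if "j < n" for j
        using less[rule_format, of i j] less[rule_format, of j i] self that i cinner_commute[of "?b i" "?b j"]
        by (cases i j rule: linorder_cases) auto
      have "cinner (?b i) (proj ?b n (d n))
          = (\<Sum>j<n. if j = i then (if ?b i \<noteq> 0 then cinner (?b i) (d n) else 0) else 0)"
        unfolding proj_def cinner_sum_right cinner_scaleC_right by (intro sum.cong) (auto simp: eq)
      also have "\<dots> = cinner (?b i) (d n)" using i by (auto simp: sum.delta)
      finally show "cinner (?b i) (?b n) = 0"
        by (simp add: gram_schmidt_proj[of d n] sgn_scaleC cinner_scaleC_right cinner_diff_right)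
    qed
  qed
  show ?thesis
    unfolding orthosys_def
  proof (intro allI)
    fix i j
    show "cinner (?b i) (?b j) = (if i = j \<and> ?b i \<noteq> 0 then 1 else 0)"
      using less[of j] less[of i] self cinner_commute[of "?b i" "?b j"]
      by (cases i j rule: linorder_cases) auto
  qed
qed

lemma proj_gram_schmidt:
  assumes "n < m" shows "proj (gram_schmidt d) m (d n) = d n"
proof -
  let ?b = "gram_schmidt d"
  note b = orthosys_gram_schmidt[of d]
  define r where "r = d n - proj ?b n (d n)"
  have pb: "proj ?b m (?b n) = ?b n"
    unfolding proj_def using assms b
    by (subst sum.remove[of _ n]) (auto simp: orthosys_self orthosys_cinner)
  have "r = complex_of_real (norm r) *\<^sub>C ?b n"
    by (cases "r = 0")
      (auto simp: gram_schmidt_proj[of d n] r_def[symmetric] sgn_scaleC scaleC_scaleC scaleC_one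
        simp flip: of_real_mult)
  then have "proj ?b m r = r" by (metis clinear_scaleC[OF proj_clinear] pb)
  moreover have "proj ?b m (proj ?b n (d n)) = proj ?b n (d n)"
    using assms by (simp add: proj_proj[OF b] min_def)
  ultimately show ?thesis by (simp add: r_def clinear_diff[OF proj_clinear])
qed

locale hilbert_basis =
  fixes b :: "nat \<Rightarrow> 'h::chilbert_space"
  assumes ortho: "orthosys b"
    and proj_tendsto: "\<And>x. (\<lambda>n. proj b n x) \<longlonglongrightarrow> x"

lemma separable_imp_hilbert_basis:
  assumes "separable_space (euclidean :: 'h::chilbert_space topology)"
  shows "\<exists>b :: nat \<Rightarrow> 'h. hilbert_basis b"
proof -
  obtain D :: "'h set" where D: "countable D" "closure D = UNIV"
    using assms unfolding separable_space_def by auto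
  then have "D \<noteq> {}" by auto
  define d where "d = from_nat_into D"
  have d: "range d = D" using \<open>D \<noteq> {}\<close> D unfolding d_def by (simp add: range_from_nat_into)
  let ?b = "gram_schmidt d"
  note b = orthosys_gram_schmidt[of d]
  have "(\<lambda>n. proj ?b n x) \<longlonglongrightarrow> x" for x
  proof (rule LIMSEQ_I)
    fix r :: real assume "0 < r"
    have "x \<in> closure D" using D by simp
    then obtain k where k: "dist (d k) x < r"
      using \<open>0 < r\<close> d unfolding closure_approachable by blast
    have "norm (proj ?b n x - x) < r" if "n \<ge> Suc k" for n
    proof -
      have "(x - d k) - proj ?b n (x - d k) = x - proj ?b n x"
        using proj_gram_schmidt[of k n d] that by (simp add: clinear_diff[OF proj_clinear])
      then have "norm (x - proj ?b n x) \<le> norm (x - d k)"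
        using norm_diff_proj_le[OF b, of "x - d k" n] by metis
      then show ?thesis using k by (simp add: dist_norm norm_minus_commute)
    qed
    then show "\<exists>no. \<forall>n\<ge>no. norm (proj ?b n x - x) < r" by blast
  qed
  then show ?thesis using b by (intro exI[of _ ?b]) (simp add: hilbert_basis_def)
qed

context hilbert_basis
begin

text \<open>The vector representing \<open>x \<mapsto> \<langle>A x, y\<rangle>\<close> is \<open>\<Sum>\<^sub>i \<langle>A b\<^sub>i, y\<rangle> b\<^sub>i\<close>. The series converges because
  testing the functional on its own partial sums bounds their norms.\<close>

lemma adjoint_exists:
  fixes A :: "'h \<Rightarrow> 'h"
  assumes A: "clinear A" and K: "\<And>x. norm (A x) \<le> K * norm x"
  shows "\<exists>B. \<forall>x y. cinner (A x) y = cinner x (B y)"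
proof -
  have K0: "0 \<le> K * norm x" for x :: 'h using K[of x] norm_ge_zero order_trans by blast
  have ex: "\<exists>z. \<forall>x. cinner (A x) y = cinner x z" for y
  proof -
    define c where "c i = cinner (A (b i)) y" for i
    \<comment> \<open>For the partial sum \<open>w\<close> and \<open>q = \<langle>A w, y\<rangle>\<close>, boundedness and
      \<open>\<parallel>w\<parallel>\<^sup>2 \<le> q\<close> give \<open>q\<^sup>2 \<le> (K \<parallel>y\<parallel>)\<^sup>2 q\<close>.\<close>
    have bound: "(\<Sum>i<n. (cmod (c i))\<^sup>2) \<le> (K * norm y)\<^sup>2" for n
    proof -
      define w where "w = (\<Sum>i<n. c i *\<^sub>C b i)"
      define q where "q = (\<Sum>i<n. (cmod (c i))\<^sup>2)"
      have q0: "0 \<le> q" by (simp add: q_def sum_nonneg)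
      have "cinner (A w) y = (\<Sum>i<n. cnj (c i) * c i)"
        by (simp add: w_def clinear_sum[OF A] clinear_scaleC[OF A] cinner_sum_left cinner_scaleC_left c_def)
      also have "\<dots> = of_real q"
        by (simp add: q_def complex_norm_square mult.commute del: of_real_power)
      finally have "q = cmod (cinner (A w) y)" using q0 by simp
      also have "\<dots> \<le> norm (A w) * norm y" by (rule cinner_Cauchy_Schwarz)
      also have "\<dots> \<le> (K * norm w) * norm y" using K by (intro mult_right_mono) auto
      finally have 1: "q \<le> (K * norm y) * norm w" by (simp add: mult_ac)
      have 2: "(norm w)\<^sup>2 \<le> q"
        unfolding w_def q_def by (intro norm_orthosys_sum_le ortho) auto
      have "q\<^sup>2 \<le> ((K * norm y) * norm w)\<^sup>2" using 1 q0 by (rule power_mono)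
      also have "\<dots> \<le> (K * norm y)\<^sup>2 * q" using 2 by (simp add: power_mult_distrib mult_left_mono)
      finally have "q * (q - (K * norm y)\<^sup>2) \<le> 0" by (simp add: power2_eq_square algebra_simps)
      then have "q \<le> (K * norm y)\<^sup>2" using q0 zero_le_power2[of "K * norm y"] unfolding mult_le_0_iff by auto
      then show ?thesis by (simp add: q_def)
    qed
    define z where "z = (\<Sum>i. c i *\<^sub>C b i)"
    have sums: "(\<lambda>n. \<Sum>i<n. c i *\<^sub>C b i) \<longlonglongrightarrow> z"
      unfolding z_def using summable_LIMSEQ[OF orthosys_summable[OF ortho bound]] .
    have bz: "cinner (b k) z = c k" for k
    proof -
      have "(\<lambda>n. cinner (b k) (\<Sum>i<n. c i *\<^sub>C b i)) \<longlonglongrightarrow> cinner (b k) z"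
        by (intro tendsto_intros sums)
      moreover have "(\<lambda>n. cinner (b k) (\<Sum>i<n. c i *\<^sub>C b i)) \<longlonglongrightarrow> c k"
      proof (rule tendsto_eventually, rule eventually_sequentiallyI[of "Suc k"])
        fix n assume "Suc k \<le> n"
        then show "cinner (b k) (\<Sum>i<n. c i *\<^sub>C b i) = c k"
          using cinner_orthosys_sum[OF ortho, of "{..<n}" k c] by (auto simp: c_def clinear_zero[OF A])
      qed
      ultimately show ?thesis by (rule LIMSEQ_unique)
    qed
    have "cinner (A x) y = cinner x z" for x
    proof -
      have "(\<lambda>n. A (proj b n x)) \<longlonglongrightarrow> A x"
      proof (rule Lim_transform_bound[of "\<lambda>n. A (proj b n x) - A x" _ _ , THEN LIM_zero_cancel])
        show "\<forall>\<^sub>F n in sequentially. norm (A (proj b n x) - A x) \<le> norm (K * norm (proj b n x - x))"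
          using K K0 by (simp flip: clinear_diff[OF A])
        show "(\<lambda>n. K * norm (proj b n x - x)) \<longlonglongrightarrow> 0"
          using proj_tendsto[of x] by (intro tendsto_mult_right_zero tendsto_norm_zero LIM_zero)
      qed
      then have 1: "(\<lambda>n. cinner (A (proj b n x)) y) \<longlonglongrightarrow> cinner (A x) y"
        by (intro tendsto_intros)
      have 2: "(\<lambda>n. cinner (proj b n x) z) \<longlonglongrightarrow> cinner x z"
        by (intro tendsto_intros proj_tendsto)
      have "cinner (A (proj b n x)) y = cinner (proj b n x) z" for n
        by (simp add: proj_def clinear_sum[OF A] clinear_scaleC[OF A] cinner_sum_left cinner_scaleC_left bz c_def)
      then show ?thesis using 1 2 LIMSEQ_unique by simp
    qed
    then show ?thesis by blast
  qed
  then show ?thesis by (metis (full_types))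
qed

lemma cadjoint:
  fixes A :: "'h \<Rightarrow> 'h"
  assumes A: "clinear A" and K: "\<And>x. norm (A x) \<le> K * norm x"
  shows "cinner (A x) y = cinner x (cadjoint A y)"
proof -
  obtain B where B: "\<And>x y. cinner (A x) y = cinner x (B y)" using adjoint_exists[OF A K] by blast
  have "cadjoint A = B"
    unfolding cadjoint_def
  proof (rule the_equality)
    show "\<forall>x y. cinner (A x) y = cinner x (B y)" by (intro allI B)
    fix B' assume B': "\<forall>x y. cinner (A x) y = cinner x (B' y)"
    show "B' = B"
    proof
      fix y
      have "cinner x (B' y - B y) = 0" for x
        by (simp add: cinner_diff_right B'[rule_format, symmetric] B[symmetric])
      then have "B' y - B y = 0" by (rule cinner_eq_0_all)
      then show "B' y = B y" by simp
    qed
  qed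
  then show ?thesis using B[of x y] by simp
qed

end

section \<open>Compact operators\<close>

definition totally_bdd :: "'a::metric_space set \<Rightarrow> bool" where
  "totally_bdd S \<longleftrightarrow> (\<forall>\<epsilon>>0. \<exists>k. finite k \<and> S \<subseteq> (\<Union>x\<in>k. ball x \<epsilon>))"

lemma totally_bdd_subset: "totally_bdd S \<Longrightarrow> R \<subseteq> S \<Longrightarrow> totally_bdd R"
  unfolding totally_bdd_def by (meson order_trans)

lemma compact_imp_totally_bdd: "compact S \<Longrightarrow> totally_bdd S"
  by (simp add: compact_eq_totally_bounded totally_bdd_def)

lemma compact_closure_iff_totally_bdd:
  "compact (closure S) \<longleftrightarrow> totally_bdd (S :: 'a::complete_space set)"
proof
  assume "compact (closure S)"
  then show "totally_bdd S"
    using compact_imp_totally_bdd totally_bdd_subset closure_subset by blast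
next
  assume S: "totally_bdd S"
  show "compact (closure S)"
    unfolding compact_eq_totally_bounded
  proof safe
    show "complete (closure S)" by (simp add: complete_eq_closed)
    fix e :: real assume e: "0 < e"
    then obtain k where k: "finite k" "S \<subseteq> (\<Union>x\<in>k. ball x (e / 2))"
      using S unfolding totally_bdd_def by (meson half_gt_zero)
    have "(\<Union>x\<in>k. ball x (e / 2)) \<subseteq> (\<Union>x\<in>k. cball x (e / 2))"
      by (intro UN_mono ball_subset_cball) auto
    then have "closure S \<subseteq> (\<Union>x\<in>k. cball x (e / 2))"
      using k by (intro closure_minimal closed_UN) auto
    also have "\<dots> \<subseteq> (\<Union>x\<in>k. ball x e)" using e by (auto simp: mem_ball mem_cball)
    finally show "\<exists>k. finite k \<and> closure S \<subseteq> (\<Union>x\<in>k. ball x e)" using k by blast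
  qed
qed

lemma totally_bdd_image_ball_iff:
  fixes A :: "'a::real_normed_vector \<Rightarrow> 'b::metric_space"
  shows "totally_bdd (A ` cball 0 1) \<longleftrightarrow>
    (\<forall>e>0. \<exists>k. finite k \<and> (\<forall>z. norm z \<le> 1 \<longrightarrow> (\<exists>x\<in>k. dist x (A z) < e)))"
  by (simp add: totally_bdd_def image_subset_iff Ball_def[of "cball 0 1"])

lemma totally_bdd_bounded: assumes "totally_bdd S" shows "bounded S"
proof -
  obtain k where k: "finite k" "S \<subseteq> (\<Union>x\<in>k. ball x 1)"
    using assms unfolding totally_bdd_def by (meson zero_less_one)
  then show ?thesis by (meson bounded_UN bounded_ball bounded_subset)
qed

lemma clinear_bounded_on_ball:
  fixes A :: "'h::complex_inner \<Rightarrow> 'h"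
  assumes A: "clinear A" and K: "\<And>x. norm x \<le> 1 \<Longrightarrow> norm (A x) \<le> K"
  shows "norm (A x) \<le> K * norm x"
proof (cases "x = 0")
  case True
  then show ?thesis by (simp add: clinear_zero[OF A])
next
  case False
  have "norm (A (complex_of_real (1 / norm x) *\<^sub>C x)) \<le> K"
    using False by (intro K) (simp add: norm_scaleC norm_divide)
  then show ?thesis using False by (simp add: clinear_scaleC[OF A] norm_scaleC norm_divide field_simps)
qed

lemma compact_hilbert_operator_iff:
  "compact_hilbert_operator A \<longleftrightarrow> clinear A \<and> totally_bdd (A ` cball 0 1)"
proof safe
  assume A: "compact_hilbert_operator A"
  then show "clinear A"
    unfolding compact_hilbert_operator_def clinear_def by (auto simp: linear_simps)
  show "totally_bdd (A ` cball 0 1)"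
    using A by (simp add: compact_hilbert_operator_def compact_closure_iff_totally_bdd)
next
  assume A: "clinear A" and tb: "totally_bdd (A ` cball 0 1)"
  obtain K where K: "\<And>x. norm x \<le> 1 \<Longrightarrow> norm (A x) \<le> K"
    using totally_bdd_bounded[OF tb] unfolding bounded_iff by (meson imageI mem_cball_0)
  have "bounded_linear A"
    by (rule bounded_linear_intro[where K = K])
       (use clinear_bounded_on_ball[OF A K] in
        \<open>auto simp: clinear_add[OF A] scaleR_scaleC clinear_scaleC[OF A] mult.commute\<close>)
  then show "compact_hilbert_operator A"
    using A tb by (simp add: compact_hilbert_operator_def compact_closure_iff_totally_bdd clinear_def)
qed

lemma compact_hilbert_operator_clinear: "compact_hilbert_operator A \<Longrightarrow> clinear A"
  by (simp add: compact_hilbert_operator_iff)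

lemma compact_hilbert_operator_bounded:
  assumes "compact_hilbert_operator A" shows "\<exists>K\<ge>0. \<forall>x. norm (A x) \<le> K * norm x"
  using assms bounded_linear.nonneg_bounded[of A]
  by (auto simp: compact_hilbert_operator_def mult.commute)

lemma compact_hilbert_operator_subseq:
  assumes A: "compact_hilbert_operator A" and x: "\<And>n::nat. norm (x n) \<le> 1"
  shows "\<exists>r y. strict_mono r \<and> (\<lambda>n. A (x (r n))) \<longlonglongrightarrow> y"
proof -
  have "\<forall>n. A (x n) \<in> closure (A ` cball 0 1)"
    using x closure_subset[of "A ` cball 0 1"] by auto
  moreover have "compact (closure (A ` cball 0 1))"
    using A by (simp add: compact_hilbert_operator_def)
  ultimately obtain l r where "strict_mono r" "((\<lambda>n. A (x n)) \<circ> r) \<longlonglongrightarrow> l"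
    using seq_compactE[of "closure (A ` cball 0 1)" "\<lambda>n. A (x n)"] compact_imp_seq_compact by metis
  then show ?thesis by (auto simp: o_def)
qed

lemma compact_hilbert_operator_add:
  assumes "compact_hilbert_operator A" "compact_hilbert_operator B"
  shows "compact_hilbert_operator (A + B)"
proof -
  have A: "clinear A" "totally_bdd (A ` cball 0 1)" and B: "clinear B" "totally_bdd (B ` cball 0 1)"
    using assms by (auto simp: compact_hilbert_operator_iff)
  have "clinear (A + B)"
    by (simp add: clinear_def clinear_add[OF A(1)] clinear_add[OF B(1)] clinear_scaleC[OF A(1)]
        clinear_scaleC[OF B(1)] scaleC_add_right add_ac)
  moreover have "totally_bdd ((A + B) ` cball 0 1)"
    unfolding totally_bdd_def
  proof safe
    fix e :: real assume "0 < e"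
    then have e2: "0 < e / 2" by simp
    obtain k where k: "finite k" "\<forall>z. norm z \<le> 1 \<longrightarrow> (\<exists>x\<in>k. dist x (A z) < e / 2)"
      using A(2)[unfolded totally_bdd_image_ball_iff, rule_format, OF e2] by blast
    obtain l where l: "finite l" "\<forall>z. norm z \<le> 1 \<longrightarrow> (\<exists>x\<in>l. dist x (B z) < e / 2)"
      using B(2)[unfolded totally_bdd_image_ball_iff, rule_format, OF e2] by blast
    have "(A + B) ` cball 0 1 \<subseteq> (\<Union>x\<in>(\<lambda>(x, y). x + y) ` (k \<times> l). ball x e)"
    proof safe
      fix z :: 'a assume z: "z \<in> cball 0 1"
      obtain x where x: "x \<in> k" "dist x (A z) < e / 2" using k z by auto
      obtain y where y: "y \<in> l" "dist y (B z) < e / 2" using l z by auto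
      have "dist (x + y) (A z + B z) < e" using x y dist_triangle_add[of x y "A z" "B z"] by linarith
      then show "(A + B) z \<in> (\<Union>x\<in>(\<lambda>(x, y). x + y) ` (k \<times> l). ball x e)" using x y by auto
    qed
    then show "\<exists>k. finite k \<and> (A + B) ` cball 0 1 \<subseteq> (\<Union>x\<in>k. ball x e)"
      using k l by (intro exI[of _ "(\<lambda>(x, y). x + y) ` (k \<times> l)"]) auto
  qed
  ultimately show ?thesis by (simp add: compact_hilbert_operator_iff)
qed

lemma compact_hilbert_operator_scaleC:
  assumes "compact_hilbert_operator A" shows "compact_hilbert_operator (a *\<^sub>C A)"
proof -
  have A: "clinear A" "totally_bdd (A ` cball 0 1)"
    using assms by (auto simp: compact_hilbert_operator_iff)
  have "clinear (a *\<^sub>C A)"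
    using A(1) by (simp add: clinear_def scaleC_fun_def scaleC_add_right scaleC_scaleC mult.commute)
  moreover have "totally_bdd ((a *\<^sub>C A) ` cball 0 1)"
    unfolding totally_bdd_def
  proof safe
    fix e :: real assume e: "0 < e"
    define d where "d = e / (cmod a + 1)"
    have "0 < d" using e by (simp add: d_def add_nonneg_pos)
    then obtain k where k: "finite k" "\<forall>z. norm z \<le> 1 \<longrightarrow> (\<exists>x\<in>k. dist x (A z) < d)"
      using A(2) unfolding totally_bdd_image_ball_iff by meson
    have "(a *\<^sub>C A) ` cball 0 1 \<subseteq> (\<Union>x\<in>(*\<^sub>C) a ` k. ball x e)"
    proof safe
      fix z :: 'a assume z: "z \<in> cball 0 1"
      obtain x where x: "x \<in> k" "dist x (A z) < d" using k z by auto
      have "dist (a *\<^sub>C x) (a *\<^sub>C A z) = cmod a * dist x (A z)"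
        by (simp add: dist_norm norm_scaleC flip: cvs.scale_right_diff_distrib)
      also have "\<dots> \<le> cmod a * d" using x by (intro mult_left_mono) auto
      also have "\<dots> < (cmod a + 1) * d" using \<open>0 < d\<close> by simp
      also have "\<dots> = e"
      proof -
        have "cmod a + 1 \<noteq> 0" by (smt (verit) norm_ge_zero)
        then show ?thesis by (simp add: d_def)
      qed
      finally show "(a *\<^sub>C A) z \<in> (\<Union>x\<in>(*\<^sub>C) a ` k. ball x e)"
        using x by (auto simp: scaleC_fun_def)
    qed
    then show "\<exists>k. finite k \<and> (a *\<^sub>C A) ` cball 0 1 \<subseteq> (\<Union>x\<in>k. ball x e)" using k by blast
  qed
  ultimately show ?thesis by (simp add: compact_hilbert_operator_iff)
qed

lemma compact_hilbert_operator_limit: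
  assumes A: "clinear A"
    and lim: "\<And>e. 0 < e \<Longrightarrow> \<exists>B. compact_hilbert_operator B \<and> (\<forall>x. norm (A x - B x) \<le> e * norm x)"
  shows "compact_hilbert_operator A"
proof -
  have "totally_bdd (A ` cball 0 1)"
    unfolding totally_bdd_def
  proof safe
    fix e :: real assume e: "0 < e"
    obtain B where B: "compact_hilbert_operator B" and close: "\<And>x. norm (A x - B x) \<le> (e / 2) * norm x"
      using lim[of "e / 2"] e by auto
    obtain k where k: "finite k" "\<forall>z. norm z \<le> 1 \<longrightarrow> (\<exists>x\<in>k. dist x (B z) < e / 2)"
      using B e unfolding compact_hilbert_operator_iff totally_bdd_image_ball_iff by (meson half_gt_zero)
    have "A ` cball 0 1 \<subseteq> (\<Union>x\<in>k. ball x e)"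
    proof safe
      fix z :: 'a assume z: "z \<in> cball 0 1"
      obtain x where x: "x \<in> k" "dist x (B z) < e / 2" using k z by auto
      have "norm (A z - B z) \<le> (e / 2) * norm z" by (rule close)
      also have "\<dots> \<le> (e / 2) * 1" using z e by (intro mult_left_mono) auto
      finally have "dist (B z) (A z) \<le> e / 2" by (simp add: dist_norm norm_minus_commute)
      then have "dist x (A z) < e" using x dist_triangle[of x "A z" "B z"] by linarith
      then show "A z \<in> (\<Union>x\<in>k. ball x e)" using x by auto
    qed
    then show "\<exists>k. finite k \<and> A ` cball 0 1 \<subseteq> (\<Union>x\<in>k. ball x e)" using k by blast
  qed
  then show ?thesis using A by (simp add: compact_hilbert_operator_iff)
qed

definition rank_one :: "'h::complex_inner \<Rightarrow> 'h \<Rightarrow> 'h \<Rightarrow> 'h" where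
  "rank_one v u x = cinner u x *\<^sub>C v"

lemma clinear_rank_one: "clinear (rank_one v u)"
  by (simp add: clinear_def rank_one_def cinner_add_right cinner_scaleC_right scaleC_add_left scaleC_scaleC)

lemma compact_hilbert_operator_rank_one: "compact_hilbert_operator (rank_one v u)"
proof -
  have "rank_one v u ` cball 0 1 \<subseteq> (\<lambda>z. z *\<^sub>C v) ` cball 0 (norm u)"
  proof safe
    fix x :: 'a assume "x \<in> cball 0 1"
    then have "cmod (cinner u x) \<le> norm u"
      using cinner_Cauchy_Schwarz[of u x] mult_left_le[of "norm x" "norm u"] by simp
    then show "rank_one v u x \<in> (\<lambda>z. z *\<^sub>C v) ` cball 0 (norm u)"
      by (auto simp: rank_one_def)
  qed
  moreover have "compact ((\<lambda>z. z *\<^sub>C v) ` cball 0 (norm u))"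
    by (intro compact_continuous_image linear_continuous_on compact_cball
        bounded_bilinear.bounded_linear_left[OF bounded_bilinear_scaleC])
  ultimately have "totally_bdd (rank_one v u ` cball 0 1)"
    by (meson compact_imp_totally_bdd totally_bdd_subset)
  then show ?thesis by (simp add: compact_hilbert_operator_iff clinear_rank_one)
qed

lemma compact_hilbert_operator_zero: "compact_hilbert_operator (0 :: 'h::chilbert_space \<Rightarrow> 'h)"
proof -
  have "rank_one 0 (0::'h) = 0" by (auto simp: rank_one_def)
  then show ?thesis using compact_hilbert_operator_rank_one[of 0 "0::'h"] by simp
qed

lemma sum_fun_apply: "(\<Sum>i\<in>I. f i) x = (\<Sum>i\<in>I. f i x)"
  by (induction I rule: infinite_finite_induct) auto

lemma compact_hilbert_operator_sum:
  "(\<And>i. i \<in> I \<Longrightarrow> compact_hilbert_operator (A i)) \<Longrightarrow> compact_hilbert_operator (\<Sum>i\<in>I. A i)"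
  by (induction I rule: infinite_finite_induct)
    (auto simp: compact_hilbert_operator_zero intro: compact_hilbert_operator_add)

text \<open>Every rank one operator is a combination of four positive ones, which is how statements about
  positive operators reach general ones.\<close>

lemma rank_one_polarisation:
  fixes u v :: "'h::complex_inner"
  shows "rank_one v u = (\<Sum>k<4::nat. (\<i> ^ k) *\<^sub>C
     rank_one ((1/2) *\<^sub>C (v + (\<i> ^ k) *\<^sub>C u)) ((1/2) *\<^sub>C (v + (\<i> ^ k) *\<^sub>C u)))"
proof
  fix x
  define \<alpha> where "\<alpha> = cinner v x"
  define \<beta> where "\<beta> = cinner u x"
  have expand: "a *\<^sub>C rank_one ((1/2) *\<^sub>C (v + a *\<^sub>C u)) ((1/2) *\<^sub>C (v + a *\<^sub>C u)) x
     = (a * (\<alpha> + cnj a * \<beta>) / 4) *\<^sub>C v + (a * a * (\<alpha> + cnj a * \<beta>) / 4) *\<^sub>C u" for a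
  proof -
    let ?h = "(1/2) *\<^sub>C (v + a *\<^sub>C u)"
    have "cinner ?h x = (\<alpha> + cnj a * \<beta>) / 2"
      by (simp add: cinner_scaleC_left cinner_add_left \<alpha>_def \<beta>_def)
    then have "rank_one ?h ?h x = ((\<alpha> + cnj a * \<beta>) / 2) *\<^sub>C ?h" by (simp only: rank_one_def)
    then have "a *\<^sub>C rank_one ?h ?h x = (a * (\<alpha> + cnj a * \<beta>) / 4) *\<^sub>C (v + a *\<^sub>C u)"
      by (simp add: scaleC_scaleC)
    then show ?thesis by (simp add: scaleC_add_right scaleC_scaleC mult_ac)
  qed
  have four: "{..<4::nat} = {0, 1, 2, 3}" by auto
  have powers: "\<i> ^ 0 = 1" "\<i> ^ 1 = \<i>" "\<i> ^ 2 = -1" "\<i> ^ 3 = - \<i>"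
    by (simp_all add: power3_eq_cube)
  have "(\<Sum>k<4::nat. (\<i> ^ k) *\<^sub>C
     rank_one ((1/2) *\<^sub>C (v + (\<i> ^ k) *\<^sub>C u)) ((1/2) *\<^sub>C (v + (\<i> ^ k) *\<^sub>C u))) x
    = (\<Sum>k<4::nat. (\<i> ^ k * (\<alpha> + cnj (\<i> ^ k) * \<beta>) / 4) *\<^sub>C v + (\<i> ^ k * \<i> ^ k * (\<alpha> + cnj (\<i> ^ k) * \<beta>) / 4) *\<^sub>C u)"
    unfolding sum_fun_apply by (intro sum.cong refl) (simp only: scaleC_fun_def expand)
  also have "\<dots> = (\<Sum>k<4::nat. \<i> ^ k * (\<alpha> + cnj (\<i> ^ k) * \<beta>) / 4) *\<^sub>C v
      + (\<Sum>k<4::nat. \<i> ^ k * \<i> ^ k * (\<alpha> + cnj (\<i> ^ k) * \<beta>) / 4) *\<^sub>C u"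
    by (simp only: sum.distrib cvs.scale_sum_left)
  also have "(\<Sum>k<4::nat. \<i> ^ k * (\<alpha> + cnj (\<i> ^ k) * \<beta>) / 4) = \<beta>"
    unfolding four by (simp add: powers field_simps)
  also have "(\<Sum>k<4::nat. \<i> ^ k * \<i> ^ k * (\<alpha> + cnj (\<i> ^ k) * \<beta>) / 4) = 0"
    unfolding four by (simp add: powers field_simps)
  finally have sum: "(\<Sum>k<4::nat. (\<i> ^ k) *\<^sub>C
     rank_one ((1/2) *\<^sub>C (v + (\<i> ^ k) *\<^sub>C u)) ((1/2) *\<^sub>C (v + (\<i> ^ k) *\<^sub>C u))) x = \<beta> *\<^sub>C v + 0 *\<^sub>C u" .
  show "rank_one v u x = (\<Sum>k<4::nat. (\<i> ^ k) *\<^sub>C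
     rank_one ((1/2) *\<^sub>C (v + (\<i> ^ k) *\<^sub>C u)) ((1/2) *\<^sub>C (v + (\<i> ^ k) *\<^sub>C u))) x"
    unfolding sum by (simp add: rank_one_def \<beta>_def)
qed

section \<open>Schmidt decomposition and singular values\<close>

text \<open>A vector of \<open>V\<close> at which \<open>A\<close> attains its norm on \<open>V\<close>, normalised unless \<open>A\<close> vanishes on
  \<open>V\<close>; in that case it is the zero vector.\<close>

definition norming_vector :: "('h::complex_inner \<Rightarrow> 'h) \<Rightarrow> 'h set \<Rightarrow> 'h \<Rightarrow> bool" where
  "norming_vector A V u \<longleftrightarrow> u \<in> V \<and> (\<forall>y\<in>V. norm (A y) \<le> norm (A u) * norm y) \<and>
     (if A u = 0 then u = 0 else norm u = 1)"

text \<open>Take a maximising sequence \<open>x\<^sub>n\<close> in the unit ball along which \<open>A x\<^sub>n\<close> converges. By the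
  parallelogram law in the image, \<open>\<parallel>A(x\<^sub>m + x\<^sub>n)\<parallel>\<close> is almost twice the maximum, so
  \<open>\<parallel>x\<^sub>m + x\<^sub>n\<parallel>\<close> is almost 2, and by the parallelogram law in the domain \<open>x\<^sub>n\<close> is a Cauchy
  sequence.\<close>

lemma norming_vector_exists:
  fixes A :: "'h::chilbert_space \<Rightarrow> 'h"
  assumes A: "compact_hilbert_operator A" and V: "cvs.subspace V"
    and closed: "\<And>f x. (\<And>n::nat. f n \<in> V) \<Longrightarrow> f \<longlonglongrightarrow> x \<Longrightarrow> x \<in> V"
  shows "\<exists>u. norming_vector A V u"
proof -
  have lin: "clinear A" using A by (rule compact_hilbert_operator_clinear)
  obtain K where K: "0 \<le> K" "\<And>x. norm (A x) \<le> K * norm x"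
    using compact_hilbert_operator_bounded[OF A] by blast
  define S where "S = (\<lambda>y. norm (A y)) ` {y\<in>V. norm y \<le> 1}"
  define s where "s = Sup S"
  have zV: "0 \<in> V" using V by (rule cvs.subspace_0)
  have S0: "0 \<in> S" unfolding S_def using zV clinear_zero[OF lin] by force
  have "z \<le> K" if "z \<in> S" for z
  proof -
    obtain y where y: "norm y \<le> 1" "z = norm (A y)" using \<open>z \<in> S\<close> by (auto simp: S_def)
    have "norm (A y) \<le> K * norm y" by (rule K)
    also have "\<dots> \<le> K" using y K by (simp add: mult_left_le)
    finally show ?thesis using y by simp
  qed
  then have bdd: "bdd_above S" by (rule bdd_aboveI)
  have s0: "0 \<le> s" unfolding s_def using S0 bdd by (rule cSup_upper)
  have le_s: "norm (A y) \<le> s * norm y" if y: "y \<in> V" for y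
  proof (cases "y = 0")
    case True
    then show ?thesis by (simp add: clinear_zero[OF lin])
  next
    case False
    let ?c = "complex_of_real (1 / norm y)"
    have "?c *\<^sub>C y \<in> V" using V y by (rule cvs.subspace_scale)
    moreover have "norm (?c *\<^sub>C y) = 1" using False by (simp add: norm_scaleC norm_divide)
    ultimately have "norm (A (?c *\<^sub>C y)) \<in> S" unfolding S_def by (intro imageI) simp
    then have "norm (A (?c *\<^sub>C y)) \<le> s" unfolding s_def using bdd by (rule cSup_upper)
    then show ?thesis using False by (simp add: clinear_scaleC[OF lin] norm_scaleC norm_divide field_simps)
  qed
  show ?thesis
  proof (cases "s = 0")
    case True
    then have "norming_vector A V 0"
      using le_s zV by (auto simp: norming_vector_def clinear_zero[OF lin])
    then show ?thesis by blast
  next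
    case False
    then have s: "0 < s" using s0 by simp
    have "\<exists>y. y \<in> V \<and> norm y \<le> 1 \<and> s - 1 / (Suc n) < norm (A y)" for n
    proof -
      have "s - 1 / (Suc n) < Sup S" by (simp add: s_def)
      then obtain z where "z \<in> S" "s - 1 / (Suc n) < z" using S0 less_cSupD[of S] by blast
      then show ?thesis by (auto simp: S_def)
    qed
    then obtain y where y: "\<And>n. y n \<in> V" "\<And>n. norm (y n) \<le> 1" "\<And>n. s - 1 / (Suc n) < norm (A (y n))"
      by metis
    obtain r z where r: "strict_mono r" and z: "(\<lambda>n. A (y (r n))) \<longlonglongrightarrow> z"
      using compact_hilbert_operator_subseq[OF A, of y] y(2) by blast
    define x where "x n = y (r n)" for n
    have x: "x n \<in> V" "norm (x n) \<le> 1" for n using y by (auto simp: x_def)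
    have Ax: "(\<lambda>n. A (x n)) \<longlonglongrightarrow> z" using z by (simp add: x_def)
    have low: "s - 1 / (Suc n) \<le> norm (A (x n))" for n
    proof -
      have "1 / real (Suc (r n)) \<le> 1 / real (Suc n)"
        using seq_suble[OF r, of n] by (intro divide_left_mono) auto
      then show ?thesis using y(3)[of "r n"] by (simp add: x_def)
    qed
    have up: "norm (A (x n)) \<le> s" for n
      using le_s[OF x(1)[of n]] x(2)[of n] s0 by (smt (verit) mult_left_le)
    have nAx: "(\<lambda>n. norm (A (x n))) \<longlonglongrightarrow> s"
    proof (rule tendsto_sandwich)
      show "(\<lambda>n. s - 1 / (Suc n)) \<longlonglongrightarrow> s"
        using tendsto_diff[OF tendsto_const LIMSEQ_inverse_real_of_nat, of s] by (simp add: divide_inverse)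
    qed (use low up in auto)
    have "Cauchy x"
    proof (rule CauchyI)
      fix e :: real assume e: "0 < e"
      \<comment> \<open>The errors below add up to at most \<open>5 d < s\<^sup>2 e\<^sup>2\<close>.\<close>
      define d where "d = e\<^sup>2 * s\<^sup>2 / 6"
      have d: "0 < d" using e s by (simp add: d_def)
      have "(\<lambda>n. (norm (A (x n)))\<^sup>2) \<longlonglongrightarrow> s\<^sup>2" by (intro tendsto_intros nAx)
      then have "\<forall>\<^sub>F n in sequentially. dist ((norm (A (x n)))\<^sup>2) (s\<^sup>2) < d" using d by (rule tendstoD)
      then obtain N where N: "\<And>n. n \<ge> N \<Longrightarrow> dist ((norm (A (x n)))\<^sup>2) (s\<^sup>2) < d"
        unfolding eventually_sequentially by blast
      have "Cauchy (\<lambda>n. A (x n))" using Ax by (rule LIMSEQ_imp_Cauchy)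
      then obtain M where M: "\<And>m n. m \<ge> M \<Longrightarrow> n \<ge> M \<Longrightarrow> norm (A (x m) - A (x n)) < sqrt d"
        using d unfolding Cauchy_iff by (metis real_sqrt_gt_zero)
      have "norm (x m - x n) < e" if "m \<ge> max M N" "n \<ge> max M N" for m n
      proof -
        have 1: "(norm (A (x m) - A (x n)))\<^sup>2 < d"
          using M[of m n] that d by (metis max.boundedE norm_ge_zero power_strict_mono real_sqrt_pow2 less_imp_le
            pos2)
        have 2: "s\<^sup>2 - d < (norm (A (x m)))\<^sup>2" "s\<^sup>2 - d < (norm (A (x n)))\<^sup>2"
          using N[of m] N[of n] that by (auto simp: dist_real_def abs_real_def split: if_splits)
        have "norm (A (x m + x n)) \<le> s * norm (x m + x n)"
          using x V by (intro le_s cvs.subspace_add)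
        then have "(norm (A (x m + x n)))\<^sup>2 \<le> s\<^sup>2 * (norm (x m + x n))\<^sup>2"
          using power_mono[of "norm (A (x m + x n))" "s * norm (x m + x n)" 2] by (simp add: power_mult_distrib)
        moreover have "(norm (A (x m + x n)))\<^sup>2 + (norm (A (x m) - A (x n)))\<^sup>2
            = 2 * (norm (A (x m)))\<^sup>2 + 2 * (norm (A (x n)))\<^sup>2"
          unfolding clinear_add[OF lin] by (rule parallelogram_law)
        ultimately have 3: "4 * s\<^sup>2 - 5 * d < s\<^sup>2 * (norm (x m + x n))\<^sup>2"
          using 1 2 by linarith
        have "(norm (x m))\<^sup>2 \<le> 1" "(norm (x n))\<^sup>2 \<le> 1" using x by (auto simp: power_le_one)
        then have "(norm (x m + x n))\<^sup>2 + (norm (x m - x n))\<^sup>2 \<le> 4"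
          unfolding parallelogram_law by linarith
        then have "s\<^sup>2 * ((norm (x m + x n))\<^sup>2 + (norm (x m - x n))\<^sup>2) \<le> s\<^sup>2 * 4"
          by (intro mult_left_mono) auto
        then have "s\<^sup>2 * (norm (x m - x n))\<^sup>2 < 5 * d" using 3 by (simp add: distrib_left)
        also have "\<dots> < s\<^sup>2 * e\<^sup>2" using s e by (simp add: d_def)
        finally have "(norm (x m - x n))\<^sup>2 < e\<^sup>2" using s by simp
        then show ?thesis using e by (simp add: power_less_imp_less_base)
      qed
      then show "\<exists>M. \<forall>m\<ge>M. \<forall>n\<ge>M. norm (x m - x n) < e" by blast
    qed
    then obtain u where u: "x \<longlonglongrightarrow> u" using Cauchy_convergent convergent_def by blast
    have uV: "u \<in> V" using x(1) u by (rule closed)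
    have "(\<lambda>n. A (x n)) \<longlonglongrightarrow> A u"
      using bounded_linear.tendsto[OF _ u, of A] A by (simp add: compact_hilbert_operator_def)
    then have "(\<lambda>n. norm (A (x n))) \<longlonglongrightarrow> norm (A u)" by (rule tendsto_norm)
    then have Au: "norm (A u) = s" using nAx LIMSEQ_unique by blast
    have "norm u \<le> 1" using tendsto_norm[OF u] x(2) by (intro LIMSEQ_le_const2) auto
    moreover have "1 \<le> norm u" using le_s[OF uV] Au s by simp
    ultimately have "norm u = 1" by simp
    then have "norming_vector A V u"
      using uV Au le_s s by (auto simp: norming_vector_def)
    then show ?thesis by blast
  qed
qed

text \<open>First variation: moving \<open>u\<close> by a small multiple of \<open>w\<close> changes \<open>\<parallel>u\<parallel>\<^sup>2\<close> in second order only,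
  so \<open>\<parallel>A u\<parallel>\<^sup>2\<close> cannot have a first order term.\<close>

lemma norming_vector_orthogonal:
  assumes A: "clinear A" and V: "cvs.subspace V" and u: "norming_vector A V u"
    and w: "w \<in> V" "cinner u w = 0"
  shows "cinner (A u) (A w) = 0"
proof (cases "A u = 0")
  case True
  then show ?thesis by simp
next
  case False
  then have nu: "norm u = 1" and uV: "u \<in> V" and max: "\<And>y. y \<in> V \<Longrightarrow> norm (A y) \<le> norm (A u) * norm y"
    using u by (auto simp: norming_vector_def)
  define q where "q = cinner (A u) (A w)"
  define s where "s = norm (A u)"
  show ?thesis
  proof (rule ccontr)
    assume "cinner (A u) (A w) \<noteq> 0"
    then have q: "0 < (cmod q)\<^sup>2" by (simp add: q_def)
    have key: "2 \<le> r * (s\<^sup>2 * (norm w)\<^sup>2)" if r: "0 < r" for r :: real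
    proof -
      \<comment> \<open>This direction turns the first order term into \<open>2 r |q|\<^sup>2\<close>.\<close>
      define t where "t = of_real r * cnj q"
      have tV: "u + t *\<^sub>C w \<in> V" using uV w V by (intro cvs.subspace_add cvs.subspace_scale)
      have "(norm (A (u + t *\<^sub>C w)))\<^sup>2 \<le> (s * norm (u + t *\<^sub>C w))\<^sup>2"
        using max[OF tV] by (intro power_mono) (auto simp: s_def)
      also have "\<dots> = s\<^sup>2 * (1 + (cmod t)\<^sup>2 * (norm w)\<^sup>2)"
      proof -
        have "cinner u (t *\<^sub>C w) = 0" using w by (simp add: cinner_scaleC_right)
        from norm_add_orthogonal[OF this] show ?thesis
          by (simp add: nu norm_scaleC power_mult_distrib)
      qed
      finally have 1: "(norm (A (u + t *\<^sub>C w)))\<^sup>2 \<le> s\<^sup>2 + s\<^sup>2 * ((cmod t)\<^sup>2 * (norm w)\<^sup>2)"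
        by (simp add: distrib_left)
      have "(norm (A (u + t *\<^sub>C w)))\<^sup>2 = Re (cinner (A u) (A u)) + 2 * Re (t * q)
          + Re (cinner (t *\<^sub>C A w) (t *\<^sub>C A w))"
        using cinner_commute[of "A w" "A u"]
        by (simp add: norm_square_eq clinear_add[OF A] clinear_scaleC[OF A] cinner_add_left cinner_add_right
            cinner_scaleC_left cinner_scaleC_right q_def algebra_simps)
      also have "Re (cinner (A u) (A u)) = s\<^sup>2" by (simp add: s_def norm_square_eq)
      also have "Re (cinner (t *\<^sub>C A w) (t *\<^sub>C A w)) = (norm (t *\<^sub>C A w))\<^sup>2" by (simp add: norm_square_eq)
      also have "Re (t * q) = r * (cmod q)\<^sup>2"
      proof -
        have "t * q = of_real r * (q * cnj q)" by (simp add: t_def mult_ac)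
        also have "\<dots> = of_real (r * (cmod q)\<^sup>2)" by (simp add: complex_norm_square del: of_real_power)
        finally show ?thesis by simp
      qed
      finally have "s\<^sup>2 + 2 * (r * (cmod q)\<^sup>2) \<le> (norm (A (u + t *\<^sub>C w)))\<^sup>2" by simp
      with 1 have "2 * (r * (cmod q)\<^sup>2) \<le> s\<^sup>2 * ((cmod t)\<^sup>2 * (norm w)\<^sup>2)" by simp
      also have "(cmod t)\<^sup>2 = r * (r * (cmod q)\<^sup>2)"
        using r by (simp add: t_def norm_mult power_mult_distrib power2_eq_square)
      finally have "(r * (cmod q)\<^sup>2) * 2 \<le> (r * (cmod q)\<^sup>2) * (r * (s\<^sup>2 * (norm w)\<^sup>2))"
        by (simp add: mult_ac)
      then show ?thesis using r q by simp
    qed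
    \<comment> \<open>The bound holds for all \<open>r > 0\<close>; a small \<open>r\<close> violates it.\<close>
    define c where "c = s\<^sup>2 * (norm w)\<^sup>2"
    have "0 \<le> c" by (simp add: c_def)
    then have "0 < 1 / (c + 1)" by simp
    then have "2 \<le> 1 / (c + 1) * c" unfolding c_def by (rule key)
    then show False using \<open>0 \<le> c\<close> by (simp add: field_simps)
  qed
qed

text \<open>The expansion \<open>A x = \<Sum>\<^sub>n s\<^sub>n \<langle>u\<^sub>n, x\<rangle> v\<^sub>n\<close>, expressed through the error after \<open>n\<close> terms. The
  identity for \<open>\<langle>A u\<^sub>n, A z\<rangle>\<close> says that \<open>u\<^sub>n\<close> is an eigenvector of \<open>A\<^sup>* A\<close>. Vectors with
  coefficient 0 are themselves 0.\<close>

definition schmidt_decomposition ::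
    "('h::complex_inner \<Rightarrow> 'h) \<Rightarrow> (nat \<Rightarrow> real) \<Rightarrow> (nat \<Rightarrow> 'h) \<Rightarrow> (nat \<Rightarrow> 'h) \<Rightarrow> bool" where
  "schmidt_decomposition A s u v \<longleftrightarrow>
     decseq s \<and> (\<forall>n. 0 \<le> s n) \<and> s \<longlonglongrightarrow> 0 \<and> orthosys u \<and> orthosys v \<and>
     (\<forall>n. A (u n) = complex_of_real (s n) *\<^sub>C v n) \<and>
     (\<forall>n z. cinner (A (u n)) (A z) = complex_of_real ((s n)\<^sup>2) * cinner (u n) z) \<and>
     (\<forall>n x. norm (A (x - proj u n x)) \<le> s n * norm x) \<and>
     (\<forall>n. s n = 0 \<longleftrightarrow> u n = 0) \<and> (\<forall>n. s n = 0 \<longleftrightarrow> v n = 0)"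

text \<open>Choose \<open>u\<^sub>n\<close> as a norming vector on the orthogonal complement of its predecessors. The first
  variation makes \<open>u\<^sub>n\<close> an eigenvector of \<open>A\<^sup>* A\<close>, and the values \<open>\<parallel>A u\<^sub>n\<parallel>\<close> tend to 0 because
  the vectors \<open>A u\<^sub>n\<close> are orthogonal to each other in a compact set.\<close>

lemma schmidt_decomposition_exists:
  fixes A :: "'h::chilbert_space \<Rightarrow> 'h"
  assumes A: "compact_hilbert_operator A"
  shows "\<exists>s u v. schmidt_decomposition A s u v"
proof -
  have lin: "clinear A" using A by (rule compact_hilbert_operator_clinear)
  define V :: "(nat \<Rightarrow> 'h) \<Rightarrow> nat \<Rightarrow> 'h set" where "V f n = {x. \<forall>i<n. cinner (f i) x = 0}" for f n
  have Vsub: "cvs.subspace (V f n)" for f n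
    by (auto simp: cvs.subspace_def V_def cinner_add_right cinner_scaleC_right)
  have "\<exists>u. \<forall>n. norming_vector A (V u n) (u n)"
  proof (rule dependent_wellorder_choice)
    fix r and f g :: "nat \<Rightarrow> 'h" and n :: nat
    assume "\<And>m. m < n \<Longrightarrow> f m = g m"
    then have "V f n = V g n" by (auto simp: V_def)
    then show "norming_vector A (V f n) r = norming_vector A (V g n) r" by simp
  next
    fix n :: nat and f :: "nat \<Rightarrow> 'h"
    show "\<exists>r. norming_vector A (V f n) r"
    proof (rule norming_vector_exists[OF A Vsub])
      fix h x assume h: "\<And>k::nat. h k \<in> V f n" "h \<longlonglongrightarrow> x"
      have "cinner (f i) x = 0" if "i < n" for i
      proof -
        have "(\<lambda>k. cinner (f i) (h k)) \<longlonglongrightarrow> cinner (f i) x" using h by (intro tendsto_intros)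
        moreover have "cinner (f i) (h k) = 0" for k using h(1)[of k] that by (simp add: V_def)
        ultimately show ?thesis by (simp add: LIMSEQ_const_iff)
      qed
      then show "x \<in> V f n" by (simp add: V_def)
    qed
  qed
  then obtain u where u: "\<And>n. norming_vector A (V u n) (u n)" by blast
  define s where "s n = norm (A (u n))" for n
  define v where "v n = complex_of_real (1 / s n) *\<^sub>C A (u n)" for n
  have s0: "0 \<le> s n" for n by (simp add: s_def)
  have uV: "u n \<in> V u n" for n using u[of n] by (simp add: norming_vector_def)
  have max: "norm (A y) \<le> s n * norm y" if "y \<in> V u n" for n y
    using u[of n] that by (simp add: norming_vector_def s_def)
  have su: "s n = 0 \<longleftrightarrow> u n = 0" for n
    using u[of n] by (auto simp: norming_vector_def s_def clinear_zero[OF lin] split: if_splits)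
  have nu: "norm (u n) = 1" if "u n \<noteq> 0" for n
    using u[of n] that by (auto simp: norming_vector_def split: if_splits)
  have less: "cinner (u i) (u n) = 0" if "i < n" for i n
    using uV[of n] that by (simp add: V_def)
  have orth: "cinner (u i) (u j) = 0" if "i \<noteq> j" for i j
    using less[of i j] less[of j i] that cinner_commute[of "u i" "u j"] by (cases i j rule: linorder_cases) auto
  have ortho_u: "orthosys u"
    unfolding orthosys_def using orth nu by (auto simp: cinner_self)
  have pV: "x - proj u n x \<in> V u n" for n x
    using cinner_proj[OF ortho_u] by (simp add: V_def cinner_diff_right)
  have eig: "cinner (A (u n)) (A z) = complex_of_real ((s n)\<^sup>2) * cinner (u n) z" for n z
  proof (induction n arbitrary: z rule: less_induct)
    case (less n)
    show ?case
    proof (cases "u n = 0")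
      case True
      then show ?thesis by (simp add: clinear_zero[OF lin])
    next
      case False
      have uu: "cinner (u n) (u n) = 1" using nu[OF False] by (simp add: cinner_self)
      define z' where "z' = z - proj u n z"
      define w where "w = z' - cinner (u n) z' *\<^sub>C u n"
      have "z' \<in> V u n" unfolding z'_def by (rule pV)
      then have "w \<in> V u n" unfolding w_def
        by (intro cvs.subspace_diff[OF Vsub] cvs.subspace_scale[OF Vsub] uV)
      moreover have "cinner (u n) w = 0" by (simp add: w_def cinner_diff_right cinner_scaleC_right uu)
      ultimately have "cinner (A (u n)) (A w) = 0"
        by (rule norming_vector_orthogonal[OF lin Vsub u])
      then have 1: "cinner (A (u n)) (A z') = cinner (u n) z' * complex_of_real ((s n)\<^sup>2)"
        by (simp add: w_def clinear_diff[OF lin] clinear_scaleC[OF lin] cinner_diff_right cinner_scaleC_right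
            cinner_self s_def)
      have "cinner (A (u n)) (A (u i)) = 0" if "i < n" for i
        using less[OF that, of "u n"] orth[of i n] that cinner_commute[of "A (u n)" "A (u i)"] by simp
      then have "cinner (A (u n)) (A (proj u n z)) = 0"
        by (simp add: proj_def clinear_sum[OF lin] clinear_scaleC[OF lin] cinner_sum_right cinner_scaleC_right)
      moreover have "cinner (u n) (proj u n z) = 0" by (simp add: cinner_proj[OF ortho_u])
      moreover have "A z = A z' + A (proj u n z)" by (simp add: z'_def clinear_diff[OF lin])
      moreover have "cinner (u n) z = cinner (u n) z' + cinner (u n) (proj u n z)"
        by (simp add: z'_def cinner_diff_right)
      ultimately show ?thesis using 1 by (simp add: cinner_add_right mult.commute)
    qed
  qed
  have Av: "A (u n) = complex_of_real (s n) *\<^sub>C v n" for n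
  proof (cases "s n = 0")
    case True
    then show ?thesis by (simp add: s_def)
  next
    case False
    then have "complex_of_real (s n) * complex_of_real (1 / s n) = 1" by (simp flip: of_real_mult)
    then show ?thesis unfolding v_def by (simp only: scaleC_scaleC scaleC_one)
  qed
  have sv: "s n = 0 \<longleftrightarrow> v n = 0" for n
    using Av[of n] by (auto simp: v_def s_def)
  have "orthosys v"
    unfolding orthosys_def
  proof (intro allI)
    fix i j
    have "cinner (v i) (v j) = complex_of_real (1 / s i) * (complex_of_real (1 / s j)
        * (complex_of_real ((s i)\<^sup>2) * cinner (u i) (u j)))"
      by (simp add: v_def cinner_scaleC_left cinner_scaleC_right eig)
    then show "cinner (v i) (v j) = (if i = j \<and> v i \<noteq> 0 then 1 else 0)"
      using orth[of i j] su[of i] sv[of i] nu[of i]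
      by (auto simp: cinner_self power2_eq_square)
  qed
  moreover have dec: "decseq s"
  proof (rule decseq_SucI)
    fix n
    have "s (Suc n) \<le> s n * norm (u (Suc n))"
      unfolding s_def[of "Suc n"] using uV[of "Suc n"] by (intro max) (simp add: V_def)
    also have "\<dots> \<le> s n" using nu[of "Suc n"] s0[of n] by (cases "u (Suc n) = 0") auto
    finally show "s (Suc n) \<le> s n" .
  qed
  moreover have "s \<longlonglongrightarrow> 0"
  proof -
    obtain L where L: "s \<longlonglongrightarrow> L" "\<And>i. L \<le> s i"
      using decseq_convergent[OF dec, of 0] s0 by auto
    have "L = 0"
    proof (rule ccontr)
      assume "L \<noteq> 0"
      moreover have "0 \<le> L" using L(1) s0 by (intro LIMSEQ_le_const) auto
      ultimately have Lp: "0 < L" by simp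
      have "norm (u n) \<le> 1" for n using nu[of n] by (cases "u n = 0") auto
      then obtain r y where r: "strict_mono r" and y: "(\<lambda>n. A (u (r n))) \<longlonglongrightarrow> y"
        using compact_hilbert_operator_subseq[OF A, of u] by blast
      have "Cauchy (\<lambda>n. A (u (r n)))" using y by (rule LIMSEQ_imp_Cauchy)
      then obtain M where M: "norm (A (u (r M)) - A (u (r (Suc M)))) < L"
        using Lp unfolding Cauchy_iff by (meson le_Suc_eq order_refl)
      have "r M \<noteq> r (Suc M)" using r by (metis lessI less_irrefl strict_monoD)
      then have "cinner (A (u (r M))) (- A (u (r (Suc M)))) = 0" by (simp add: eig orth)
      from norm_add_orthogonal[OF this]
      have "(norm (A (u (r M)) - A (u (r (Suc M)))))\<^sup>2 = (s (r M))\<^sup>2 + (s (r (Suc M)))\<^sup>2"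
        by (simp add: s_def)
      moreover have "L\<^sup>2 \<le> (s (r M))\<^sup>2" using L Lp by (intro power_mono) auto
      moreover have "(norm (A (u (r M)) - A (u (r (Suc M)))))\<^sup>2 < L\<^sup>2"
        using M by (intro power_strict_mono) auto
      ultimately show False by (smt (verit) zero_le_power2)
    qed
    then show ?thesis using L by simp
  qed
  moreover have "norm (A (x - proj u n x)) \<le> s n * norm x" for n x
  proof -
    have "norm (A (x - proj u n x)) \<le> s n * norm (x - proj u n x)" by (intro max pV)
    also have "\<dots> \<le> s n * norm x" using s0 norm_diff_proj_le[OF ortho_u] by (intro mult_left_mono)
    finally show ?thesis .
  qed
  ultimately have "schmidt_decomposition A s u v"
    unfolding schmidt_decomposition_def using s0 ortho_u Av eig su sv by blast
  then show ?thesis by blast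
qed

text \<open>At the first index where two such sequences differ, the larger value is attained more often by one
  of them than by the other.\<close>

lemma singular_value_sequence_unique:
  assumes "singular_value_sequence A s" "singular_value_sequence A t"
  shows "s = t"
proof -
  have aux: False
    if s: "singular_value_sequence A s" and t: "singular_value_sequence A t"
      and n: "t n < s n" "\<And>m. m < n \<Longrightarrow> s m = t m" for s t and n :: nat
  proof -
    define c where "c = s n"
    have c: "0 < c" using t n unfolding singular_value_sequence_def c_def by (metis order.strict_trans1)
    have fin: "finite {i. s i = c}" and card: "card {i. s i = c} = card {i. t i = c}"
      using s t c unfolding singular_value_sequence_def by auto
    have "{i. t i = c} \<subset> {i. s i = c}"
    proof
      show "{i. t i = c} \<subseteq> {i. s i = c}"
      proof safe
        fix i assume i: "c = t i"
        have "i < n"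
        proof (rule ccontr)
          assume "\<not> i < n"
          then have "t i \<le> t n" using t unfolding singular_value_sequence_def by (simp add: decseqD)
          then show False using n i c_def by simp
        qed
        then show "s i = t i" using n by simp
      qed
      have "n \<in> {i. s i = c}" by (simp add: c_def)
      moreover have "n \<notin> {i. t i = c}" using n(1) by (simp add: c_def)
      ultimately show "{i. t i = c} \<noteq> {i. s i = c}" by blast
    qed
    then have "card {i. t i = c} < card {i. s i = c}" by (rule psubset_card_mono[OF fin])
    then show False unfolding card by simp
  qed
  show ?thesis
  proof (rule ccontr)
    assume "s \<noteq> t"
    then have ex: "\<exists>n. s n \<noteq> t n" by auto
    define n where "n = (LEAST n. s n \<noteq> t n)"
    have "s n \<noteq> t n" unfolding n_def using ex by (rule LeastI_ex)
    moreover have eq: "s m = t m" if "m < n" for m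
      using not_less_Least[of m "\<lambda>n. s n \<noteq> t n"] that unfolding n_def by blast
    ultimately consider "t n < s n" | "s n < t n" by linarith
    then show False
    proof cases
      case 1
      then show False by (rule aux[OF assms]) (rule eq)
    next
      case 2
      then show False by (rule aux[OF assms(2,1)]) (rule eq[symmetric])
    qed
  qed
qed

lemma finite_level_set_tendsto_0:
  assumes "s \<longlonglongrightarrow> (0::real)" "0 < c" shows "finite {i. s i = c}"
proof -
  obtain N where N: "\<And>n. n \<ge> N \<Longrightarrow> dist (s n) 0 < c"
    using tendstoD[OF assms] unfolding eventually_sequentially by blast
  have "i < N" if "s i = c" for i
    using N[of i] that assms(2) by (simp add: dist_real_def) (meson not_le_imp_less)
  then have "{i. s i = c} \<subseteq> {..<N}" by auto
  then show ?thesis by (rule finite_subset) simp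
qed

text \<open>The eigenspace of \<open>A\<^sup>* A\<close> for \<open>c\<^sup>2 > 0\<close> is spanned by the \<open>u\<^sub>i\<close> with \<open>s\<^sub>i = c\<close>: an eigenvector
  is orthogonal to all other \<open>u\<^sub>i\<close>, and what remains after subtracting its components is
  annihilated by \<open>A\<close>.\<close>

lemma (in hilbert_basis) singular_value_schmidt:
  fixes A :: "'h \<Rightarrow> 'h"
  assumes A: "compact_hilbert_operator A" and svd: "schmidt_decomposition A s u v"
  shows "singular_value A = s"
proof -
  have lin: "clinear A" using A by (rule compact_hilbert_operator_clinear)
  obtain K where K: "\<And>x. norm (A x) \<le> K * norm x"
    using compact_hilbert_operator_bounded[OF A] by blast
  note adj = cadjoint[OF lin K]
  have s: "decseq s" "\<And>n. 0 \<le> s n" "s \<longlonglongrightarrow> 0" and ou: "orthosys u"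
    and eig: "\<And>n z. cinner (A (u n)) (A z) = complex_of_real ((s n)\<^sup>2) * cinner (u n) z"
    and tail: "\<And>n x. norm (A (x - proj u n x)) \<le> s n * norm x"
    and su: "\<And>n. s n = 0 \<longleftrightarrow> u n = 0"
    using svd by (auto simp: schmidt_decomposition_def)
  have eigspace: "cadjoint A (A x) = complex_of_real (c\<^sup>2) *\<^sub>C x \<longleftrightarrow>
      (\<forall>z. cinner (A z) (A x) = complex_of_real (c\<^sup>2) * cinner z x)" for c x
  proof
    assume "cadjoint A (A x) = complex_of_real (c\<^sup>2) *\<^sub>C x"
    then show "\<forall>z. cinner (A z) (A x) = complex_of_real (c\<^sup>2) * cinner z x"
      by (simp add: adj cinner_scaleC_right)
  next
    assume *: "\<forall>z. cinner (A z) (A x) = complex_of_real (c\<^sup>2) * cinner z x"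
    have "cinner z (cadjoint A (A x) - complex_of_real (c\<^sup>2) *\<^sub>C x) = 0" for z
      using *[rule_format, of z] by (simp add: adj cinner_diff_right cinner_scaleC_right)
    then have "cadjoint A (A x) - complex_of_real (c\<^sup>2) *\<^sub>C x = 0" by (rule cinner_eq_0_all)
    then show "cadjoint A (A x) = complex_of_real (c\<^sup>2) *\<^sub>C x" by simp
  qed
  have "singular_value_sequence A s"
    unfolding singular_value_sequence_def
  proof (intro conjI allI impI)
    fix c :: real assume c: "0 < c"
    define I where "I = {i. s i = c}"
    show fin: "finite {i. s i = c}" using s(3) c by (rule finite_level_set_tendsto_0)
    have finI: "finite I" using fin by (simp add: I_def)
    define E where "E = {x. cadjoint A (A x) = complex_of_real (c\<^sup>2) *\<^sub>C x}"
    have E: "x \<in> E \<longleftrightarrow> (\<forall>z. cinner (A z) (A x) = complex_of_real (c\<^sup>2) * cinner z x)" for x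
      unfolding E_def mem_Collect_eq by (rule eigspace)
    have uI: "u i \<noteq> 0" if "i \<in> I" for i using that c su[of i] by (simp add: I_def)
    have inj: "inj_on u I"
    proof (rule inj_onI, rule ccontr)
      fix i j assume "i \<in> I" "j \<in> I" "u i = u j" "i \<noteq> j"
      then show False using uI[of i] ou unfolding orthosys_def by (metis zero_neq_one)
    qed
    have "u ` I \<subseteq> E"
    proof safe
      fix i assume i: "i \<in> I"
      have "cinner (A z) (A (u i)) = complex_of_real (c\<^sup>2) * cinner z (u i)" for z
        using eig[of i z] i cinner_commute[of "A z" "A (u i)"] cinner_commute[of z "u i"]
        by (simp add: I_def)
      then show "u i \<in> E" by (simp add: E)
    qed
    moreover have "E \<subseteq> cvs.span (u ` I)"
    proof
      fix x assume x: "x \<in> E"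
      have off: "cinner (u i) x = 0" if "i \<notin> I" for i
      proof -
        have "complex_of_real ((s i)\<^sup>2) * cinner (u i) x = complex_of_real (c\<^sup>2) * cinner (u i) x"
          using x[unfolded E, rule_format, of "u i"] eig[of i x] by (rule trans[OF sym, rotated])
        then have "complex_of_real ((s i)\<^sup>2 - c\<^sup>2) * cinner (u i) x = 0"
          by (simp add: left_diff_distrib del: of_real_power)
        moreover have "(s i)\<^sup>2 - c\<^sup>2 \<noteq> 0"
          using that s(2)[of i] c by (simp add: I_def power2_eq_iff_nonneg)
        ultimately show ?thesis by (simp only: mult_eq_0_iff of_real_eq_0_iff) auto
      qed
      define y where "y = (\<Sum>i\<in>I. cinner (u i) x *\<^sub>C u i)"
      have yE: "y \<in> cvs.span (u ` I)"
        unfolding y_def by (intro cvs.span_sum cvs.span_scale cvs.span_base) auto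
      have uy: "cinner (u i) (x - y) = 0" for i
        using off[of i] cinner_orthosys_sum[OF ou finI, of i "\<lambda>i. cinner (u i) x"]
        by (cases "u i = 0") (auto simp: y_def cinner_diff_right)
      have "A (x - y) = 0"
      proof -
        have "proj u n (x - y) = 0" for n by (simp add: proj_def uy)
        then have "norm (A (x - y)) \<le> s n * norm (x - y)" for n using tail[of "x - y" n] by simp
        moreover have "(\<lambda>n. s n * norm (x - y)) \<longlonglongrightarrow> 0" using s(3) by (rule tendsto_mult_left_zero)
        ultimately have "norm (A (x - y)) \<le> 0" by (intro LIMSEQ_le_const) auto
        then show ?thesis by simp
      qed
      moreover have "cinner (A (x - y)) (A (x - y)) = complex_of_real (c\<^sup>2) * cinner (x - y) (x - y)"
      proof -
        define d where "d = x - y"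
        have "cinner (A z) (A (u i)) = complex_of_real (c\<^sup>2) * cinner z (u i)" if "i \<in> I" for z i
          using \<open>u ` I \<subseteq> E\<close> that by (auto simp: E)
        then have dy: "cinner (A d) (A y) = complex_of_real (c\<^sup>2) * cinner d y"
          by (simp add: y_def clinear_sum[OF lin] clinear_scaleC[OF lin] cinner_sum_right
              cinner_scaleC_right sum_distrib_left mult_ac)
        have dx: "cinner (A d) (A x) = complex_of_real (c\<^sup>2) * cinner d x" using x by (simp add: E)
        have "cinner (A d) (A x - A y) = complex_of_real (c\<^sup>2) * cinner d (x - y)"
          unfolding cinner_diff_right dx dy by (rule right_diff_distrib[symmetric])
        then show ?thesis unfolding clinear_diff[OF lin, symmetric] by (simp only: d_def)
      qed
      ultimately have "cinner (x - y) (x - y) = 0" using c by simp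
      then have "x = y" by (simp add: cinner_self_eq_0)
      then show "x \<in> cvs.span (u ` I)" using yE by simp
    qed
    moreover have "cvs.independent (u ` I)"
    proof (rule cvs.independent_if_scalars_zero)
      show "finite (u ` I)" using finI by simp
      fix f x assume f: "(\<Sum>x\<in>u ` I. f x *\<^sub>C x) = 0" and x: "x \<in> u ` I"
      obtain k where k: "k \<in> I" "x = u k" using x by blast
      have "(\<Sum>i\<in>I. f (u i) *\<^sub>C u i) = 0" using f inj by (simp add: sum.reindex)
      then have "cinner (u k) (\<Sum>i\<in>I. f (u i) *\<^sub>C u i) = 0" by simp
      then show "f x = 0" using k uI[of k] by (simp add: cinner_orthosys_sum[OF ou finI])
    qed
    ultimately have "cvs.dim E = card (u ` I)"
      by (intro cvs.dim_unique[where B = "u ` I"]) auto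
    then show "card {i. s i = c} = cvs.dim {x. cadjoint A (A x) = complex_of_real (c\<^sup>2) *\<^sub>C x}"
      using inj by (simp add: card_image E_def I_def)
  qed (use s in auto)
  then show ?thesis
    unfolding singular_value_def using singular_value_sequence_unique by blast
qed

section \<open>The Schatten norm as a supremum over Bessel systems\<close>

lemma bessel_sgn: "bessel {i} (\<lambda>_. sgn (x :: 'h::complex_inner))"
proof -
  have "(cmod (cinner (sgn x) z))\<^sup>2 \<le> (norm z)\<^sup>2" for z
  proof (rule power_mono)
    have "cmod (cinner (sgn x) z) \<le> norm (sgn x) * norm z" by (rule cinner_Cauchy_Schwarz)
    also have "\<dots> \<le> norm z" by (simp add: norm_sgn)
    finally show "cmod (cinner (sgn x) z) \<le> norm z" .
  qed simp
  then show ?thesis by (simp add: bessel_def)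
qed

text \<open>The inequality \<open>x y \<le> (x\<^sup>2 + y\<^sup>2) / 2\<close> bounds the entries by a matrix that is doubly
  substochastic by the Bessel inequality for the four families.\<close>

lemma bessel_pairing_le:
  assumes p: "1 \<le> p" and g: "bessel I g" and h: "bessel I h" and e: "bessel J e" and f: "bessel J f"
  shows "pnorm p J (\<lambda>j. cmod (\<Sum>i\<in>I. t i * (cinner (h i) (f j) * cinner (e j) (g i))))
     \<le> pnorm p I (\<lambda>i. cmod (t i))"
proof -
  define m where "m j i = ((cmod (cinner (g i) (e j)))\<^sup>2 + (cmod (cinner (h i) (f j)))\<^sup>2) / 2" for i j
  define m' where "m' j i = ((cmod (cinner (e j) (g i)))\<^sup>2 + (cmod (cinner (f j) (h i)))\<^sup>2) / 2" for i j
  have mm': "m j i = m' j i" for i j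
    using cinner_commute[of "g i" "e j"] cinner_commute[of "h i" "f j"] by (simp add: m_def m'_def)
  have I: "finite I" and J: "finite J" using g e by (auto dest: bessel_finite)
  have sq: "(norm (e j))\<^sup>2 \<le> 1" "(norm (f j))\<^sup>2 \<le> 1" if "j \<in> J" for j
    using bessel_norm_le[OF e that] bessel_norm_le[OF f that] by (auto simp: power_le_one)
  have sq': "(norm (g i))\<^sup>2 \<le> 1" "(norm (h i))\<^sup>2 \<le> 1" if "i \<in> I" for i
    using bessel_norm_le[OF g that] bessel_norm_le[OF h that] by (auto simp: power_le_one)
  have rows: "(\<Sum>i\<in>I. m j i) \<le> 1" if "j \<in> J" for j
    using besselD[OF g, of "e j"] besselD[OF h, of "f j"] sq[OF that]
    by (simp add: m_def sum.distrib flip: sum_divide_distrib)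
  have cols: "(\<Sum>j\<in>J. m j i) \<le> 1" if "i \<in> I" for i
    unfolding mm' using besselD[OF e, of "g i"] besselD[OF f, of "h i"] sq'[OF that]
    by (simp add: m'_def sum.distrib flip: sum_divide_distrib)
  have "cmod (\<Sum>i\<in>I. t i * (cinner (h i) (f j) * cinner (e j) (g i))) \<le> (\<Sum>i\<in>I. m j i * cmod (t i))" for j
  proof -
    have "cmod (t i * (cinner (h i) (f j) * cinner (e j) (g i))) \<le> m j i * cmod (t i)" for i
    proof -
      have "cmod (cinner (h i) (f j)) * cmod (cinner (e j) (g i)) \<le> m j i"
        using zero_le_power2[of "cmod (cinner (h i) (f j)) - cmod (cinner (e j) (g i))"]
          cinner_commute[of "g i" "e j"] unfolding m_def by (simp add: power2_eq_square algebra_simps)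
      then have "cmod (t i) * (cmod (cinner (h i) (f j)) * cmod (cinner (e j) (g i))) \<le> cmod (t i) * m j i"
        by (rule mult_left_mono) simp
      then show ?thesis by (simp add: norm_mult mult.commute)
    qed
    then show ?thesis by (intro sum_norm_le)
  qed
  then have "pnorm p J (\<lambda>j. cmod (\<Sum>i\<in>I. t i * (cinner (h i) (f j) * cinner (e j) (g i))))
      \<le> pnorm p J (\<lambda>j. \<Sum>i\<in>I. m j i * \<bar>cmod (t i)\<bar>)"
    using p by (intro pnorm_mono) (auto intro: order_trans[OF _ abs_ge_self])
  also have "\<dots> \<le> pnorm p I (\<lambda>i. cmod (t i))"
    by (rule pnorm_substochastic[OF p I J _ rows cols]) (simp add: m_def)
  finally show ?thesis .
qed

locale schatten = hilbert_basis b for b :: "nat \<Rightarrow> 'h::chilbert_space" +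
  fixes p :: real
  assumes p: "1 \<le> p"
begin

abbreviation C :: "('h \<Rightarrow> 'h) set" where "C \<equiv> schatten_space p"
abbreviation nC :: "('h \<Rightarrow> 'h) \<Rightarrow> real" where "nC \<equiv> schatten_norm p"

lemma p0: "0 < p" using p by simp

lemma schatten_compact: "A \<in> C \<Longrightarrow> compact_hilbert_operator A"
  by (simp add: schatten_space_def)

lemma schatten_clinear: "A \<in> C \<Longrightarrow> clinear A"
  by (simp add: schatten_compact compact_hilbert_operator_clinear)

lemma schatten_norm_nonneg [simp]: "0 \<le> nC A"
  by (simp add: schatten_norm_def)

lemma schmidt_proj:
  assumes A: "clinear A" and svd: "schmidt_decomposition A s u v"
  shows "A (proj u n x) = (\<Sum>i<n. (complex_of_real (s i) *\<^sub>C rank_one (v i) (u i)) x)"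
  using svd
  by (simp add: proj_def clinear_sum[OF A] clinear_scaleC[OF A] schmidt_decomposition_def rank_one_def
      scaleC_scaleC scaleC_fun_def mult.commute)

lemma schmidt_proj_tendsto:
  assumes A: "clinear A" and svd: "schmidt_decomposition A s u v"
  shows "(\<lambda>n. A (proj u n x)) \<longlonglongrightarrow> A x"
proof -
  have s: "s \<longlonglongrightarrow> 0" and tail: "\<And>n. norm (A (x - proj u n x)) \<le> s n * norm x"
    using svd by (auto simp: schmidt_decomposition_def)
  have "(\<lambda>n. A x - A (proj u n x)) \<longlonglongrightarrow> 0"
  proof (rule Lim_null_comparison)
    show "\<forall>\<^sub>F n in sequentially. norm (A x - A (proj u n x)) \<le> s n * norm x"
      using tail by (simp add: clinear_diff[OF A])
    show "(\<lambda>n. s n * norm x) \<longlonglongrightarrow> 0" using s by (rule tendsto_mult_left_zero)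
  qed
  from tendsto_diff[OF tendsto_const this, of "A x"] show ?thesis by simp
qed

lemma schatten_schmidt_iff:
  assumes A: "compact_hilbert_operator A" and svd: "schmidt_decomposition A s u v" and K: "0 \<le> K"
  shows "A \<in> C \<and> nC A \<le> K \<longleftrightarrow> (\<forall>n. pnorm p {..<n} s \<le> K)"
proof -
  have "\<bar>s n\<bar> = s n" for n using svd by (simp add: schmidt_decomposition_def)
  then show ?thesis
    using summable_powr_iff_pnorm_bounded[OF p0 K, of s] A singular_value_schmidt[OF A svd]
    by (simp add: schatten_space_def schatten_norm_def)
qed

text \<open>The tail of the Schmidt decomposition, paired with Bessel families, is a limit of finite sums to
  which the previous estimate applies. With \<open>N = 0\<close> this bounds the whole operator.\<close>

lemma schmidt_pairing_le:
  assumes A: "clinear A" and svd: "schmidt_decomposition A s u v"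
    and K: "\<And>M. pnorm p {N..<M} s \<le> K"
    and e: "bessel J e" and f: "bessel J f"
  shows "pnorm p J (\<lambda>j. cmod (cinner (e j)
    (A (f j) - (\<Sum>i<N. (complex_of_real (s i) *\<^sub>C rank_one (v i) (u i)) (f j))))) \<le> K"
proof (rule LIMSEQ_le_const2)
  let ?R = "\<lambda>x. \<Sum>i<N. (complex_of_real (s i) *\<^sub>C rank_one (v i) (u i)) x"
  have ou: "orthosys u" and ov: "orthosys v" using svd by (auto simp: schmidt_decomposition_def)
  show "(\<lambda>M. pnorm p J (\<lambda>j. cmod (cinner (e j) (A (proj u M (f j)) - ?R (f j)))))
     \<longlonglongrightarrow> pnorm p J (\<lambda>j. cmod (cinner (e j) (A (f j) - ?R (f j))))"
    using p0 bessel_finite[OF e]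
    by (intro tendsto_pnorm tendsto_intros schmidt_proj_tendsto[OF A svd])
  have "pnorm p J (\<lambda>j. cmod (cinner (e j) (A (proj u M (f j)) - ?R (f j)))) \<le> K" if M: "M \<ge> N" for M
  proof -
    have "A (proj u M x) - ?R x = (\<Sum>i\<in>{N..<M}. (complex_of_real (s i) *\<^sub>C rank_one (v i) (u i)) x)" for x
    proof -
      have "A (proj u M x) = (\<Sum>i\<in>{..<N} \<union> {N..<M}. (complex_of_real (s i) *\<^sub>C rank_one (v i) (u i)) x)"
        unfolding schmidt_proj[OF A svd] using M by (intro sum.cong) auto
      also have "\<dots> = ?R x + (\<Sum>i\<in>{N..<M}. (complex_of_real (s i) *\<^sub>C rank_one (v i) (u i)) x)"
        by (rule sum.union_disjoint) auto
      finally show ?thesis by simp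
    qed
    then have "cinner (e j) (A (proj u M (f j)) - ?R (f j))
        = (\<Sum>i\<in>{N..<M}. complex_of_real (s i) * (cinner (u i) (f j) * cinner (e j) (v i)))" for j
      by (simp add: cinner_sum_right scaleC_fun_def rank_one_def cinner_scaleC_right mult.assoc)
    then have "pnorm p J (\<lambda>j. cmod (cinner (e j) (A (proj u M (f j)) - ?R (f j))))
        \<le> pnorm p {N..<M} (\<lambda>i. cmod (complex_of_real (s i)))"
      using bessel_pairing_le[OF p bessel_orthosys[OF ov] bessel_orthosys[OF ou] e f,
          of "{N..<M}" "\<lambda>i. complex_of_real (s i)"] by simp
    also have "\<dots> = pnorm p {N..<M} s" by (intro pnorm_cong) auto
    also have "\<dots> \<le> K" by (rule K)
    finally show ?thesis .
  qed
  then show "\<exists>N. \<forall>M\<ge>N. pnorm p J (\<lambda>j. cmod (cinner (e j) (A (proj u M (f j)) - ?R (f j)))) \<le> K"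
    by blast
qed

text \<open>Together with the next lemma: the Schatten norm is a supremum over pairs of Bessel families.\<close>

lemma schatten_pairing_le:
  assumes A: "A \<in> C" and e: "bessel J e" and f: "bessel J f"
  shows "pnorm p J (\<lambda>j. cmod (cinner (e j) (A (f j)))) \<le> nC A"
proof -
  obtain s u v where svd: "schmidt_decomposition A s u v"
    using schmidt_decomposition_exists[OF schatten_compact[OF A]] by blast
  have "pnorm p {0..<M} s \<le> nC A" for M
    using schatten_schmidt_iff[OF schatten_compact[OF A] svd, of "nC A"] A by (simp add: atLeast0LessThan)
  from schmidt_pairing_le[OF schatten_clinear[OF A] svd this e f] show ?thesis by simp
qed

text \<open>The families \<open>v\<close> and \<open>u\<close> of a Schmidt decomposition reproduce the singular values.\<close>

lemma schattenI:
  assumes A: "compact_hilbert_operator A" and K: "0 \<le> K"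
    and le: "\<And>n e f. bessel {..<n} e \<Longrightarrow> bessel {..<n::nat} f \<Longrightarrow>
       pnorm p {..<n} (\<lambda>j. cmod (cinner (e j) (A (f j)))) \<le> K"
  shows "A \<in> C \<and> nC A \<le> K"
proof -
  obtain s u v where svd: "schmidt_decomposition A s u v"
    using schmidt_decomposition_exists[OF A] by blast
  have ou: "orthosys u" and ov: "orthosys v" using svd by (auto simp: schmidt_decomposition_def)
  have "cinner (v i) (A (u i)) = complex_of_real (s i)" for i
    using svd by (auto simp: schmidt_decomposition_def cinner_scaleC_right orthosys_def)
  then have "pnorm p {..<n} s = pnorm p {..<n} (\<lambda>j. cmod (cinner (v j) (A (u j))))" for n
    by (intro pnorm_cong) auto
  then have "pnorm p {..<n} s \<le> K" for n
    using le[OF bessel_orthosys[OF ov] bessel_orthosys[OF ou], of n] by simp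
  then show ?thesis using schatten_schmidt_iff[OF A svd K] by blast
qed

lemma cinner_schatten_le:
  assumes A: "A \<in> C" shows "cmod (cinner e (A f)) \<le> nC A * norm e * norm f"
proof (cases "e = 0 \<or> f = 0")
  case True
  then show ?thesis by (auto simp: clinear_zero[OF schatten_clinear[OF A]])
next
  case False
  have "cmod (cinner (sgn e) (A (sgn f))) \<le> nC A"
    using schatten_pairing_le[OF A bessel_sgn[of "0::nat" e] bessel_sgn[of 0 f]] p0 by (simp add: pnorm_def powr_powr)
  then have "cmod (cinner e (A f)) / (norm e * norm f) \<le> nC A"
    by (simp add: sgn_scaleC clinear_scaleC[OF schatten_clinear[OF A]] cinner_scaleC_left
        cinner_scaleC_right norm_mult norm_divide mult.commute)
  then show ?thesis using False by (simp add: field_simps)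
qed

lemma norm_schatten_le:
  assumes A: "A \<in> C" shows "norm (A x) \<le> nC A * norm x"
proof -
  have "norm (A x) * norm (A x) = cmod (cinner (A x) (A x))"
    by (simp add: cinner_self power2_eq_square norm_mult)
  also have "\<dots> \<le> norm (A x) * (nC A * norm x)" using cinner_schatten_le[OF A, of "A x" x] by (simp add: mult_ac)
  finally show ?thesis by (cases "A x = 0") auto
qed

lemma schatten_add:
  assumes A: "A \<in> C" and B: "B \<in> C" shows "A + B \<in> C \<and> nC (A + B) \<le> nC A + nC B"
proof (rule schattenI)
  show "compact_hilbert_operator (A + B)"
    using A B by (intro compact_hilbert_operator_add schatten_compact)
  fix n and e f :: "nat \<Rightarrow> 'h" assume e: "bessel {..<n} e" and f: "bessel {..<n::nat} f"
  have "pnorm p {..<n} (\<lambda>j. cmod (cinner (e j) ((A + B) (f j))))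
     \<le> pnorm p {..<n} (\<lambda>j. cmod (cinner (e j) (A (f j))) + cmod (cinner (e j) (B (f j))))"
    using p0 by (intro pnorm_mono) (auto simp: cinner_add_right intro: norm_triangle_ineq)
  also have "\<dots> \<le> pnorm p {..<n} (\<lambda>j. cmod (cinner (e j) (A (f j))))
      + pnorm p {..<n} (\<lambda>j. cmod (cinner (e j) (B (f j))))"
    by (intro pnorm_triangle p) simp
  also have "\<dots> \<le> nC A + nC B" by (intro add_mono schatten_pairing_le A B e f)
  finally show "pnorm p {..<n} (\<lambda>j. cmod (cinner (e j) ((A + B) (f j)))) \<le> nC A + nC B" .
qed simp

lemma schatten_scaleC_le:
  assumes A: "A \<in> C" shows "a *\<^sub>C A \<in> C \<and> nC (a *\<^sub>C A) \<le> cmod a * nC A"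
proof (rule schattenI)
  show "compact_hilbert_operator (a *\<^sub>C A)"
    using A by (intro compact_hilbert_operator_scaleC schatten_compact)
  fix n and e f :: "nat \<Rightarrow> 'h" assume e: "bessel {..<n} e" and f: "bessel {..<n::nat} f"
  have "pnorm p {..<n} (\<lambda>j. cmod (cinner (e j) ((a *\<^sub>C A) (f j))))
    = cmod a * pnorm p {..<n} (\<lambda>j. cmod (cinner (e j) (A (f j))))"
    using p0 by (simp add: scaleC_fun_def cinner_scaleC_right norm_mult pnorm_scale)
  also have "\<dots> \<le> cmod a * nC A" by (intro mult_left_mono schatten_pairing_le A e f) simp
  finally show "pnorm p {..<n} (\<lambda>j. cmod (cinner (e j) ((a *\<^sub>C A) (f j)))) \<le> cmod a * nC A" .
qed simp

lemma schatten_scaleC: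
  assumes A: "A \<in> C" shows "nC (a *\<^sub>C A) = cmod a * nC A"
proof (cases "a = 0")
  case True
  then show ?thesis using schatten_scaleC_le[OF A, of 0] schatten_norm_nonneg[of "0 *\<^sub>C A"] by (auto intro: antisym)
next
  case False
  have "A = (1 / a) *\<^sub>C (a *\<^sub>C A)" using False by (simp add: scaleC_scaleC scaleC_one)
  then have "nC A \<le> cmod (1 / a) * nC (a *\<^sub>C A)"
    using schatten_scaleC_le[of "a *\<^sub>C A" "1 / a"] schatten_scaleC_le[OF A, of a] by metis
  then have "cmod a * nC A \<le> nC (a *\<^sub>C A)" using False by (simp add: norm_divide field_simps)
  then show ?thesis using schatten_scaleC_le[OF A, of a] by simp
qed

lemma schatten_zero: "0 \<in> C"
  using schattenI[OF compact_hilbert_operator_zero, of 0] by simp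

lemma subspace_schatten: "cvs.subspace C"
  using schatten_zero schatten_add schatten_scaleC_le by (auto simp: cvs.subspace_def)

lemma schatten_diff: "A \<in> C \<Longrightarrow> B \<in> C \<Longrightarrow> A - B \<in> C"
  using subspace_schatten by (rule cvs.subspace_diff)

lemma schatten_sum: "(\<And>i. i \<in> I \<Longrightarrow> A i \<in> C) \<Longrightarrow> (\<Sum>i\<in>I. A i) \<in> C"
  using subspace_schatten by (rule cvs.subspace_sum)

lemma schatten_norm_eq_0: assumes "A \<in> C" "nC A = 0" shows "A = 0"
proof
  fix x show "A x = 0 x" using norm_schatten_le[OF assms(1), of x] assms(2) by simp
qed

lemma schatten_bessel_sum:
  assumes g: "bessel I g" and h: "bessel I h"
  shows "(\<Sum>i\<in>I. t i *\<^sub>C rank_one (g i) (h i)) \<in> C \<and>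
     nC (\<Sum>i\<in>I. t i *\<^sub>C rank_one (g i) (h i)) \<le> pnorm p I (\<lambda>i. cmod (t i))"
proof (rule schattenI)
  show "compact_hilbert_operator (\<Sum>i\<in>I. t i *\<^sub>C rank_one (g i) (h i))"
    by (intro compact_hilbert_operator_sum compact_hilbert_operator_scaleC compact_hilbert_operator_rank_one)
  fix n and e f :: "nat \<Rightarrow> 'h" assume e: "bessel {..<n} e" and f: "bessel {..<n::nat} f"
  show "pnorm p {..<n} (\<lambda>j. cmod (cinner (e j) ((\<Sum>i\<in>I. t i *\<^sub>C rank_one (g i) (h i)) (f j))))
     \<le> pnorm p I (\<lambda>i. cmod (t i))"
    using bessel_pairing_le[OF p g h e f, of t]
    by (simp add: sum_fun_apply cinner_sum_right scaleC_fun_def rank_one_def cinner_scaleC_right mult.assoc)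
qed simp

lemma schatten_rank_one: "rank_one v u \<in> C \<and> nC (rank_one v u) \<le> norm v * norm u"
proof (rule schattenI)
  show "compact_hilbert_operator (rank_one v u)" by (rule compact_hilbert_operator_rank_one)
  fix n and e f :: "nat \<Rightarrow> 'h" assume e: "bessel {..<n} e" and f: "bessel {..<n::nat} f"
  have "complex_of_real (norm x) *\<^sub>C sgn x = x" for x :: 'h
    by (cases "x = 0") (auto simp: sgn_scaleC scaleC_scaleC scaleC_one simp flip: of_real_mult)
  then have "rank_one v u x = complex_of_real (norm v * norm u) *\<^sub>C rank_one (sgn v) (sgn u) x" for x
    unfolding rank_one_def by (metis (no_types, lifting) cinner_scaleC_left complex_cnj_complex_of_real
        mult.commute of_real_mult scaleC_scaleC)
  then have "rank_one v u = complex_of_real (norm v * norm u) *\<^sub>C rank_one (sgn v) (sgn u)"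
    by (auto simp: scaleC_fun_def)
  then show "pnorm p {..<n} (\<lambda>j. cmod (cinner (e j) (rank_one v u (f j)))) \<le> norm v * norm u"
    using bessel_pairing_le[OF p bessel_sgn[of "0::nat" v] bessel_sgn[of 0 u] e f, of "\<lambda>_. complex_of_real (norm v * norm u)"] p0
    by (simp add: pnorm_def[of p "{0}"] powr_powr scaleC_fun_def rank_one_def cinner_scaleC_right mult_ac
        norm_mult)
qed simp

text \<open>A Cauchy sequence converges pointwise. The supremum over Bessel families is lower semicontinuous
  under pointwise limits, so the limit is also the limit in norm.\<close>

lemma schatten_complete:
  assumes X: "\<And>n::nat. X n \<in> C"
    and Cauchy: "\<And>e. 0 < e \<Longrightarrow> \<exists>N. \<forall>m\<ge>N. \<forall>n\<ge>N. nC (X m - X n) < e"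
  shows "\<exists>A\<in>C. (\<lambda>n. nC (X n - A)) \<longlonglongrightarrow> 0"
proof -
  have lin: "clinear (X n)" for n by (intro schatten_clinear X)
  have "convergent (\<lambda>n. X n x)" for x
  proof (rule Cauchy_convergent, rule CauchyI)
    fix e :: real assume e: "0 < e"
    then have "0 < e / (norm x + 1)" by (simp add: add_nonneg_pos)
    then obtain N where N: "\<And>m n. m \<ge> N \<Longrightarrow> n \<ge> N \<Longrightarrow> nC (X m - X n) < e / (norm x + 1)"
      using Cauchy by blast
    have "norm (X m x - X n x) < e" if "m \<ge> N" "n \<ge> N" for m n
    proof -
      have "norm (X m x - X n x) \<le> nC (X m - X n) * norm x"
        using norm_schatten_le[OF schatten_diff[OF X X], of m n x] by simp
      also have "\<dots> \<le> nC (X m - X n) * (norm x + 1)" by (intro mult_left_mono) auto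
      also have "\<dots> < e / (norm x + 1) * (norm x + 1)"
        using N[OF that] by (intro mult_strict_right_mono) (auto simp: add_nonneg_pos)
      also have "\<dots> = e"
      proof -
        have "norm x + 1 \<noteq> 0" using norm_ge_zero[of x] by linarith
        then show ?thesis by simp
      qed
      finally show ?thesis .
    qed
    then show "\<exists>M. \<forall>m\<ge>M. \<forall>n\<ge>M. norm (X m x - X n x) < e" by blast
  qed
  then obtain A where A: "\<And>x. (\<lambda>n. X n x) \<longlonglongrightarrow> A x" unfolding convergent_def by metis
  have "A (x + y) = A x + A y" for x y
    using tendsto_add[OF A[of x] A[of y]] A[of "x + y"] LIMSEQ_unique by (simp add: clinear_add[OF lin])
  moreover have "A (a *\<^sub>C x) = a *\<^sub>C A x" for a x
    using tendsto_scaleC[OF tendsto_const A[of x], of a] A[of "a *\<^sub>C x"] LIMSEQ_unique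
    by (simp add: clinear_scaleC[OF lin])
  ultimately have linA: "clinear A" by (simp add: clinear_def)
  have close: "\<exists>N. \<forall>n\<ge>N. (\<forall>x. norm (A x - X n x) \<le> e * norm x) \<and>
     (\<forall>k. \<forall>g h. bessel {..<k::nat} g \<longrightarrow> bessel {..<k} h \<longrightarrow>
         pnorm p {..<k} (\<lambda>j. cmod (cinner (g j) (X n (h j) - A (h j)))) \<le> e)" if e: "0 < e" for e
  proof -
    obtain N where N: "\<And>m n. m \<ge> N \<Longrightarrow> n \<ge> N \<Longrightarrow> nC (X m - X n) < e" using Cauchy[OF e] by blast
    have 1: "norm (A x - X n x) \<le> e * norm x" if n: "n \<ge> N" for n x
    proof (rule LIMSEQ_le_const2)
      show "(\<lambda>m. norm (X m x - X n x)) \<longlonglongrightarrow> norm (A x - X n x)" by (intro tendsto_intros A)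
      have "norm (X m x - X n x) \<le> e * norm x" if "m \<ge> N" for m
      proof -
        have "norm (X m x - X n x) \<le> nC (X m - X n) * norm x"
          using norm_schatten_le[OF schatten_diff[OF X X], of m n x] by simp
        also have "\<dots> \<le> e * norm x" using N[OF that n] by (intro mult_right_mono) auto
        finally show ?thesis .
      qed
      then show "\<exists>N. \<forall>m\<ge>N. norm (X m x - X n x) \<le> e * norm x" by blast
    qed
    have 2: "pnorm p {..<k} (\<lambda>j. cmod (cinner (g j) (X n (h j) - A (h j)))) \<le> e"
      if n: "n \<ge> N" and g: "bessel {..<k} g" and h: "bessel {..<k::nat} h" for n k g h
    proof (rule LIMSEQ_le_const2)
      show "(\<lambda>m. pnorm p {..<k} (\<lambda>j. cmod (cinner (g j) (X n (h j) - X m (h j)))))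
         \<longlonglongrightarrow> pnorm p {..<k} (\<lambda>j. cmod (cinner (g j) (X n (h j) - A (h j))))"
        using p0 by (intro tendsto_pnorm tendsto_intros A) auto
      have "pnorm p {..<k} (\<lambda>j. cmod (cinner (g j) (X n (h j) - X m (h j)))) \<le> e" if "m \<ge> N" for m
        using schatten_pairing_le[OF schatten_diff[OF X X] g h, of n m] N[OF n that] by simp
      then show "\<exists>N. \<forall>m\<ge>N. pnorm p {..<k} (\<lambda>j. cmod (cinner (g j) (X n (h j) - X m (h j)))) \<le> e"
        by blast
    qed
    show ?thesis using 1 2 by blast
  qed
  have compA: "compact_hilbert_operator A"
  proof (rule compact_hilbert_operator_limit[OF linA])
    fix e :: real assume "0 < e"
    then obtain N where "\<forall>x. norm (A x - X N x) \<le> e * norm x" using close by blast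
    then show "\<exists>B. compact_hilbert_operator B \<and> (\<forall>x. norm (A x - B x) \<le> e * norm x)"
      using schatten_compact[OF X[of N]] by blast
  qed
  have compd: "compact_hilbert_operator (X n - A)" for n
    using compact_hilbert_operator_add[OF schatten_compact[OF X[of n]]
        compact_hilbert_operator_scaleC[OF compA, of "-1"]]
    by (simp add: scaleC_minus_one)
  have lim: "\<exists>N. \<forall>n\<ge>N. X n - A \<in> C \<and> nC (X n - A) \<le> e" if e: "0 < e" for e
  proof -
    obtain N where N: "\<And>n k g h. n \<ge> N \<Longrightarrow> bessel {..<k::nat} g \<Longrightarrow> bessel {..<k} h \<Longrightarrow>
         pnorm p {..<k} (\<lambda>j. cmod (cinner (g j) (X n (h j) - A (h j)))) \<le> e"
      using close[OF e] by blast
    have "X n - A \<in> C \<and> nC (X n - A) \<le> e" if "n \<ge> N" for n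
      using N[OF that] e by (intro schattenI compd) auto
    then show ?thesis by blast
  qed
  obtain N where "X N - A \<in> C" using lim[of 1] by auto
  then have "X N - (X N - A) \<in> C" by (rule schatten_diff[OF X])
  moreover have "X N - (X N - A) = A" by (rule ext) simp
  ultimately have "A \<in> C" by (simp only:)
  moreover have "(\<lambda>n. nC (X n - A)) \<longlonglongrightarrow> 0"
  proof (rule LIMSEQ_I)
    fix r :: real assume r: "0 < r"
    then obtain N where "\<And>n. n \<ge> N \<Longrightarrow> nC (X n - A) \<le> r / 2" using lim[of "r / 2"] by auto
    then show "\<exists>no. \<forall>n\<ge>no. norm (nC (X n - A) - 0) < r"
      using r by (intro exI[of _ N]) (force intro: le_less_trans)
  qed
  ultimately show ?thesis by blast
qed

lemma schatten_finite_rank_approx: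
  assumes A: "A \<in> C" and e: "0 < e"
  shows "\<exists>N s u v. bessel {..<N::nat} u \<and> bessel {..<N} v \<and> (\<forall>i. 0 \<le> s i) \<and>
    pnorm p {..<N} s \<le> nC A \<and>
    nC (A - (\<Sum>i<N. complex_of_real (s i) *\<^sub>C rank_one (v i) (u i))) \<le> e"
proof -
  obtain s u v where svd: "schmidt_decomposition A s u v"
    using schmidt_decomposition_exists[OF schatten_compact[OF A]] by blast
  have ou: "orthosys u" and ov: "orthosys v" and s0: "\<And>i. 0 \<le> s i"
    using svd by (auto simp: schmidt_decomposition_def)
  have le: "pnorm p {..<n} s \<le> nC A" for n
    using schatten_schmidt_iff[OF schatten_compact[OF A] svd, of "nC A"] A by simp
  have "summable (\<lambda>i. \<bar>s i\<bar> powr p)"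
    using le summable_powr_iff_pnorm_bounded[OF p0, of "nC A" s] by simp
  then obtain N where N: "\<And>m n. m \<ge> N \<Longrightarrow> norm (\<Sum>i=m..<n. \<bar>s i\<bar> powr p) < e powr p"
    unfolding summable_Cauchy using e by (metis powr_gt_zero less_irrefl)
  have tail: "pnorm p {N..<M} s \<le> e" for M
    using N[of N M] e p0 by (subst pnorm_le_iff) (auto simp: sum_nonneg)
  let ?R = "\<Sum>i<N. complex_of_real (s i) *\<^sub>C rank_one (v i) (u i)"
  have R: "?R \<in> C" using schatten_bessel_sum[OF bessel_orthosys[OF ov] bessel_orthosys[OF ou]] by auto
  have "A - ?R \<in> C \<and> nC (A - ?R) \<le> e"
  proof (rule schattenI)
    show "compact_hilbert_operator (A - ?R)" by (intro schatten_compact schatten_diff A R)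
    fix n and g h :: "nat \<Rightarrow> 'h" assume g: "bessel {..<n} g" and h: "bessel {..<n::nat} h"
    show "pnorm p {..<n} (\<lambda>j. cmod (cinner (g j) ((A - ?R) (h j)))) \<le> e"
      using schmidt_pairing_le[OF schatten_clinear[OF A] svd tail g h] by (simp add: sum_fun_apply)
  qed (use e in simp)
  then show ?thesis
    using bessel_orthosys[OF ov, of "{..<N}"] bessel_orthosys[OF ou, of "{..<N}"] s0 le[of N] by blast
qed

section \<open>Compressions to finite-dimensional corners\<close>

text \<open>The operator \<open>P\<^sub>n y P\<^sub>n\<close>, written through matrix entries so that its finite rank and its
  dependence on finitely many functionals of \<open>y\<close> are visible.\<close>

definition compression :: "nat \<Rightarrow> ('h \<Rightarrow> 'h) \<Rightarrow> 'h \<Rightarrow> 'h" where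
  "compression n y = (\<Sum>a<n. \<Sum>c<n. cinner (b a) (y (b c)) *\<^sub>C rank_one (b a) (b c))"

lemma compression_apply:
  assumes "clinear y" shows "compression n y x = proj b n (y (proj b n x))"
  unfolding compression_def proj_def
  by (simp add: sum_fun_apply scaleC_fun_def rank_one_def clinear_sum[OF assms] clinear_scaleC[OF assms]
      cinner_sum_right cinner_scaleC_right cvs.scale_sum_left scaleC_scaleC mult.commute)

lemma compression_schatten: "compression n y \<in> C"
  unfolding compression_def
  by (intro schatten_sum) (use schatten_rank_one schatten_scaleC_le in blast)

lemma norm_compression_le:
  assumes y: "y \<in> C" shows "nC (compression n y) \<le> nC y"
proof -
  have "compression n y \<in> C \<and> nC (compression n y) \<le> nC y"
  proof (rule schattenI)
    show "compact_hilbert_operator (compression n y)" by (intro schatten_compact compression_schatten)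
    fix k and e f :: "nat \<Rightarrow> 'h" assume e: "bessel {..<k} e" and f: "bessel {..<k::nat} f"
    show "pnorm p {..<k} (\<lambda>j. cmod (cinner (e j) (compression n y (f j)))) \<le> nC y"
      using schatten_pairing_le[OF y bessel_proj[OF ortho e, of n] bessel_proj[OF ortho f, of n]]
      by (simp add: compression_apply[OF schatten_clinear[OF y]] proj_selfadjoint)
  qed simp
  then show ?thesis by simp
qed

lemma compression_add: "compression n (x + y) = compression n x + compression n y"
  by (simp add: compression_def cinner_add_right scaleC_add_left sum.distrib)

lemma compression_scaleC: "compression n (a *\<^sub>C x) = a *\<^sub>C compression n x"
  by (simp add: compression_def scaleC_fun_def[of a x] cinner_scaleC_right cvs.scale_sum_right scaleC_scaleC)

lemma compression_clinear: "clinear (compression n)"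
  by (simp add: clinear_def compression_add compression_scaleC)

lemma compression_rank_one_tendsto:
  "(\<lambda>n. nC (rank_one v u - compression n (rank_one v u))) \<longlonglongrightarrow> 0"
proof (rule Lim_null_comparison)
  have "nC (rank_one v u - compression n (rank_one v u))
      \<le> norm (v - proj b n v) * norm u + norm v * norm (u - proj b n u)" for n
  proof -
    have "rank_one v u - compression n (rank_one v u)
      = rank_one (v - proj b n v) u + rank_one (proj b n v) (u - proj b n u)"
    proof
      fix x
      show "(rank_one v u - compression n (rank_one v u)) x
          = (rank_one (v - proj b n v) u + rank_one (proj b n v) (u - proj b n u)) x"
        by (simp add: compression_apply clinear_rank_one)
          (simp add: rank_one_def clinear_scaleC[OF proj_clinear] cinner_diff_left proj_selfadjoint
            cvs.scale_right_diff_distrib cvs.scale_left_diff_distrib)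
    qed
    then have "nC (rank_one v u - compression n (rank_one v u))
        \<le> nC (rank_one (v - proj b n v) u) + nC (rank_one (proj b n v) (u - proj b n u))"
      using schatten_add schatten_rank_one by metis
    also have "\<dots> \<le> norm (v - proj b n v) * norm u + norm (proj b n v) * norm (u - proj b n u)"
      using schatten_rank_one by (intro add_mono) auto
    also have "\<dots> \<le> norm (v - proj b n v) * norm u + norm v * norm (u - proj b n u)"
      by (intro add_left_mono mult_right_mono norm_proj_le ortho) auto
    finally show ?thesis .
  qed
  then show "\<forall>\<^sub>F n in sequentially. norm (nC (rank_one v u - compression n (rank_one v u)))
      \<le> norm (v - proj b n v) * norm u + norm v * norm (u - proj b n u)" by simp
  have "(\<lambda>n. norm (v - proj b n v) * norm u + norm v * norm (u - proj b n u))
      \<longlonglongrightarrow> norm (v - v) * norm u + norm v * norm (u - u)"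
    by (intro tendsto_intros proj_tendsto)
  then show "(\<lambda>n. norm (v - proj b n v) * norm u + norm v * norm (u - proj b n u)) \<longlonglongrightarrow> 0" by simp
qed

lemma schatten_norm_sum_le:
  "(\<And>i. i \<in> I \<Longrightarrow> A i \<in> C) \<Longrightarrow> nC (\<Sum>i\<in>I. A i) \<le> (\<Sum>i\<in>I. nC (A i))"
proof (induction I rule: infinite_finite_induct)
  case (insert i I)
  have "nC (A i + (\<Sum>i\<in>I. A i)) \<le> nC (A i) + nC (\<Sum>i\<in>I. A i)"
    using schatten_add[of "A i" "\<Sum>i\<in>I. A i"] insert schatten_sum by blast
  also have "\<dots> \<le> nC (A i) + (\<Sum>i\<in>I. nC (A i))" using insert by simp
  finally show ?case unfolding sum.insert[OF insert(1,2)] .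
qed (use schatten_scaleC[OF schatten_zero, of 0] in auto)

text \<open>True for rank one operators since \<open>P\<^sub>n\<close> tends strongly to the identity, hence for finite rank
  operators; the general case follows by approximation because compressions are contractions.\<close>

lemma compression_tendsto:
  assumes y: "y \<in> C" shows "(\<lambda>n. nC (y - compression n y)) \<longlonglongrightarrow> 0"
proof (rule LIMSEQ_I)
  fix r :: real assume r: "0 < r"
  obtain N s u v where "bessel {..<N::nat} u" "bessel {..<N} v"
    and close: "nC (y - (\<Sum>i<N. complex_of_real (s i) *\<^sub>C rank_one (v i) (u i))) \<le> r / 4"
    using schatten_finite_rank_approx[OF y, of "r / 4"] r by auto
  define z where "z = (\<Sum>i<N. complex_of_real (s i) *\<^sub>C rank_one (v i) (u i))"
  have z: "z \<in> C" unfolding z_def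
    by (intro schatten_sum) (use schatten_rank_one schatten_scaleC_le in blast)
  have "(\<lambda>n. \<Sum>i<N. cmod (complex_of_real (s i)) * nC (rank_one (v i) (u i) - compression n (rank_one (v i) (u i))))
      \<longlonglongrightarrow> (\<Sum>i<N. cmod (complex_of_real (s i)) * 0)"
    by (intro tendsto_intros compression_rank_one_tendsto)
  then have "(\<lambda>n. \<Sum>i<N. cmod (complex_of_real (s i)) * nC (rank_one (v i) (u i) - compression n (rank_one (v i) (u i))))
      \<longlonglongrightarrow> 0" by simp
  then have "\<exists>no. \<forall>n\<ge>no. norm ((\<Sum>i<N. cmod (complex_of_real (s i)) *
      nC (rank_one (v i) (u i) - compression n (rank_one (v i) (u i)))) - 0) < r / 2"
    using r by (intro LIMSEQ_D) auto
  then obtain n0 where n0: "\<And>n. n \<ge> n0 \<Longrightarrow> (\<Sum>i<N. cmod (complex_of_real (s i)) *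
      nC (rank_one (v i) (u i) - compression n (rank_one (v i) (u i)))) < r / 2"
    by force
  have "nC (y - compression n y) < r" if n: "n \<ge> n0" for n
  proof -
    define d where "d i = rank_one (v i) (u i) - compression n (rank_one (v i) (u i))" for i
    have d: "d i \<in> C" for i
      unfolding d_def using schatten_rank_one compression_schatten by (intro schatten_diff) auto
    have "z - compression n z = (\<Sum>i<N. complex_of_real (s i) *\<^sub>C d i)"
      by (simp add: z_def d_def clinear_sum[OF compression_clinear] compression_scaleC
          cvs.scale_right_diff_distrib sum_subtractf)
    then have "nC (z - compression n z) \<le> (\<Sum>i<N. nC (complex_of_real (s i) *\<^sub>C d i))"
      using schatten_norm_sum_le[of "{..<N}" "\<lambda>i. complex_of_real (s i) *\<^sub>C d i"] schatten_scaleC_le[OF d]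
      by simp
    also have "\<dots> = (\<Sum>i<N. cmod (complex_of_real (s i)) * nC (d i))"
      by (simp add: schatten_scaleC[OF d])
    finally have 1: "nC (z - compression n z) < r / 2" using n0[OF n] by (simp add: d_def)
    have 2: "nC (compression n (z - y)) \<le> r / 4"
    proof -
      have "nC (compression n (z - y)) \<le> nC ((-1) *\<^sub>C (y - z))"
        using norm_compression_le[OF schatten_diff[OF z y], of n] by (simp add: scaleC_minus_one)
      then show ?thesis using close schatten_scaleC[OF schatten_diff[OF y z], of "-1"] by (simp add: z_def)
    qed
    have eq: "y - compression n y = (y - z) + ((z - compression n z) + compression n (z - y))"
      by (simp add: clinear_diff[OF compression_clinear])
    have "nC (y - compression n y) \<le> nC (y - z) + (nC (z - compression n z) + nC (compression n (z - y)))"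
      unfolding eq
      using schatten_add[OF schatten_diff[OF y z], of "(z - compression n z) + compression n (z - y)"]
        schatten_add[OF schatten_diff[OF z compression_schatten] compression_schatten, of n z n "z - y"]
      by linarith
    then show ?thesis using 1 2 close by (simp add: z_def)
  qed
  then show "\<exists>no. \<forall>n\<ge>no. norm (nC (y - compression n y) - 0) < r" by auto
qed

end

section \<open>Normed spaces given by a carrier\<close>

locale normed_carrier =
  fixes X :: "'v::complex_vector set" and nX :: "'v \<Rightarrow> real"
  assumes subspace: "cvs.subspace X"
    and norm_nonneg: "x \<in> X \<Longrightarrow> 0 \<le> nX x"
    and norm_triangle: "x \<in> X \<Longrightarrow> y \<in> X \<Longrightarrow> nX (x + y) \<le> nX x + nX y"
    and norm_scale: "x \<in> X \<Longrightarrow> nX (a *\<^sub>C x) = cmod a * nX x"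
    and norm_definite: "x \<in> X \<Longrightarrow> nX x = 0 \<Longrightarrow> x = 0"
begin

lemma zero_mem: "0 \<in> X"
  and add_mem: "x \<in> X \<Longrightarrow> y \<in> X \<Longrightarrow> x + y \<in> X"
  and scale_mem: "x \<in> X \<Longrightarrow> a *\<^sub>C x \<in> X"
  and diff_mem: "x \<in> X \<Longrightarrow> y \<in> X \<Longrightarrow> x - y \<in> X"
  using subspace by (auto simp: cvs.subspace_0 cvs.subspace_add cvs.subspace_scale cvs.subspace_diff)

lemma norm_zero: "nX 0 = 0"
  using norm_scale[OF zero_mem, of 0] by simp

lemma norm_minus_commute: "x \<in> X \<Longrightarrow> y \<in> X \<Longrightarrow> nX (x - y) = nX (y - x)"
  using norm_scale[of "y - x" "-1"] by (simp add: diff_mem scaleC_minus_one)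

lemma norm_triangle_diff: "x \<in> X \<Longrightarrow> y \<in> X \<Longrightarrow> z \<in> X \<Longrightarrow> nX (x - z) \<le> nX (x - y) + nX (y - z)"
  using norm_triangle[of "x - y" "y - z"] by (simp add: diff_mem)

definition carrier_dist :: "'v \<Rightarrow> 'v \<Rightarrow> real" where
  "carrier_dist x y = (if x \<in> X \<and> y \<in> X then nX (x - y) else 0)"

lemma Metric_space_carrier_dist: "Metric_space X carrier_dist"
proof
  fix x y z
  show "0 \<le> carrier_dist x y" by (simp add: carrier_dist_def norm_nonneg diff_mem)
  show "carrier_dist x y = carrier_dist y x" by (simp add: carrier_dist_def norm_minus_commute)
  show "carrier_dist x y = 0 \<longleftrightarrow> x = y" if "x \<in> X" "y \<in> X"
    using that norm_definite[of "x - y"] by (auto simp: carrier_dist_def diff_mem norm_zero)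
  show "carrier_dist x z \<le> carrier_dist x y + carrier_dist y z" if "x \<in> X" "y \<in> X" "z \<in> X"
    using that by (simp add: carrier_dist_def norm_triangle_diff)
qed

sublocale metric: Metric_space X carrier_dist
  by (rule Metric_space_carrier_dist)

lemma norm_topology_eq: "norm_topology X nX = metric.mtopology"
proof -
  have "carrier_dist = (\<lambda>x y. if x \<in> X \<and> y \<in> X then nX (x - y) else 0)"
    by (auto simp: carrier_dist_def fun_eq_iff)
  then show ?thesis by (simp add: norm_topology_def)
qed

lemma closedin_norm_topologyI:
  assumes "E \<subseteq> X"
    and seq: "\<And>x y. (\<And>n::nat. x n \<in> E) \<Longrightarrow> y \<in> X \<Longrightarrow> (\<lambda>n. nX (x n - y)) \<longlonglongrightarrow> 0 \<Longrightarrow> y \<in> E"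
  shows "closedin (norm_topology X nX) E"
  unfolding norm_topology_eq metric.metric_closedin_iff_sequentially_closed
proof (intro conjI allI impI)
  fix s l assume *: "range s \<subseteq> E \<and> limitin metric.mtopology s l sequentially"
  then have l: "l \<in> X" and lim: "(\<lambda>n. carrier_dist (s n) l) \<longlonglongrightarrow> 0"
    by (auto simp: metric.limitin_metric_dist_null)
  have sE: "s n \<in> E" for n using * by auto
  then have "carrier_dist (s n) l = nX (s n - l)" for n
    using assms(1) l by (auto simp: carrier_dist_def)
  then have "(\<lambda>n. nX (s n - l)) \<longlonglongrightarrow> 0" using lim by simp
  then show "l \<in> E" by (rule seq[OF sE l])
qed (rule assms(1))

text \<open>For sequences in \<open>X\<close> this is the Cauchy property of the metric, free of the case distinction in
  the distance.\<close>

definition norm_Cauchy :: "(nat \<Rightarrow> 'v) \<Rightarrow> bool" where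
  "norm_Cauchy x \<longleftrightarrow> (\<forall>e>0. \<exists>N. \<forall>m\<ge>N. \<forall>n\<ge>N. nX (x m - x n) < e)"

lemma MCauchy_iff: "range x \<subseteq> X \<Longrightarrow> metric.MCauchy x \<longleftrightarrow> norm_Cauchy x"
  by (auto simp: metric.MCauchy_def norm_Cauchy_def carrier_dist_def image_subset_iff)

lemma compact_operator_subseq:
  assumes T: "compact_operator X nX X nX T" and x: "\<And>n. x n \<in> X" "\<And>n::nat. nX (x n) \<le> 1"
  shows "\<exists>r. strict_mono r \<and> norm_Cauchy (\<lambda>n. T (x (r n)))"
proof -
  define S where "S = T ` {x\<in>X. nX x \<le> 1}"
  have S: "S \<subseteq> X" using T by (auto simp: S_def compact_operator_def bounded_operator_def)
  have "metric.mtotally_bounded S"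
    using T S metric.compact_closure_of_imp_mtotally_bounded
    by (simp add: compact_operator_def norm_topology_eq S_def)
  moreover have "range (\<lambda>n. T (x n)) \<subseteq> S" using x by (auto simp: S_def)
  ultimately obtain r where r: "strict_mono r" "metric.MCauchy ((\<lambda>n. T (x n)) \<circ> r)"
    unfolding metric.mtotally_bounded_sequentially by blast
  moreover have "range ((\<lambda>n. T (x n)) \<circ> r) \<subseteq> X"
    using S \<open>range (\<lambda>n. T (x n)) \<subseteq> S\<close> by auto
  ultimately have "norm_Cauchy ((\<lambda>n. T (x n)) \<circ> r)" using MCauchy_iff by blast
  then show ?thesis using r(1) by (auto simp: o_def)
qed

end

locale banach_carrier = normed_carrier +
  assumes complete: "(\<And>n::nat. x n \<in> X) \<Longrightarrow> norm_Cauchy x \<Longrightarrow> \<exists>y\<in>X. (\<lambda>n. nX (x n - y)) \<longlonglongrightarrow> 0"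
begin

lemma mcomplete: "metric.mcomplete"
  unfolding metric.mcomplete_def
proof (intro allI impI)
  fix s assume s: "metric.MCauchy s"
  then have sX: "range s \<subseteq> X" by (simp add: metric.MCauchy_def)
  then obtain y where y: "y \<in> X" "(\<lambda>n. nX (s n - y)) \<longlonglongrightarrow> 0"
    using s complete[of s] MCauchy_iff[OF sX] by auto
  moreover have "carrier_dist (s n) y = nX (s n - y)" for n
    using sX y by (auto simp: carrier_dist_def)
  ultimately have "limitin metric.mtopology s y sequentially"
    using sX by (auto simp: metric.limitin_metric_dist_null image_subset_iff intro!: always_eventually)
  then show "\<exists>x. limitin metric.mtopology s x sequentially" by blast
qed

lemma compact_operatorI:
  assumes T: "bounded_operator X nX X nX T"
    and seq: "\<And>x. (\<And>n::nat. x n \<in> X) \<Longrightarrow> (\<And>n. nX (x n) \<le> 1) \<Longrightarrow>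
       \<exists>r. strict_mono r \<and> norm_Cauchy (\<lambda>n. T (x (r n)))"
  shows "compact_operator X nX X nX T"
proof -
  define S where "S = T ` {x\<in>X. nX x \<le> 1}"
  have S: "S \<subseteq> X" using T by (auto simp: S_def bounded_operator_def)
  have "metric.mtotally_bounded S"
    unfolding metric.mtotally_bounded_sequentially
  proof (intro conjI allI impI S)
    fix s :: "nat \<Rightarrow> 'a" assume s: "range s \<subseteq> S"
    then have "\<forall>n. \<exists>x. x \<in> X \<and> nX x \<le> 1 \<and> s n = T x" by (auto simp: S_def image_subset_iff)
    then obtain x where x: "\<And>n. x n \<in> X" "\<And>n. nX (x n) \<le> 1" "\<And>n. s n = T (x n)" by metis
    then obtain r where r: "strict_mono r" "norm_Cauchy (\<lambda>n. T (x (r n)))" using seq by blast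
    have "range (s \<circ> r) \<subseteq> X" using s S by auto
    then have "metric.MCauchy (s \<circ> r)" using r x by (simp add: MCauchy_iff o_def)
    then show "\<exists>r. strict_mono r \<and> metric.MCauchy (s \<circ> r)" using r by blast
  qed
  then show ?thesis
    using T metric.mtotally_bounded_eq_compact_closure_of[OF mcomplete, of S]
    by (simp add: compact_operator_def norm_topology_eq S_def)
qed

end

lemma bounded_operatorD:
  assumes "bounded_operator X nX Y nY T"
  shows "x \<in> X \<Longrightarrow> T x \<in> Y" and "x \<in> X \<Longrightarrow> y \<in> X \<Longrightarrow> T (x + y) = T x + T y"
    and "x \<in> X \<Longrightarrow> T (a *\<^sub>C x) = a *\<^sub>C T x"
  using assms by (auto simp: bounded_operator_def)

lemma bounded_operator_diff:
  assumes T: "bounded_operator X nX Y nY T" and X: "cvs.subspace X" and x: "x \<in> X" and y: "y \<in> X"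
  shows "T (x - y) = T x - T y"
  using bounded_operatorD(2)[OF T x, of "(-1) *\<^sub>C y"] bounded_operatorD(3)[OF T y, of "-1"]
    cvs.subspace_scale[OF X y, of "-1"] by (simp add: scaleC_minus_one)

lemma bounded_operator_zero: "bounded_operator X nX Y nY T \<Longrightarrow> cvs.subspace X \<Longrightarrow> T 0 = 0"
  using bounded_operatorD(3)[of X nX Y nY T 0 0] by (simp add: cvs.subspace_0)

lemma bounded_operator_sum:
  assumes T: "bounded_operator X nX Y nY T" and X: "cvs.subspace X" and x: "\<And>i. i \<in> I \<Longrightarrow> x i \<in> X"
  shows "T (\<Sum>i\<in>I. a i *\<^sub>C x i) = (\<Sum>i\<in>I. a i *\<^sub>C T (x i))"
  using x
proof (induction I rule: infinite_finite_induct)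
  case (insert i I)
  have "(\<Sum>i\<in>I. a i *\<^sub>C x i) \<in> X" using insert X by (intro cvs.subspace_sum cvs.subspace_scale) auto
  moreover have "a i *\<^sub>C x i \<in> X" using insert X by (intro cvs.subspace_scale) auto
  ultimately have "T (a i *\<^sub>C x i + (\<Sum>i\<in>I. a i *\<^sub>C x i)) = a i *\<^sub>C T (x i) + (\<Sum>i\<in>I. a i *\<^sub>C T (x i))"
    using insert bounded_operatorD[OF T] by simp
  then show ?case unfolding sum.insert[OF insert(1,2)] .
qed (use bounded_operator_zero[OF T X] in auto)

lemma bounded_operator_bound:
  assumes T: "bounded_operator X nX Y nY T" and nonneg: "\<And>x. x \<in> X \<Longrightarrow> 0 \<le> nX x"
  shows "\<exists>K>0. \<forall>x\<in>X. nY (T x) \<le> K * nX x"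
proof -
  obtain K where K: "\<forall>x\<in>X. nY (T x) \<le> K * nX x" using T by (auto simp: bounded_operator_def)
  have "nY (T x) \<le> (\<bar>K\<bar> + 1) * nX x" if "x \<in> X" for x
  proof -
    have "nY (T x) \<le> K * nX x" using K that by blast
    also have "\<dots> \<le> (\<bar>K\<bar> + 1) * nX x" using nonneg[OF that] by (intro mult_right_mono) auto
    finally show ?thesis .
  qed
  then show ?thesis by (intro exI[of _ "\<bar>K\<bar> + 1"]) auto
qed

lemma bounded_operator_comp:
  assumes f: "bounded_operator X nX Y nY f" and g: "bounded_operator Y nY Z nZ g"
    and nonneg: "\<And>y. y \<in> Y \<Longrightarrow> 0 \<le> nY y"
  shows "bounded_operator X nX Z nZ (\<lambda>x. g (f x))"
proof -
  obtain K where K: "\<forall>x\<in>X. nY (f x) \<le> K * nX x" using f by (auto simp: bounded_operator_def)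
  obtain L where L: "0 < L" "\<forall>y\<in>Y. nZ (g y) \<le> L * nY y"
    using bounded_operator_bound[OF g nonneg] by blast
  have "nZ (g (f x)) \<le> (L * K) * nX x" if "x \<in> X" for x
  proof -
    have "nZ (g (f x)) \<le> L * nY (f x)" using L bounded_operatorD(1)[OF f that] by blast
    also have "\<dots> \<le> L * (K * nX x)" using K L that by (intro mult_left_mono) auto
    finally show ?thesis by simp
  qed
  then show ?thesis
    using bounded_operatorD[OF f] bounded_operatorD[OF g] unfolding bounded_operator_def by auto
qed

lemma bounded_operator_restrict:
  assumes "bounded_operator X nX Y nY f" "X' \<subseteq> X" "f ` X' \<subseteq> Y'"
  shows "bounded_operator X' nX Y' nY f"
  using assms unfolding bounded_operator_def by (auto simp: subset_iff) blast

lemma bounded_operator_cong: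
  assumes "bounded_operator X nX Y nY f" "cvs.subspace X" "\<And>x. x \<in> X \<Longrightarrow> g x = f x"
  shows "bounded_operator X nX Y nY g"
  using assms unfolding bounded_operator_def
  by (auto simp: cvs.subspace_add cvs.subspace_scale)

lemma subspace_image:
  assumes T: "bounded_operator X nX Y nY T" and X: "cvs.subspace X" shows "cvs.subspace (T ` X)"
  unfolding cvs.subspace_def
proof safe
  show "0 \<in> T ` X" using bounded_operator_zero[OF T X] cvs.subspace_0[OF X] by (metis imageI)
  show "T x + T y \<in> T ` X" if "x \<in> X" "y \<in> X" for x y
    using bounded_operatorD(2)[OF T that] cvs.subspace_add[OF X that] by (metis imageI)
  show "c *\<^sub>C T x \<in> T ` X" if "x \<in> X" for x c
    using bounded_operatorD(3)[OF T that] cvs.subspace_scale[OF X that] by (metis imageI)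
qed

text \<open>On the image, the inverse agrees with the given bounded left inverse.\<close>

lemma left_invertible_isomorphism:
  assumes f: "bounded_operator X nX Y nY f" and g: "bounded_operator Y nY X nX g"
    and X: "cvs.subspace X" and inv: "\<And>x. x \<in> X \<Longrightarrow> g (f x) = x"
  shows "isomorphism X nX (f ` X) nY f"
  unfolding isomorphism_def
proof (intro conjI)
  have inj: "inj_on f X" using inv by (metis inj_onI)
  then show "bij_betw f X (f ` X)" by (simp add: bij_betw_def)
  show "bounded_operator X nX (f ` X) nY f" using f by (rule bounded_operator_restrict) auto
  have fY: "f ` X \<subseteq> Y" using bounded_operatorD(1)[OF f] by blast
  have "bounded_operator (f ` X) nY X nX g"
    using g fY by (rule bounded_operator_restrict) (use inv in auto)
  then show "bounded_operator (f ` X) nY X nX (inv_into X f)"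
    using subspace_image[OF f X]
  proof (rule bounded_operator_cong)
    show "inv_into X f y = g y" if "y \<in> f ` X" for y using that inv inj by auto
  qed
qed

text \<open>Each functional cuts down the dimension by at most one.\<close>

lemma common_kernel_nonzero:
  fixes \<phi> :: "'i \<Rightarrow> 'v::complex_vector \<Rightarrow> complex"
  assumes I: "finite I" and \<phi>: "\<And>i. clinear (\<phi> i)" and E: "cvs.subspace E" and inf: "\<not> finite_dimensional E"
  shows "\<exists>x\<in>E. x \<noteq> 0 \<and> (\<forall>i\<in>I. \<phi> i x = 0)"
  using I E inf
proof (induction I arbitrary: E rule: finite_induct)
  case empty
  have "\<exists>x\<in>E. x \<noteq> 0"
  proof (rule ccontr)
    assume "\<not> ?thesis"
    then have "E \<subseteq> cvs.span {}" by auto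
    then show False using empty(2) unfolding finite_dimensional_def by blast
  qed
  then show ?case by simp
next
  case (insert i I)
  define F where "F = {x\<in>E. \<phi> i x = 0}"
  have F: "cvs.subspace F"
    using insert.prems(1) by (auto simp: F_def cvs.subspace_def clinear_zero[OF \<phi>] clinear_add[OF \<phi>]
        clinear_scaleC[OF \<phi>])
  have "\<not> finite_dimensional F"
  proof
    assume "finite_dimensional F"
    then obtain B where B: "finite B" "F \<subseteq> cvs.span B" by (auto simp: finite_dimensional_def)
    show False
    proof (cases "F = E")
      case True
      then show False using \<open>finite_dimensional F\<close> insert.prems(2) by simp
    next
      case False
      then obtain z where z: "z \<in> E" "\<phi> i z \<noteq> 0" by (auto simp: F_def)
      have "E \<subseteq> cvs.span (insert z B)"
      proof
        fix x assume x: "x \<in> E"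
        define c where "c = \<phi> i x / \<phi> i z"
        have "x - c *\<^sub>C z \<in> F"
          using x z insert.prems(1)
          by (simp add: F_def cvs.subspace_diff cvs.subspace_scale clinear_diff[OF \<phi>] clinear_scaleC[OF \<phi>]
              scaleC_complex_def c_def)
        then have "x - c *\<^sub>C z \<in> cvs.span (insert z B)"
          using B cvs.span_mono[of B "insert z B"] by blast
        moreover have "c *\<^sub>C z \<in> cvs.span (insert z B)" by (simp add: cvs.span_base cvs.span_scale)
        ultimately have "(x - c *\<^sub>C z) + c *\<^sub>C z \<in> cvs.span (insert z B)" by (rule cvs.span_add)
        then show "x \<in> cvs.span (insert z B)" by simp
      qed
      then show False using insert.prems(2) B unfolding finite_dimensional_def by blast
    qed
  qed
  from insert.IH[OF F this] show ?case by (auto simp: F_def)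
qed

section \<open>Copies of the sequence space\<close>

lemma lp_space_iff:
  assumes p: "1 \<le> p" and K: "0 \<le> K"
  shows "x \<in> lp_space p \<and> lp_norm p x \<le> K \<longleftrightarrow> (\<forall>n. pnorm p {..<n} (\<lambda>i. cmod (x i)) \<le> K)"
  using summable_powr_iff_pnorm_bounded[of p K "\<lambda>i. cmod (x i)"] p K
  by (simp add: lp_space_def lp_norm_def)

lemma lp_norm_nonneg [simp]: "0 \<le> lp_norm p x"
  by (simp add: lp_norm_def)

lemma pnorm_le_lp_norm:
  assumes "1 \<le> p" "x \<in> lp_space p" "finite F" shows "pnorm p F (\<lambda>i. cmod (x i)) \<le> lp_norm p x"
proof -
  obtain n where "F \<subseteq> {..<n}" using assms(3) by (metis finite_nat_iff_bounded)
  then have "pnorm p F (\<lambda>i. cmod (x i)) \<le> pnorm p {..<n} (\<lambda>i. cmod (x i))"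
    using assms(1) by (intro pnorm_mono_set) auto
  also have "\<dots> \<le> lp_norm p x" using lp_space_iff[OF assms(1), of "lp_norm p x" x] assms(2) by auto
  finally show ?thesis .
qed

lemma cmod_le_lp_norm: "1 \<le> p \<Longrightarrow> x \<in> lp_space p \<Longrightarrow> cmod (x i) \<le> lp_norm p x"
  using pnorm_le_lp_norm[of p x "{i}"] by (simp add: pnorm_def powr_powr)

lemma lp_add:
  assumes p: "1 \<le> p" and x: "x \<in> lp_space p" and y: "y \<in> lp_space p"
  shows "x + y \<in> lp_space p \<and> lp_norm p (x + y) \<le> lp_norm p x + lp_norm p y"
  unfolding lp_space_iff[OF p add_nonneg_nonneg[OF lp_norm_nonneg lp_norm_nonneg]]
proof
  fix n
  have "pnorm p {..<n} (\<lambda>i. cmod ((x + y) i)) \<le> pnorm p {..<n} (\<lambda>i. cmod (x i) + cmod (y i))"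
    using p by (intro pnorm_mono) (auto intro: norm_triangle_ineq)
  also have "\<dots> \<le> pnorm p {..<n} (\<lambda>i. cmod (x i)) + pnorm p {..<n} (\<lambda>i. cmod (y i))"
    using p by (intro pnorm_triangle) auto
  also have "\<dots> \<le> lp_norm p x + lp_norm p y" using p x y by (intro add_mono pnorm_le_lp_norm) auto
  finally show "pnorm p {..<n} (\<lambda>i. cmod ((x + y) i)) \<le> lp_norm p x + lp_norm p y" .
qed

lemma lp_scaleC:
  assumes p: "1 \<le> p" and x: "x \<in> lp_space p"
  shows "a *\<^sub>C x \<in> lp_space p \<and> lp_norm p (a *\<^sub>C x) \<le> cmod a * lp_norm p x"
proof (subst lp_space_iff[OF p])
  have "pnorm p {..<n} (\<lambda>i. cmod ((a *\<^sub>C x) i)) = cmod a * pnorm p {..<n} (\<lambda>i. cmod (x i))" for n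
    using p by (simp add: scaleC_fun_def scaleC_complex_def norm_mult pnorm_scale)
  then show "\<forall>n. pnorm p {..<n} (\<lambda>i. cmod ((a *\<^sub>C x) i)) \<le> cmod a * lp_norm p x"
    using pnorm_le_lp_norm[OF p x] by (simp add: mult_left_mono)
qed simp

lemma subspace_lp: assumes p: "1 \<le> p" shows "cvs.subspace (lp_space p)"
proof -
  have "(0 :: nat \<Rightarrow> complex) \<in> lp_space p" using p by (simp add: lp_space_def)
  then show ?thesis using lp_add[OF p] lp_scaleC[OF p] by (simp add: cvs.subspace_def)
qed

definition lp_unit :: "nat \<Rightarrow> nat \<Rightarrow> complex" where
  "lp_unit k i = (if i = k then 1 else 0)"

lemma lp_unit_mem: assumes p: "1 \<le> p" shows "lp_unit k \<in> lp_space p"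
proof -
  have "summable (\<lambda>i. cmod (lp_unit k i) powr p)"
    using p by (intro summable_finite[of "{k}"]) (auto simp: lp_unit_def)
  then show ?thesis by (simp add: lp_space_def)
qed

text \<open>The operators \<open>J L T\<close> and \<open>T J L\<close> are idempotent because \<open>L T J\<close> is the identity; their ranges
  are \<open>E = J(\<ell>\<^sub>p)\<close> and \<open>T(E)\<close>. Closedness of \<open>E\<close> follows since it is the fixed point set of
  \<open>J L T\<close>.\<close>

theorem (in normed_carrier) factorisation_fixes_complemented_lp:
  assumes p: "1 \<le> p" and T: "bounded_operator X nX X nX T"
    and J: "bounded_operator (lp_space p) (lp_norm p) X nX J"
    and L: "bounded_operator X nX (lp_space p) (lp_norm p) L"
    and LTJ: "\<And>a. a \<in> lp_space p \<Longrightarrow> L (T (J a)) = a"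
  shows "\<exists>E. closed_inf_dim_subspace X nX E \<and> isomorphic E nX (lp_space p) (lp_norm p) \<and>
     isomorphism E nX (T ` E) nX T \<and> complemented X nX E \<and> complemented X nX (T ` E)"
proof -
  define E where "E = J ` lp_space p"
  note lp = subspace_lp[OF p]
  have E: "cvs.subspace E" unfolding E_def by (rule subspace_image[OF J lp])
  have EX: "E \<subseteq> X" using bounded_operatorD(1)[OF J] by (auto simp: E_def)
  have LT: "bounded_operator X nX (lp_space p) (lp_norm p) (\<lambda>x. L (T x))"
    using T L norm_nonneg by (rule bounded_operator_comp)
  have JL: "bounded_operator X nX X nX (\<lambda>x. J (L x))"
    using L J by (rule bounded_operator_comp) simp
  have P: "bounded_operator X nX X nX (\<lambda>x. J (L (T x)))"
    using LT J by (rule bounded_operator_comp) simp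
  have R: "bounded_operator X nX X nX (\<lambda>x. T (J (L x)))"
    using JL T norm_nonneg by (rule bounded_operator_comp)
  have PE: "J (L (T x)) = x" if "x \<in> E" for x using that LTJ by (auto simp: E_def)
  have LTX: "L (T x) \<in> lp_space p" "L x \<in> lp_space p" if "x \<in> X" for x
    using bounded_operatorD(1)[OF LT that] bounded_operatorD(1)[OF L that] by auto
  have "closedin (norm_topology X nX) E"
  proof (rule closedin_norm_topologyI[OF EX])
    fix x y assume x: "\<And>n::nat. x n \<in> E" and y: "y \<in> X" and lim: "(\<lambda>n. nX (x n - y)) \<longlonglongrightarrow> 0"
    obtain K where K: "0 < K" "\<forall>x\<in>X. nX (J (L (T x))) \<le> K * nX x"
      using bounded_operator_bound[OF P norm_nonneg] by blast
    define z where "z = J (L (T y))"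
    have z: "z \<in> X" unfolding z_def using bounded_operatorD(1)[OF P y] .
    have xX: "x n \<in> X" for n using x EX by auto
    have "nX (z - y) \<le> K * nX (x n - y) + nX (x n - y)" for n
    proof -
      have "z - x n = J (L (T (y - x n)))"
        using bounded_operator_diff[OF P subspace y xX, of n] PE[OF x] by (simp add: z_def)
      then have "nX (z - x n) \<le> K * nX (y - x n)" using K diff_mem[OF y xX] by metis
      then show ?thesis
        using norm_triangle_diff[OF z xX y, of n] norm_minus_commute[OF y xX, of n] by simp
    qed
    moreover have "(\<lambda>n. K * nX (x n - y) + nX (x n - y)) \<longlonglongrightarrow> K * 0 + 0"
      by (intro tendsto_intros lim)
    ultimately have "nX (z - y) \<le> K * 0 + 0" by (intro LIMSEQ_le_const) auto
    then have "z - y = 0" using norm_nonneg[of "z - y"] norm_definite[of "z - y"] diff_mem[OF z y] by simp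
    then have "y = J (L (T y))" by (simp add: z_def)
    then show "y \<in> E" unfolding E_def using LTX(1)[OF y] by (metis imageI)
  qed
  moreover have "\<not> finite_dimensional E"
  proof
    assume "finite_dimensional E"
    then obtain B where B: "finite B" "E \<subseteq> cvs.span B" by (auto simp: finite_dimensional_def)
    define S where "S = (\<lambda>i. J (lp_unit i)) ` {..card B}"
    have inj: "inj_on (\<lambda>i. J (lp_unit i)) {..card B}"
    proof (rule inj_onI)
      fix i j assume "J (lp_unit i) = J (lp_unit j)"
      then have "lp_unit i = lp_unit j" using LTJ lp_unit_mem[OF p] by metis
      then have "lp_unit i i = lp_unit j i" by simp
      then show "i = j" by (simp add: lp_unit_def split: if_splits)
    qed
    have "cvs.independent S"
    proof (rule cvs.independent_if_scalars_zero)
      show "finite S" by (simp add: S_def)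
      fix f x assume f: "(\<Sum>x\<in>S. f x *\<^sub>C x) = 0" and x: "x \<in> S"
      obtain k where k: "k \<le> card B" "x = J (lp_unit k)" using x by (auto simp: S_def)
      define c where "c i = f (J (lp_unit i))" for i
      define a where "a = (\<Sum>i\<le>card B. c i *\<^sub>C lp_unit i)"
      have a: "a \<in> lp_space p"
        unfolding a_def by (intro cvs.subspace_sum[OF lp] cvs.subspace_scale[OF lp] lp_unit_mem p)
      have "J a = (\<Sum>i\<le>card B. c i *\<^sub>C J (lp_unit i))"
        unfolding a_def by (rule bounded_operator_sum[OF J lp lp_unit_mem[OF p]])
      also have "\<dots> = 0" using f inj by (simp add: S_def c_def sum.reindex)
      finally have "a = 0" using LTJ[OF a] bounded_operator_zero[OF LT subspace] by simp
      then have "a k = 0" by simp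
      moreover have "a k = (\<Sum>i\<le>card B. if i = k then c k else 0)"
        unfolding a_def sum_fun_apply
        by (intro sum.cong) (auto simp: scaleC_fun_def scaleC_complex_def lp_unit_def)
      ultimately show "f x = 0" using k by (simp add: c_def)
    qed
    moreover have "S \<subseteq> cvs.span B" using B lp_unit_mem[OF p] by (auto simp: S_def E_def)
    ultimately have "card S \<le> card B" using cvs.independent_span_bound[OF B(1)] by blast
    then show False using inj by (simp add: S_def card_image)
  qed
  ultimately have 1: "closed_inf_dim_subspace X nX E"
    using E EX by (simp add: closed_inf_dim_subspace_def)
  have JE: "bounded_operator (lp_space p) (lp_norm p) E nX J"
    using J by (rule bounded_operator_restrict) (auto simp: E_def)
  have "isomorphism E nX ((\<lambda>x. L (T x)) ` E) (lp_norm p) (\<lambda>x. L (T x))"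
  proof (rule left_invertible_isomorphism[where f = "\<lambda>x. L (T x)" and g = J, OF _ JE E PE])
    show "bounded_operator E nX (lp_space p) (lp_norm p) (\<lambda>x. L (T x))"
      using LT EX by (rule bounded_operator_restrict) (use EX LTX in auto)
  qed
  moreover have "(\<lambda>x. L (T x)) ` E = lp_space p" using LTJ by (force simp: E_def)
  ultimately have 2: "isomorphic E nX (lp_space p) (lp_norm p)" by (auto simp: isomorphic_def)
  have 3: "isomorphism E nX (T ` E) nX T"
  proof (rule left_invertible_isomorphism[where f = T and g = "\<lambda>x. J (L x)", OF _ _ E PE])
    show "bounded_operator E nX X nX T"
      using T EX by (rule bounded_operator_restrict) (use EX bounded_operatorD(1)[OF T] in auto)
    show "bounded_operator X nX E nX (\<lambda>x. J (L x))"
      using JL subset_refl by (rule bounded_operator_restrict) (use LTX in \<open>auto simp: E_def\<close>)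
  qed
  have 4: "complemented X nX E"
    unfolding complemented_def
  proof (intro exI conjI ballI)
    show "bounded_operator X nX X nX (\<lambda>x. J (L (T x)))" by (rule P)
    show "J (L (T (J (L (T x))))) = J (L (T x))" if "x \<in> X" for x using LTJ LTX[OF that] by simp
    show "(\<lambda>x. J (L (T x))) ` X = E"
      using LTX PE EX unfolding E_def by (auto simp: image_iff subset_iff) metis
  qed
  have 5: "complemented X nX (T ` E)"
    unfolding complemented_def
  proof (intro exI conjI ballI)
    show "bounded_operator X nX X nX (\<lambda>x. T (J (L x)))" by (rule R)
    show "T (J (L (T (J (L x))))) = T (J (L x))" if "x \<in> X" for x using LTJ LTX[OF that] by simp
    show "(\<lambda>x. T (J (L x))) ` X = T ` E"
    proof safe
      fix x assume "x \<in> X"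
      then show "T (J (L x)) \<in> T ` E" using LTX by (auto simp: E_def)
    next
      fix x assume x: "x \<in> E"
      then have "T x = T (J (L (T x)))" using PE by simp
      moreover have "T x \<in> X" using x EX bounded_operatorD(1)[OF T] by blast
      ultimately show "T x \<in> (\<lambda>x. T (J (L x))) ` X" by (rule image_eqI)
    qed
  qed
  show ?thesis using 1 2 3 4 5 by blast
qed

section \<open>Almost diagonal matrices\<close>

text \<open>The Neumann series converges coordinatewise. A left inverse suffices for the factorisation, and it
  follows from telescoping in each coordinate.\<close>

lemma lp_neumann_left_inverse:
  assumes p: "1 \<le> p" and U: "bounded_operator (lp_space p) (lp_norm p) (lp_space p) (lp_norm p) U"
    and half: "\<And>a. a \<in> lp_space p \<Longrightarrow> lp_norm p (U a) \<le> lp_norm p a / 2"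
  shows "\<exists>V. bounded_operator (lp_space p) (lp_norm p) (lp_space p) (lp_norm p) V \<and>
     (\<forall>a\<in>lp_space p. V (a - U a) = a)"
proof -
  note lp = subspace_lp[OF p]
  have Un: "(U ^^ n) a \<in> lp_space p \<and> lp_norm p ((U ^^ n) a) \<le> (1/2) ^ n * lp_norm p a"
    if "a \<in> lp_space p" for n a
  proof (induction n)
    case (Suc n)
    then show ?case using half[of "(U ^^ n) a"] bounded_operatorD(1)[OF U] by force
  qed (use that in simp)
  have Uadd: "(U ^^ n) (a + c) = (U ^^ n) a + (U ^^ n) c" if "a \<in> lp_space p" "c \<in> lp_space p" for n a c
    using Un[OF that(1)] Un[OF that(2)] by (induction n) (auto simp: bounded_operatorD(2)[OF U])
  have Uscale: "(U ^^ n) (z *\<^sub>C a) = z *\<^sub>C (U ^^ n) a" if "a \<in> lp_space p" for n a z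
    using Un[OF that] by (induction n) (auto simp: bounded_operatorD(3)[OF U])
  have coord: "cmod ((U ^^ n) a k) \<le> (1/2) ^ n * lp_norm p a" if "a \<in> lp_space p" for n a k
    using Un[OF that, of n] cmod_le_lp_norm[OF p, of "(U ^^ n) a" k] by simp
  have summable: "summable (\<lambda>n. (U ^^ n) a k)" if "a \<in> lp_space p" for a k
    by (rule summable_comparison_test'[where g = "\<lambda>n. (1/2) ^ n * lp_norm p a" and N = 0])
      (use coord[OF that] in \<open>auto intro!: summable_mult2 summable_geometric\<close>)
  define V where "V a k = (\<Sum>n. (U ^^ n) a k)" for a k
  have V: "V a \<in> lp_space p \<and> lp_norm p (V a) \<le> 2 * lp_norm p a" if a: "a \<in> lp_space p" for a
  proof (subst lp_space_iff[OF p])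
    show "\<forall>N. pnorm p {..<N} (\<lambda>k. cmod (V a k)) \<le> 2 * lp_norm p a"
    proof
      fix N
      show "pnorm p {..<N} (\<lambda>k. cmod (V a k)) \<le> 2 * lp_norm p a"
      proof (rule LIMSEQ_le_const2)
        show "(\<lambda>m. pnorm p {..<N} (\<lambda>k. cmod (\<Sum>n<m. (U ^^ n) a k))) \<longlonglongrightarrow> pnorm p {..<N} (\<lambda>k. cmod (V a k))"
          using p summable[OF a] unfolding V_def
          by (intro tendsto_pnorm tendsto_norm summable_LIMSEQ) auto
        have "pnorm p {..<N} (\<lambda>k. cmod (\<Sum>n<m. (U ^^ n) a k)) \<le> 2 * lp_norm p a" for m
        proof -
          have "pnorm p {..<N} (\<lambda>k. cmod (\<Sum>n<m. (U ^^ n) a k))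
              \<le> pnorm p {..<N} (\<lambda>k. \<Sum>n<m. cmod ((U ^^ n) a k))"
            using p by (intro pnorm_mono) (auto intro!: order_trans[OF norm_sum] sum_nonneg)
          also have "\<dots> \<le> (\<Sum>n<m. pnorm p {..<N} (\<lambda>k. cmod ((U ^^ n) a k)))"
            using p by (intro pnorm_sum_le) auto
          also have "\<dots> \<le> (\<Sum>n<m. (1/2) ^ n * lp_norm p a)"
            using Un[OF a] p by (intro sum_mono order_trans[OF pnorm_le_lp_norm]) auto
          also have "\<dots> = (\<Sum>n<m. (1/2) ^ n) * lp_norm p a" by (simp add: sum_distrib_right)
          also have "\<dots> \<le> 2 * lp_norm p a"
          proof (rule mult_right_mono)
            have "(\<Sum>n<m. (1/2::real) ^ n) \<le> (\<Sum>n. (1/2) ^ n)"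
              by (intro sum_le_suminf summable_geometric) auto
            also have "\<dots> = 2" by (subst suminf_geometric) auto
            finally show "(\<Sum>n<m. (1/2::real) ^ n) \<le> 2" .
          qed simp
          finally show ?thesis .
        qed
        then show "\<exists>M. \<forall>m\<ge>M. pnorm p {..<N} (\<lambda>k. cmod (\<Sum>n<m. (U ^^ n) a k)) \<le> 2 * lp_norm p a" by blast
      qed
    qed
  qed simp
  have "bounded_operator (lp_space p) (lp_norm p) (lp_space p) (lp_norm p) V"
    unfolding bounded_operator_def
  proof (intro conjI ballI allI)
    show "V \<in> lp_space p \<rightarrow> lp_space p" using V by blast
    show "V (a + c) = V a + V c" if "a \<in> lp_space p" "c \<in> lp_space p" for a c
    proof
      fix k
      show "V (a + c) k = (V a + V c) k"
        using suminf_add[OF summable[OF that(1), of k] summable[OF that(2), of k]]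
        by (simp add: V_def Uadd[OF that])
    qed
    show "V (z *\<^sub>C a) = z *\<^sub>C V a" if "a \<in> lp_space p" for z a
    proof
      fix k
      have "V (z *\<^sub>C a) k = (\<Sum>n. (z *\<^sub>C (U ^^ n) a) k)" unfolding V_def Uscale[OF that] ..
      then show "V (z *\<^sub>C a) k = (z *\<^sub>C V a) k"
        using suminf_mult[OF summable[OF that, of k], of z]
        by (simp add: V_def scaleC_fun_def scaleC_complex_def)
    qed
    show "\<exists>K. \<forall>a\<in>lp_space p. lp_norm p (V a) \<le> K * lp_norm p a" using V by blast
  qed
  moreover have "V (a - U a) = a" if a: "a \<in> lp_space p" for a
  proof
    fix k
    have Ua: "U a \<in> lp_space p" using bounded_operatorD(1)[OF U a] .
    have step: "(U ^^ n) (a - U a) = (U ^^ n) a - (U ^^ Suc n) a" for n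
      using Uadd[OF a cvs.subspace_scale[OF lp Ua, of "-1"], of n] Uscale[OF Ua, of n "-1"]
      by (simp add: scaleC_minus_one funpow_swap1)
    have "(\<lambda>n. (U ^^ n) a k) \<longlonglongrightarrow> 0" using summable[OF a] by (rule summable_LIMSEQ_zero)
    from telescope_sums'[OF this] have "(\<lambda>n. (U ^^ n) a k - (U ^^ Suc n) a k) sums ((U ^^ 0) a k - 0)" .
    then have "(\<lambda>n. (U ^^ n) (a - U a) k) sums a k" unfolding step by simp
    then show "V (a - U a) k = a k" unfolding V_def by (rule sums_unique[symmetric])
  qed
  ultimately show ?thesis by blast
qed

lemma infinite_partition:
  assumes "infinite (S :: nat set)"
  shows "\<exists>N :: nat \<Rightarrow> nat set. (\<forall>i. infinite (N i) \<and> N i \<subseteq> S) \<and> (\<forall>i j. i \<noteq> j \<longrightarrow> N i \<inter> N j = {})"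
proof -
  define h where "h i j = enumerate S (prod_encode (i, j))" for i j
  have inj: "h i j = h k l \<longleftrightarrow> i = k \<and> j = l" for i j k l
    using strict_mono_enumerate[OF assms] by (simp add: h_def strict_mono_eq prod_encode_eq)
  have "infinite (range (h i))" for i by (rule range_inj_infinite) (simp add: inj_def inj)
  moreover have "range (h i) \<subseteq> S" for i unfolding h_def using assms by (auto intro: enumerate_in_set)
  moreover have "range (h i) \<inter> range (h k) = {}" if "i \<noteq> k" for i k using that by (auto simp: inj)
  ultimately show ?thesis by (intro exI[of _ "\<lambda>i. range (h i)"]) auto
qed

text \<open>Split \<open>S\<close> into infinitely many infinite parts \<open>N\<^sub>i\<close>. If no part satisfies the conclusion, each
  part contains an index \<open>l\<^sub>i\<close> whose column already has mass more than \<open>d\<close> inside \<open>N\<^sub>i\<close>. On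
  the set of these indices all column sums off the diagonal have dropped by \<open>d\<close>, since the set
  meets \<open>N\<^sub>i\<close> in \<open>l\<^sub>i\<close> only. Hence \<open>n\<close> steps suffice.\<close>

lemma rosenthal_disjointification:
  fixes A :: "nat \<Rightarrow> nat \<Rightarrow> real"
  assumes d: "0 < d" and S: "infinite S"
    and bound: "\<And>l F. l \<in> S \<Longrightarrow> finite F \<Longrightarrow> F \<subseteq> S - {l} \<Longrightarrow> (\<Sum>k\<in>F. A k l) \<le> real n * d"
  shows "\<exists>S'\<subseteq>S. infinite S' \<and> (\<forall>l\<in>S'. \<forall>F. finite F \<longrightarrow> F \<subseteq> S' - {l} \<longrightarrow> (\<Sum>k\<in>F. A k l) \<le> d)"
  using S bound
proof (induction n arbitrary: S)
  case 0
  have "(\<Sum>k\<in>F. A k l) \<le> d" if "l \<in> S" "finite F" "F \<subseteq> S - {l}" for l F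
    using "0.prems"(2)[OF that] d by simp
  then show ?case using "0.prems"(1) by (intro exI[of _ S]) simp
next
  case (Suc n)
  obtain N :: "nat \<Rightarrow> nat set" where
      N1: "\<forall>i. infinite (N i) \<and> N i \<subseteq> S" and N2: "\<forall>i j. i \<noteq> j \<longrightarrow> N i \<inter> N j = {}"
    using infinite_partition[OF Suc.prems(1)] by (elim exE conjE) (rule that)
  have N: "\<And>i. infinite (N i)" "\<And>i. N i \<subseteq> S" "\<And>i j. i \<noteq> j \<Longrightarrow> N i \<inter> N j = {}"
    using N1 N2 by simp_all
  show ?case
  proof (cases "\<exists>i. \<forall>l\<in>N i. \<forall>F. finite F \<longrightarrow> F \<subseteq> N i - {l} \<longrightarrow> (\<Sum>k\<in>F. A k l) \<le> d")
    case True
    then obtain i where "\<forall>l\<in>N i. \<forall>F. finite F \<longrightarrow> F \<subseteq> N i - {l} \<longrightarrow> (\<Sum>k\<in>F. A k l) \<le> d" ..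
    then show ?thesis using N(1,2)[of i] by (intro exI[of _ "N i"]) simp
  next
    case False
    then have "\<forall>i. \<exists>l F. l \<in> N i \<and> finite F \<and> F \<subseteq> N i - {l} \<and> d < (\<Sum>k\<in>F. A k l)"
      by (meson not_le)
    then obtain l F where lF: "\<And>i. l i \<in> N i" "\<And>i. finite (F i)" "\<And>i. F i \<subseteq> N i - {l i}"
        "\<And>i. d < (\<Sum>k\<in>F i. A k (l i))"
      by metis
    define S1 where "S1 = range l"
    have "inj l"
    proof (rule injI, rule ccontr)
      fix i j assume "l i = l j" "i \<noteq> j"
      then show False using N(3)[of i j] lF(1)[of i] lF(1)[of j] by auto
    qed
    then have inf: "infinite S1" unfolding S1_def by (rule range_inj_infinite)
    have sub: "S1 \<subseteq> S" using N(2) lF(1) by (auto simp: S1_def)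
    have less: "(\<Sum>k\<in>G. A k m) \<le> real n * d" if m: "m \<in> S1" and G: "finite G" "G \<subseteq> S1 - {m}" for m G
    proof -
      obtain i where i: "m = l i" using m by (auto simp: S1_def)
      have disj: "G \<inter> F i = {}"
      proof (rule ccontr)
        assume "G \<inter> F i \<noteq> {}"
        then obtain j where j: "l j \<in> F i" "l j \<noteq> l i" using G i by (auto simp: S1_def)
        then have "i \<noteq> j" "l j \<in> N i" using lF(3)[of i] by auto
        then show False using N(3)[of i j] lF(1)[of j] by auto
      qed
      have "(\<Sum>k\<in>G \<union> F i. A k m) \<le> real (Suc n) * d"
        using G sub N(2)[of i] lF(1-3)[of i] m by (intro Suc.prems(2)) (auto simp: i)
      moreover have "(\<Sum>k\<in>G \<union> F i. A k m) = (\<Sum>k\<in>G. A k m) + (\<Sum>k\<in>F i. A k m)"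
        using G lF(2) disj by (intro sum.union_disjoint) auto
      ultimately show ?thesis using lF(4)[of i] i by (simp add: algebra_simps)
    qed
    have "\<exists>S'\<subseteq>S1. infinite S' \<and> (\<forall>l\<in>S'. \<forall>F. finite F \<longrightarrow> F \<subseteq> S' - {l} \<longrightarrow> (\<Sum>k\<in>F. A k l) \<le> d)"
      using inf by (rule Suc.IH) (rule less)
    then obtain S' where "S' \<subseteq> S1" and S': "infinite S'"
        "\<forall>l\<in>S'. \<forall>F. finite F \<longrightarrow> F \<subseteq> S' - {l} \<longrightarrow> (\<Sum>k\<in>F. A k l) \<le> d"
      by (elim exE conjE)
    moreover have "S' \<subseteq> S" using \<open>S' \<subseteq> S1\<close> sub by (rule order_trans)
    ultimately show ?thesis by (intro exI[of _ S'] conjI)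
  qed
qed

lemma null_rows_columns_subsequence:
  fixes A :: "nat \<Rightarrow> nat \<Rightarrow> real"
  assumes rows: "\<And>k. (\<lambda>l. A k l) \<longlonglongrightarrow> 0" and cols: "\<And>l. (\<lambda>k. A k l) \<longlonglongrightarrow> 0" and d: "0 < d"
  shows "\<exists>\<sigma>. strict_mono \<sigma> \<and> (\<forall>k l. k \<noteq> l \<longrightarrow> A (\<sigma> k) (\<sigma> l) \<le> d * (1/2) ^ k * (1/2) ^ l)"
proof -
  define P where "P f k r \<longleftrightarrow> (\<forall>j<k. f j < r \<and> A (f j) r \<le> d * (1/2) ^ j * (1/2) ^ k \<and>
      A r (f j) \<le> d * (1/2) ^ k * (1/2) ^ j)" for f and k r :: nat
  have "\<exists>\<sigma>. \<forall>k. P \<sigma> k (\<sigma> k)"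
  proof (rule dependent_wellorder_choice)
    show "P f k r = P g k r" if "\<And>j. j < k \<Longrightarrow> f j = g j" for r f g k
      using that by (simp add: P_def)
    fix k f
    have "\<forall>\<^sub>F r in sequentially. f j < r \<and> A (f j) r \<le> d * (1/2) ^ j * (1/2) ^ k \<and>
        A r (f j) \<le> d * (1/2) ^ k * (1/2) ^ j" for j
    proof (intro eventually_conj)
      have pos: "0 < d * (1/2) ^ j * (1/2) ^ k" "0 < d * (1/2) ^ k * (1/2) ^ j" using d by auto
      show "\<forall>\<^sub>F r in sequentially. f j < r" by (rule eventually_gt_at_top)
      show "\<forall>\<^sub>F r in sequentially. A (f j) r \<le> d * (1/2) ^ j * (1/2) ^ k"
        using order_tendstoD(2)[OF rows[of "f j"] pos(1)] by eventually_elim simp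
      show "\<forall>\<^sub>F r in sequentially. A r (f j) \<le> d * (1/2) ^ k * (1/2) ^ j"
        using order_tendstoD(2)[OF cols[of "f j"] pos(2)] by eventually_elim simp
    qed
    then have "\<forall>\<^sub>F r in sequentially. \<forall>j\<in>{..<k}. f j < r \<and> A (f j) r \<le> d * (1/2) ^ j * (1/2) ^ k \<and>
        A r (f j) \<le> d * (1/2) ^ k * (1/2) ^ j"
      by (intro eventually_ball_finite) auto
    then have "\<forall>\<^sub>F r in sequentially. P f k r" by (simp add: P_def Ball_def)
    then show "\<exists>r. P f k r" by (rule eventually_happens'[rotated]) simp
  qed
  then obtain \<sigma> where \<sigma>: "\<And>k. P \<sigma> k (\<sigma> k)" by blast
  have "strict_mono \<sigma>" using \<sigma> by (auto simp: strict_mono_def P_def)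
  moreover have "A (\<sigma> k) (\<sigma> l) \<le> d * (1/2) ^ k * (1/2) ^ l" if "k \<noteq> l" for k l
    using \<sigma>[of k] \<sigma>[of l] that by (cases k l rule: linorder_cases) (auto simp: P_def)
  ultimately show ?thesis by (intro exI[of _ \<sigma>]) simp
qed

text \<open>The assumption \<open>bounded\<close> is what remains of boundedness on \<open>\<ell>\<^sub>p\<close> for a nonnegative matrix tested
  on indicator vectors. For \<open>p = 1\<close> it bounds the column sums, and the disjointification makes them
  small off the diagonal; rows need not tend to 0 in that case. For \<open>p > 1\<close> a row with
  infinitely many entries above \<open>r > 0\<close> would give \<open>n r \<le> K n\<^sup>1\<^sup>/\<^sup>p\<close> for all \<open>n\<close>, so rows and
  columns tend to 0 and the entries can be made summable.\<close>

lemma almost_diagonal_subsequence: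
  fixes A :: "nat \<Rightarrow> nat \<Rightarrow> real"
  assumes p: "1 \<le> p" and pos: "\<And>k l. 0 \<le> A k l" and d: "0 < d"
    and bounded: "\<And>F G. finite F \<Longrightarrow> finite G \<Longrightarrow>
      pnorm p F (\<lambda>k. \<Sum>l\<in>G. A k l) \<le> K * real (card G) powr (1 / p)"
  shows "\<exists>\<sigma> :: nat \<Rightarrow> nat. strict_mono \<sigma> \<and> (\<forall>F G x. finite F \<longrightarrow> finite G \<longrightarrow>
     pnorm p F (\<lambda>k. \<Sum>l\<in>G - {k}. A (\<sigma> k) (\<sigma> l) * \<bar>x l\<bar>) \<le> d * pnorm p G x)"
proof (cases "p = 1")
  case True
  have sums: "pnorm p F x = (\<Sum>k\<in>F. \<bar>x k\<bar>)" for F and x :: "nat \<Rightarrow> real" by (simp add: pnorm_def True sum_nonneg)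
  obtain n where n: "K \<le> real n * d" using reals_Archimedean3[OF d] by (meson less_imp_le)
  have col_sums: "(\<Sum>k\<in>F. A k l) \<le> real n * d" if "finite F" for l F
    using bounded[OF that, of "{l}"] n by (simp add: sums pos abs_of_nonneg)
  have "\<exists>S\<subseteq>UNIV. infinite S \<and> (\<forall>l\<in>S. \<forall>F. finite F \<longrightarrow> F \<subseteq> S - {l} \<longrightarrow> (\<Sum>k\<in>F. A k l) \<le> d)"
    using d infinite_UNIV_nat by (rule rosenthal_disjointification) (rule col_sums)
  then obtain S where S1: "infinite S" "\<forall>l\<in>S. \<forall>F. finite F \<longrightarrow> F \<subseteq> S - {l} \<longrightarrow> (\<Sum>k\<in>F. A k l) \<le> d"
    by (elim exE conjE)
  then have S: "infinite S" "\<And>l F. l \<in> S \<Longrightarrow> finite F \<Longrightarrow> F \<subseteq> S - {l} \<Longrightarrow> (\<Sum>k\<in>F. A k l) \<le> d"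
    by simp_all
  define \<sigma> where "\<sigma> = enumerate S"
  have mono: "strict_mono \<sigma>" unfolding \<sigma>_def using S(1) by (rule strict_mono_enumerate)
  have \<sigma>S: "\<sigma> k \<in> S" for k unfolding \<sigma>_def using S(1) by (rule enumerate_in_set)
  have est: "pnorm p F (\<lambda>k. \<Sum>l\<in>G - {k}. A (\<sigma> k) (\<sigma> l) * \<bar>x l\<bar>) \<le> d * pnorm p G x"
    if F: "finite F" and G: "finite G" for F G and x :: "nat \<Rightarrow> real"
  proof -
    have "pnorm p F (\<lambda>k. \<Sum>l\<in>G - {k}. A (\<sigma> k) (\<sigma> l) * \<bar>x l\<bar>)
        = (\<Sum>k\<in>F. \<Sum>l\<in>G. if l = k then 0 else A (\<sigma> k) (\<sigma> l) * \<bar>x l\<bar>)"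
      unfolding sums
    proof (rule sum.cong[OF refl])
      fix k
      have "(\<Sum>l\<in>G. if l = k then 0 else A (\<sigma> k) (\<sigma> l) * \<bar>x l\<bar>)
          = (\<Sum>l\<in>G - {k}. if l = k then 0 else A (\<sigma> k) (\<sigma> l) * \<bar>x l\<bar>)"
        using G by (intro sum.mono_neutral_right) auto
      also have "\<dots> = (\<Sum>l\<in>G - {k}. A (\<sigma> k) (\<sigma> l) * \<bar>x l\<bar>)" by (intro sum.cong) auto
      finally show "\<bar>\<Sum>l\<in>G - {k}. A (\<sigma> k) (\<sigma> l) * \<bar>x l\<bar>\<bar>
          = (\<Sum>l\<in>G. if l = k then 0 else A (\<sigma> k) (\<sigma> l) * \<bar>x l\<bar>)"
        using pos by (simp add: sum_nonneg abs_of_nonneg)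
    qed
    also have "\<dots> = (\<Sum>l\<in>G. \<Sum>k\<in>F. if l = k then 0 else A (\<sigma> k) (\<sigma> l) * \<bar>x l\<bar>)" by (rule sum.swap)
    also have "\<dots> \<le> (\<Sum>l\<in>G. d * \<bar>x l\<bar>)"
    proof (rule sum_mono)
      fix l
      have "(\<Sum>k\<in>F. if l = k then 0 else A (\<sigma> k) (\<sigma> l) * \<bar>x l\<bar>)
          = (\<Sum>k\<in>F - {l}. if l = k then 0 else A (\<sigma> k) (\<sigma> l) * \<bar>x l\<bar>)"
        using F by (intro sum.mono_neutral_right) auto
      also have "\<dots> = (\<Sum>k\<in>F - {l}. A (\<sigma> k) (\<sigma> l)) * \<bar>x l\<bar>"
        unfolding sum_distrib_right by (intro sum.cong) auto
      also have "(\<Sum>k\<in>F - {l}. A (\<sigma> k) (\<sigma> l)) = (\<Sum>k\<in>\<sigma> ` (F - {l}). A k (\<sigma> l))"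
        using mono by (subst sum.reindex) (auto simp: strict_mono_eq inj_on_def)
      also have "\<dots> \<le> d"
        using F \<sigma>S mono by (intro S(2)) (auto simp: strict_mono_eq)
      finally show "(\<Sum>k\<in>F. if l = k then 0 else A (\<sigma> k) (\<sigma> l) * \<bar>x l\<bar>) \<le> d * \<bar>x l\<bar>"
        by (simp add: mult_right_mono)
    qed
    also have "\<dots> = d * pnorm p G x" by (simp add: sums sum_distrib_left)
    finally show ?thesis .
  qed
  show ?thesis by (intro exI[of _ \<sigma>] conjI allI impI mono est)
next
  case False
  then have p1: "1 < p" using p by simp
  have K0: "0 \<le> K" using order_trans[OF pnorm_nonneg bounded[of "{}" "{0}"]] by simp
  have cols: "(\<lambda>k. A k l) \<longlonglongrightarrow> 0" for l
  proof -
    have "\<forall>n. pnorm p {..<n} (\<lambda>k. A k l) \<le> K" using bounded[of _ "{l}"] by simp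
    then have "summable (\<lambda>k. \<bar>A k l\<bar> powr p)"
      using summable_powr_iff_pnorm_bounded[of p K "\<lambda>k. A k l"] p K0 by simp
    then have "(\<lambda>k. \<bar>A k l\<bar> powr p) \<longlonglongrightarrow> 0" by (rule summable_LIMSEQ_zero)
    then have "(\<lambda>k. (\<bar>A k l\<bar> powr p) powr (1 / p)) \<longlonglongrightarrow> 0 powr (1 / p)"
      using p by (intro tendsto_powr') auto
    then show ?thesis using p pos by (simp add: powr_powr)
  qed
  have rows: "(\<lambda>l. A k l) \<longlonglongrightarrow> 0" for k
  proof (rule ccontr)
    assume "\<not> (\<lambda>l. A k l) \<longlonglongrightarrow> 0"
    then obtain r where r: "0 < r" "\<And>n. \<exists>l\<ge>n. r \<le> A k l"
      using pos unfolding LIMSEQ_iff by (auto simp: not_less)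
    have inf: "infinite {l. r \<le> A k l}" unfolding infinite_nat_iff_unbounded_le using r(2) by auto
    have key: "real n * r \<le> K * real n powr (1 / p)" for n
    proof -
      obtain G where G: "G \<subseteq> {l. r \<le> A k l}" "finite G" "card G = n"
        using infinite_arbitrarily_large[OF inf] by blast
      have "real n * r = (\<Sum>l\<in>G. r)" using G by simp
      also have "\<dots> \<le> (\<Sum>l\<in>G. A k l)" using G by (intro sum_mono) auto
      also have "\<dots> \<le> \<bar>\<Sum>l\<in>G. A k l\<bar>" by simp
      also have "\<dots> \<le> pnorm p {k} (\<lambda>k. \<Sum>l\<in>G. A k l)" using p by (intro abs_le_pnorm) auto
      also have "\<dots> \<le> K * real (card G) powr (1 / p)" using G by (intro bounded) auto
      finally show ?thesis using G by simp
    qed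
    \<comment> \<open>The exponent is positive since \<open>p > 1\<close>, so this bound cannot hold for all \<open>n\<close>.\<close>
    have slow: "real n powr (1 - 1 / p) \<le> K / r" if "0 < n" for n
    proof -
      have "real n powr (1 - 1 / p) * (r * real n powr (1 / p)) = real n * r"
        using that by (simp add: powr_diff)
      also have "\<dots> \<le> (K / r) * (r * real n powr (1 / p))" using key[of n] r by simp
      finally show ?thesis using that r by (simp add: mult_le_cancel_right pos_le_divide_eq)
    qed
    have "filterlim (\<lambda>n. real n powr (1 - 1 / p)) at_top sequentially"
      using p1 by (intro filterlim_compose[OF real_powr_at_top filterlim_real_sequentially]) (auto simp: field_simps)
    then have "\<forall>\<^sub>F n in sequentially. K / r + 1 \<le> real n powr (1 - 1 / p)" by (simp add: filterlim_at_top)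
    then obtain N where "K / r + 1 \<le> real (Suc N) powr (1 - 1 / p)"
      unfolding eventually_sequentially by (meson le_SucI order_refl)
    moreover have "real (Suc N) powr (1 - 1 / p) \<le> K / r" by (rule slow) simp
    ultimately show False by simp
  qed
  \<comment> \<open>The double geometric series has sum 4.\<close>
  define e where "e = d / 4"
  have e: "0 < e" using d by (simp add: e_def)
  obtain \<sigma> where \<sigma>0: "strict_mono \<sigma>" "\<forall>k l. k \<noteq> l \<longrightarrow> A (\<sigma> k) (\<sigma> l) \<le> e * (1/2) ^ k * (1/2) ^ l"
    using null_rows_columns_subsequence[OF rows cols e] by (elim exE conjE)
  then have \<sigma>: "strict_mono \<sigma>" "\<And>k l. k \<noteq> l \<Longrightarrow> A (\<sigma> k) (\<sigma> l) \<le> e * (1/2) ^ k * (1/2) ^ l"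
    by simp_all
  have geom: "(\<Sum>k\<in>F. (1/2::real) ^ k) \<le> 2" if "finite F" for F :: "nat set"
  proof -
    have "(\<Sum>k\<in>F. (1/2::real) ^ k) \<le> (\<Sum>k. (1/2) ^ k)"
      using that by (intro sum_le_suminf summable_geometric) auto
    also have "\<dots> = 2" by (subst suminf_geometric) auto
    finally show ?thesis .
  qed
  have est: "pnorm p F (\<lambda>k. \<Sum>l\<in>G - {k}. A (\<sigma> k) (\<sigma> l) * \<bar>x l\<bar>) \<le> d * pnorm p G x"
    if F: "finite F" and G: "finite G" for F G and x :: "nat \<Rightarrow> real"
  proof -
    have "pnorm p F (\<lambda>k. \<Sum>l\<in>G - {k}. A (\<sigma> k) (\<sigma> l) * \<bar>x l\<bar>)
        \<le> (\<Sum>k\<in>F. \<bar>\<Sum>l\<in>G - {k}. A (\<sigma> k) (\<sigma> l) * \<bar>x l\<bar>\<bar>)"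
      by (intro pnorm_le_sum p F)
    also have "\<dots> \<le> (\<Sum>k\<in>F. (1/2) ^ k * (e * 2 * pnorm p G x))"
    proof (rule sum_mono)
      fix k
      have "\<bar>\<Sum>l\<in>G - {k}. A (\<sigma> k) (\<sigma> l) * \<bar>x l\<bar>\<bar> = (\<Sum>l\<in>G - {k}. A (\<sigma> k) (\<sigma> l) * \<bar>x l\<bar>)"
        using pos by (intro abs_of_nonneg sum_nonneg) auto
      also have "\<dots> \<le> (\<Sum>l\<in>G - {k}. (e * (1/2) ^ k * (1/2) ^ l) * pnorm p G x)"
        using p G e by (intro sum_mono mult_mono \<sigma>(2) abs_le_pnorm) auto
      also have "\<dots> = (e * (1/2) ^ k * pnorm p G x) * (\<Sum>l\<in>G - {k}. (1/2) ^ l)"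
        by (simp add: sum_distrib_left mult_ac)
      also have "\<dots> \<le> (e * (1/2) ^ k * pnorm p G x) * 2"
        using G e by (intro mult_left_mono geom) auto
      finally show "\<bar>\<Sum>l\<in>G - {k}. A (\<sigma> k) (\<sigma> l) * \<bar>x l\<bar>\<bar> \<le> (1/2) ^ k * (e * 2 * pnorm p G x)"
        by (simp add: mult_ac)
    qed
    also have "\<dots> = (\<Sum>k\<in>F. (1/2) ^ k) * (e * 2 * pnorm p G x)" by (simp add: sum_distrib_right)
    also have "\<dots> \<le> 2 * (e * 2 * pnorm p G x)" using e by (intro mult_right_mono geom F) auto
    also have "\<dots> = d * pnorm p G x" by (simp add: e_def)
    finally show ?thesis .
  qed
  show ?thesis by (intro exI[of _ \<sigma>] conjI allI impI \<sigma>(1) est)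
qed

text \<open>An upper estimate by the norm of \<open>\<ell>\<^sub>p\<close> on finite combinations extends to the whole space by
  completeness.\<close>

lemma (in banach_carrier) lp_synthesis:
  assumes p: "1 \<le> p" and c: "\<And>k::nat. c k \<in> X"
    and upper: "\<And>F a. finite F \<Longrightarrow> nX (\<Sum>k\<in>F. a k *\<^sub>C c k) \<le> pnorm p F (\<lambda>k. cmod (a k))"
  shows "\<exists>J. bounded_operator (lp_space p) (lp_norm p) X nX J \<and>
     (\<forall>a\<in>lp_space p. (\<lambda>n. nX ((\<Sum>k<n. a k *\<^sub>C c k) - J a)) \<longlonglongrightarrow> 0)"
proof -
  have sums: "(\<Sum>k\<in>F. a k *\<^sub>C c k) \<in> X" for F a
    using c subspace by (intro cvs.subspace_sum cvs.subspace_scale) auto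
  have "\<exists>y\<in>X. (\<lambda>n. nX ((\<Sum>k<n. a k *\<^sub>C c k) - y)) \<longlonglongrightarrow> 0" if a: "a \<in> lp_space p" for a
  proof (rule complete[OF sums])
    show "norm_Cauchy (\<lambda>n. \<Sum>k<n. a k *\<^sub>C c k)"
      unfolding norm_Cauchy_def
    proof (intro allI impI)
      fix e :: real assume e: "0 < e"
      have "summable (\<lambda>k. cmod (a k) powr p)" using a by (simp add: lp_space_def)
      then obtain N where N: "\<And>m n. m \<ge> N \<Longrightarrow> norm (\<Sum>k=m..<n. cmod (a k) powr p) < (e/2) powr p"
        unfolding summable_Cauchy using e by (metis powr_gt_zero half_gt_zero less_irrefl)
      have *: "nX ((\<Sum>k<m. a k *\<^sub>C c k) - (\<Sum>k<n. a k *\<^sub>C c k)) < e" if "n \<ge> N" "m \<ge> n" for m n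
      proof -
        have "(\<Sum>k<m. a k *\<^sub>C c k) = (\<Sum>k\<in>{..<n} \<union> {n..<m}. a k *\<^sub>C c k)"
          using that by (intro sum.cong) auto
        also have "\<dots> = (\<Sum>k<n. a k *\<^sub>C c k) + (\<Sum>k\<in>{n..<m}. a k *\<^sub>C c k)"
          by (rule sum.union_disjoint) auto
        finally have "(\<Sum>k<m. a k *\<^sub>C c k) - (\<Sum>k<n. a k *\<^sub>C c k) = (\<Sum>k\<in>{n..<m}. a k *\<^sub>C c k)" by simp
        also have "nX \<dots> \<le> pnorm p {n..<m} (\<lambda>k. cmod (a k))" by (rule upper) simp
        also have "\<dots> \<le> e / 2"
          using N[OF that(1), of m] e p by (subst pnorm_le_iff) (auto simp: sum_nonneg)
        finally show ?thesis using e by simp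
      qed
      have "nX ((\<Sum>k<m. a k *\<^sub>C c k) - (\<Sum>k<n. a k *\<^sub>C c k)) < e" if "m \<ge> N" "n \<ge> N" for m n
        using *[of n m] *[of m n] that norm_minus_commute[OF sums sums, of a "{..<m}" a "{..<n}"]
        by (cases "m \<le> n") auto
      then show "\<exists>N. \<forall>m\<ge>N. \<forall>n\<ge>N. nX ((\<Sum>k<m. a k *\<^sub>C c k) - (\<Sum>k<n. a k *\<^sub>C c k)) < e" by blast
    qed
  qed
  then obtain J where JX: "\<And>a. a \<in> lp_space p \<Longrightarrow> J a \<in> X"
    and lim: "\<And>a. a \<in> lp_space p \<Longrightarrow> (\<lambda>n. nX ((\<Sum>k<n. a k *\<^sub>C c k) - J a)) \<longlonglongrightarrow> 0"
    by metis
  have unique: "y = z" if "y \<in> X" "z \<in> X" "(\<lambda>n. nX (f n - y)) \<longlonglongrightarrow> 0" "(\<lambda>n. nX (f n - z)) \<longlonglongrightarrow> 0"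
    "\<And>n::nat. f n \<in> X" for f y z
  proof -
    have "nX (y - z) \<le> nX (f n - y) + nX (f n - z)" for n
      using norm_triangle_diff[OF that(1) that(5) that(2), of n] norm_minus_commute[OF that(1) that(5), of n] by simp
    moreover have "(\<lambda>n. nX (f n - y) + nX (f n - z)) \<longlonglongrightarrow> 0 + 0" using that by (intro tendsto_intros)
    ultimately have "nX (y - z) \<le> 0 + 0" by (intro LIMSEQ_le_const) auto
    then show ?thesis using norm_nonneg[of "y - z"] norm_definite[of "y - z"] that(1,2) by (simp add: diff_mem)
  qed
  note lp = subspace_lp[OF p]
  have "bounded_operator (lp_space p) (lp_norm p) X nX J"
    unfolding bounded_operator_def
  proof (intro conjI ballI allI)
    show "J \<in> lp_space p \<rightarrow> X" using JX by blast
    show "J (a + d) = J a + J d" if a: "a \<in> lp_space p" and d: "d \<in> lp_space p" for a d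
    proof (rule unique[OF JX[OF cvs.subspace_add[OF lp a d]] add_mem[OF JX[OF a] JX[OF d]]
          lim[OF cvs.subspace_add[OF lp a d]]])
      show "(\<lambda>n. nX ((\<Sum>k<n. (a + d) k *\<^sub>C c k) - (J a + J d))) \<longlonglongrightarrow> 0"
      proof (rule Lim_null_comparison)
        have le: "nX ((\<Sum>k<n. (a + d) k *\<^sub>C c k) - (J a + J d))
          \<le> nX ((\<Sum>k<n. a k *\<^sub>C c k) - J a) + nX ((\<Sum>k<n. d k *\<^sub>C c k) - J d)" for n
        proof -
          have eq: "(\<Sum>k<n. (a + d) k *\<^sub>C c k) - (J a + J d)
            = ((\<Sum>k<n. a k *\<^sub>C c k) - J a) + ((\<Sum>k<n. d k *\<^sub>C c k) - J d)"
            by (simp add: scaleC_add_left sum.distrib)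
          show ?thesis
            unfolding eq by (rule norm_triangle[OF diff_mem[OF sums JX[OF a]] diff_mem[OF sums JX[OF d]]])
        qed
        have "0 \<le> nX ((\<Sum>k<n. (a + d) k *\<^sub>C c k) - (J a + J d))" for n
          by (rule norm_nonneg[OF diff_mem[OF sums add_mem[OF JX[OF a] JX[OF d]]]])
        then show "\<forall>\<^sub>F n in sequentially. norm (nX ((\<Sum>k<n. (a + d) k *\<^sub>C c k) - (J a + J d)))
          \<le> nX ((\<Sum>k<n. a k *\<^sub>C c k) - J a) + nX ((\<Sum>k<n. d k *\<^sub>C c k) - J d)"
          by (intro always_eventually allI) (simp only: real_norm_def abs_of_nonneg le)
        show "(\<lambda>n. nX ((\<Sum>k<n. a k *\<^sub>C c k) - J a) + nX ((\<Sum>k<n. d k *\<^sub>C c k) - J d)) \<longlonglongrightarrow> 0"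
          using tendsto_add[OF lim[OF a] lim[OF d]] by simp
      qed
    qed (rule sums)
    show "J (z *\<^sub>C a) = z *\<^sub>C J a" if a: "a \<in> lp_space p" for z a
    proof (rule unique[OF JX[OF cvs.subspace_scale[OF lp a]] scale_mem[OF JX[OF a]]
          lim[OF cvs.subspace_scale[OF lp a]]])
      have "(\<Sum>k<n. (z *\<^sub>C a) k *\<^sub>C c k) - z *\<^sub>C J a = z *\<^sub>C ((\<Sum>k<n. a k *\<^sub>C c k) - J a)" for n
        by (simp add: scaleC_fun_def[of z a] scaleC_complex_def cvs.scale_right_diff_distrib
            cvs.scale_sum_right scaleC_scaleC)
      then have "nX ((\<Sum>k<n. (z *\<^sub>C a) k *\<^sub>C c k) - z *\<^sub>C J a) = cmod z * nX ((\<Sum>k<n. a k *\<^sub>C c k) - J a)" for n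
        using norm_scale[OF diff_mem[OF sums JX[OF a]]] by simp
      then show "(\<lambda>n. nX ((\<Sum>k<n. (z *\<^sub>C a) k *\<^sub>C c k) - z *\<^sub>C J a)) \<longlonglongrightarrow> 0"
        using tendsto_mult_right_zero[OF lim[OF a], of "cmod z"] by simp
    qed (rule sums)
    show "\<exists>K. \<forall>a\<in>lp_space p. nX (J a) \<le> K * lp_norm p a"
    proof (intro exI[of _ 1] ballI)
      fix a assume a: "a \<in> lp_space p"
      have "nX (J a) \<le> nX ((\<Sum>k<n. a k *\<^sub>C c k) - J a) + lp_norm p a" for n
      proof -
        have "nX (J a) \<le> nX (J a - (\<Sum>k<n. a k *\<^sub>C c k)) + nX (\<Sum>k<n. a k *\<^sub>C c k)"
          using norm_triangle[OF diff_mem[OF JX[OF a] sums] sums, of a "{..<n}" a "{..<n}"] by simp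
        also have "nX (\<Sum>k<n. a k *\<^sub>C c k) \<le> pnorm p {..<n} (\<lambda>k. cmod (a k))" by (rule upper) simp
        also have "\<dots> \<le> lp_norm p a" using p a by (intro pnorm_le_lp_norm) auto
        finally show ?thesis using norm_minus_commute[OF JX[OF a] sums, of a "{..<n}"] by simp
      qed
      moreover have "(\<lambda>n. nX ((\<Sum>k<n. a k *\<^sub>C c k) - J a) + lp_norm p a) \<longlonglongrightarrow> 0 + lp_norm p a"
        by (intro tendsto_intros lim a)
      ultimately have "nX (J a) \<le> 0 + lp_norm p a" by (intro LIMSEQ_le_const) auto
      then show "nX (J a) \<le> 1 * lp_norm p a" by simp
    qed
  qed
  then show ?thesis using lim by (intro exI[of _ J] conjI ballI)
qed

section \<open>Inverting a positive matrix of blocks\<close>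

text \<open>The matrix \<open>A\<close> represents \<open>T\<close> between the blocks \<open>c\<^sub>l\<close> and the functionals \<open>\<phi>\<^sub>k\<close>. On a
  subsequence its off-diagonal part has norm at most \<open>d / 2\<close>, so after division by the diagonal it
  is within \<open>1/2\<close> of the identity of \<open>\<ell>\<^sub>p\<close> and the Neumann series yields a left inverse. This left
  inverse is absorbed into \<open>L\<close>.\<close>

theorem (in banach_carrier) positive_blocks_factorisation:
  assumes p: "1 \<le> p" and T: "bounded_operator X nX X nX T"
    and c: "\<And>k::nat. c k \<in> X"
    and upper: "\<And>F a. finite F \<Longrightarrow> nX (\<Sum>k\<in>F. a k *\<^sub>C c k) \<le> pnorm p F (\<lambda>k. cmod (a k))"
    and \<phi>_add: "\<And>k x y. x \<in> X \<Longrightarrow> y \<in> X \<Longrightarrow> \<phi> k (x + y) = \<phi> k x + \<phi> k y"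
    and \<phi>_scale: "\<And>k a x. x \<in> X \<Longrightarrow> \<phi> k (a *\<^sub>C x) = a * \<phi> k x"
    and lower: "\<And>F x. finite F \<Longrightarrow> x \<in> X \<Longrightarrow> pnorm p F (\<lambda>k. cmod (\<phi> k x)) \<le> nX x"
    and entries: "\<And>k l. \<phi> k (T (c l)) = complex_of_real (A k l)" and pos: "\<And>k l. 0 \<le> A k l"
    and d: "0 < d" and diag: "\<And>k. d \<le> A k k"
  shows "\<exists>J L. bounded_operator (lp_space p) (lp_norm p) X nX J \<and>
     bounded_operator X nX (lp_space p) (lp_norm p) L \<and> (\<forall>a\<in>lp_space p. L (T (J a)) = a)"
proof -
  note lp = subspace_lp[OF p]
  have p0: "0 < p" using p by simp
  obtain K where K: "0 < K" "\<forall>x\<in>X. nX (T x) \<le> K * nX x"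
    using bounded_operator_bound[OF T norm_nonneg] by blast
  have \<phi>b: "bounded_operator X nX UNIV cmod (\<phi> k)" for k
    unfolding bounded_operator_def
  proof (intro conjI ballI allI exI[of _ 1])
    show "cmod (\<phi> k x) \<le> 1 * nX x" if "x \<in> X" for x
      using lower[of "{k}" x] that p0 by (simp add: pnorm_def powr_powr)
  qed (auto simp: \<phi>_add \<phi>_scale scaleC_complex_def)
  have T\<phi>: "bounded_operator X nX UNIV cmod (\<lambda>x. \<phi> k (T x))" for k
    using T \<phi>b norm_nonneg by (rule bounded_operator_comp)
  have T\<phi>_sum: "\<phi> k (T (\<Sum>l\<in>G. a l *\<^sub>C c (h l))) = (\<Sum>l\<in>G. a l * complex_of_real (A k (h l)))"
    for k G a and h :: "nat \<Rightarrow> nat"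
    using bounded_operator_sum[OF T\<phi> subspace c, of k a "\<lambda>l. h l" G]
    by (simp add: entries scaleC_complex_def)
  have sumX: "(\<Sum>k\<in>F. a k *\<^sub>C c (h k)) \<in> X" for F a and h :: "nat \<Rightarrow> nat"
    using c subspace by (intro cvs.subspace_sum cvs.subspace_scale) auto
  have bounded: "pnorm p F (\<lambda>k. \<Sum>l\<in>G. A k l) \<le> K * real (card G) powr (1 / p)"
    if F: "finite F" and G: "finite G" for F G
  proof -
    define y where "y = (\<Sum>l\<in>G. 1 *\<^sub>C c (id l))"
    have y: "y \<in> X" unfolding y_def by (rule sumX)
    have "pnorm p F (\<lambda>k. \<Sum>l\<in>G. A k l) = pnorm p F (\<lambda>k. cmod (\<phi> k (T y)))"
    proof (rule pnorm_cong)
      fix k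
      have "\<phi> k (T y) = complex_of_real (\<Sum>l\<in>G. A k l)" unfolding y_def T\<phi>_sum by simp
      then show "\<bar>\<Sum>l\<in>G. A k l\<bar> = \<bar>cmod (\<phi> k (T y))\<bar>" by (simp del: of_real_sum)
    qed
    also have "\<dots> \<le> nX (T y)" using F bounded_operatorD(1)[OF T y] by (rule lower)
    also have "\<dots> \<le> K * nX y" using K y by blast
    also have "\<dots> \<le> K * pnorm p G (\<lambda>l. cmod 1)"
      using K upper[OF G, of "\<lambda>_. 1"] by (simp add: y_def)
    also have "pnorm p G (\<lambda>l. cmod 1) = real (card G) powr (1 / p)" by (simp add: pnorm_def)
    finally show ?thesis .
  qed
  have d2: "0 < d / 2" using d by simp
  have "\<exists>\<sigma> :: nat \<Rightarrow> nat. strict_mono \<sigma> \<and> (\<forall>F G x. finite F \<longrightarrow> finite G \<longrightarrow>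
      pnorm p F (\<lambda>k. \<Sum>l\<in>G - {k}. A (\<sigma> k) (\<sigma> l) * \<bar>x l\<bar>) \<le> d / 2 * pnorm p G x)"
    using p pos d2 by (rule almost_diagonal_subsequence) (rule bounded)
  then obtain \<sigma> :: "nat \<Rightarrow> nat" where \<sigma>: "strict_mono \<sigma>" and
    off: "\<forall>F G x. finite F \<longrightarrow> finite G \<longrightarrow>
      pnorm p F (\<lambda>k. \<Sum>l\<in>G - {k}. A (\<sigma> k) (\<sigma> l) * \<bar>x l\<bar>) \<le> d / 2 * pnorm p G x"
    by (elim exE conjE)
  have inj: "inj \<sigma>" using \<sigma> by (rule strict_mono_imp_inj_on)
  have upper': "nX (\<Sum>k\<in>F. a k *\<^sub>C c (\<sigma> k)) \<le> pnorm p F (\<lambda>k. cmod (a k))" if F: "finite F" for F a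
  proof -
    have injF: "inj_on \<sigma> F" using inj by (rule inj_on_subset) simp
    have "nX (\<Sum>j\<in>\<sigma> ` F. a (inv \<sigma> j) *\<^sub>C c j) \<le> pnorm p (\<sigma> ` F) (\<lambda>j. cmod (a (inv \<sigma> j)))"
      using F by (intro upper) simp
    then show ?thesis using inj by (simp add: sum.reindex[OF injF] pnorm_reindex[OF injF])
  qed
  have "\<exists>J. bounded_operator (lp_space p) (lp_norm p) X nX J \<and>
     (\<forall>a\<in>lp_space p. (\<lambda>n. nX ((\<Sum>k<n. a k *\<^sub>C c (\<sigma> k)) - J a)) \<longlonglongrightarrow> 0)"
    using p c by (rule lp_synthesis[where c = "\<lambda>k. c (\<sigma> k)"]) (rule upper')
  then obtain J where J: "bounded_operator (lp_space p) (lp_norm p) X nX J"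
    and Jlim: "\<forall>a\<in>lp_space p. (\<lambda>n. nX ((\<Sum>k<n. a k *\<^sub>C c (\<sigma> k)) - J a)) \<longlonglongrightarrow> 0"
    by (elim exE conjE)
  have JX: "J a \<in> X" if "a \<in> lp_space p" for a using bounded_operatorD(1)[OF J that] .
  define D where "D k = A (\<sigma> k) (\<sigma> k)" for k
  have D: "d \<le> D k" "0 < D k" for k using diag[of "\<sigma> k"] d by (auto simp: D_def)
  define S where "S x k = \<phi> (\<sigma> k) x / complex_of_real (D k)" for x k
  have S: "S x \<in> lp_space p \<and> lp_norm p (S x) \<le> (1 / d) * nX x" if x: "x \<in> X" for x
  proof (subst lp_space_iff[OF p])
    show "0 \<le> 1 / d * nX x" using d norm_nonneg[OF x] by simp
    show "\<forall>n. pnorm p {..<n} (\<lambda>i. cmod (S x i)) \<le> 1 / d * nX x"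
    proof
      fix n
      have "cmod (S x i) \<le> (1 / d) * cmod (\<phi> (\<sigma> i) x)" for i
      proof -
        have "cmod (S x i) = cmod (\<phi> (\<sigma> i) x) / D i" using D(2)[of i] by (simp add: S_def norm_divide)
        also have "\<dots> \<le> cmod (\<phi> (\<sigma> i) x) / d" using D[of i] d by (intro divide_left_mono) auto
        finally show ?thesis by simp
      qed
      then have "pnorm p {..<n} (\<lambda>i. cmod (S x i)) \<le> pnorm p {..<n} (\<lambda>i. (1 / d) * cmod (\<phi> (\<sigma> i) x))"
        using p0 d by (intro pnorm_mono) auto
      also have "\<dots> = (1 / d) * pnorm p {..<n} (\<lambda>i. cmod (\<phi> (\<sigma> i) x))"
        using d by (subst pnorm_scale[OF p0]) simp
      also have "pnorm p {..<n} (\<lambda>i. cmod (\<phi> (\<sigma> i) x)) = pnorm p (\<sigma> ` {..<n}) (\<lambda>j. cmod (\<phi> j x))"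
        using inj by (subst pnorm_reindex) (auto intro: inj_on_subset)
      also have "(1 / d) * \<dots> \<le> (1 / d) * nX x"
        using d x by (intro mult_left_mono lower) auto
      finally show "pnorm p {..<n} (\<lambda>i. cmod (S x i)) \<le> 1 / d * nX x" .
    qed
  qed
  have Sb: "bounded_operator X nX (lp_space p) (lp_norm p) S"
    unfolding bounded_operator_def
  proof (intro conjI ballI allI)
    show "S \<in> X \<rightarrow> lp_space p" using S by blast
    show "\<exists>K. \<forall>x\<in>X. lp_norm p (S x) \<le> K * nX x" using S by blast
  qed (auto simp: S_def fun_eq_iff \<phi>_add \<phi>_scale add_divide_distrib scaleC_fun_def scaleC_complex_def)
  have ST: "bounded_operator X nX (lp_space p) (lp_norm p) (\<lambda>x. S (T x))"
    using T Sb norm_nonneg by (rule bounded_operator_comp)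
  have M: "bounded_operator (lp_space p) (lp_norm p) (lp_space p) (lp_norm p) (\<lambda>a. S (T (J a)))"
    using J ST norm_nonneg by (rule bounded_operator_comp)
  obtain K' where K': "0 < K'" "\<forall>x\<in>X. lp_norm p (S (T x)) \<le> K' * nX x"
    using bounded_operator_bound[OF ST norm_nonneg] by blast
  have Mlim: "(\<lambda>n. \<Sum>l<n. a l * complex_of_real (A (\<sigma> k) (\<sigma> l)) / complex_of_real (D k)) \<longlonglongrightarrow> S (T (J a)) k"
    if a: "a \<in> lp_space p" for a k
  proof -
    let ?y = "\<lambda>n. \<Sum>k<n. a k *\<^sub>C c (\<sigma> k)"
    have "(\<lambda>n. S (T (?y n)) k - S (T (J a)) k) \<longlonglongrightarrow> 0"
    proof (rule Lim_null_comparison)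
      have "cmod (S (T (?y n)) k - S (T (J a)) k) \<le> K' * nX (?y n - J a)" for n
      proof -
        have yJ: "?y n - J a \<in> X" by (rule diff_mem[OF sumX JX[OF a]])
        have "S (T (?y n - J a)) = S (T (?y n)) - S (T (J a))"
          by (rule bounded_operator_diff[OF ST subspace sumX JX[OF a]])
        then have "cmod (S (T (?y n)) k - S (T (J a)) k) = cmod (S (T (?y n - J a)) k)" by simp
        also have "\<dots> \<le> lp_norm p (S (T (?y n - J a)))"
          by (rule cmod_le_lp_norm[OF p bounded_operatorD(1)[OF ST yJ]])
        also have "\<dots> \<le> K' * nX (?y n - J a)" using K' yJ by blast
        finally show ?thesis .
      qed
      then show "\<forall>\<^sub>F n in sequentially. cmod (S (T (?y n)) k - S (T (J a)) k) \<le> K' * nX (?y n - J a)"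
        by (intro always_eventually allI)
      show "(\<lambda>n. K' * nX (?y n - J a)) \<longlonglongrightarrow> 0" using Jlim a by (intro tendsto_mult_right_zero) blast
    qed
    then have "(\<lambda>n. S (T (?y n)) k) \<longlonglongrightarrow> S (T (J a)) k" by (rule LIM_zero_cancel)
    then show ?thesis by (simp add: S_def T\<phi>_sum sum_divide_distrib)
  qed
  define U where "U a = a - S (T (J a))" for a
  have U: "U a \<in> lp_space p \<and> lp_norm p (U a) \<le> lp_norm p a / 2" if a: "a \<in> lp_space p" for a
  proof (subst lp_space_iff[OF p])
    show "\<forall>N. pnorm p {..<N} (\<lambda>k. cmod (U a k)) \<le> lp_norm p a / 2"
    proof
      fix N
      let ?R = "\<lambda>n k. a k - (\<Sum>l<n. a l * complex_of_real (A (\<sigma> k) (\<sigma> l)) / complex_of_real (D k))"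
      show "pnorm p {..<N} (\<lambda>k. cmod (U a k)) \<le> lp_norm p a / 2"
      proof (rule LIMSEQ_le_const2)
        show "(\<lambda>n. pnorm p {..<N} (\<lambda>k. cmod (?R n k))) \<longlonglongrightarrow> pnorm p {..<N} (\<lambda>k. cmod (U a k))"
        proof (rule tendsto_pnorm[OF p0])
          fix k
          show "(\<lambda>n. cmod (?R n k)) \<longlonglongrightarrow> cmod (U a k)"
            unfolding U_def minus_apply by (intro tendsto_norm tendsto_diff tendsto_const Mlim a)
        qed simp
        have "pnorm p {..<N} (\<lambda>k. cmod (?R n k)) \<le> lp_norm p a / 2" if n: "n \<ge> N" for n
        proof -
          have bd: "cmod (?R n k) \<le> (1 / d) * (\<Sum>l\<in>{..<n} - {k}. A (\<sigma> k) (\<sigma> l) * \<bar>cmod (a l)\<bar>)" if k: "k < N" for k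
          proof -
            have "(\<Sum>l<n. a l * complex_of_real (A (\<sigma> k) (\<sigma> l)) / complex_of_real (D k))
              = a k + (\<Sum>l\<in>{..<n} - {k}. a l * complex_of_real (A (\<sigma> k) (\<sigma> l)) / complex_of_real (D k))"
              using k n D(2)[of k] by (subst sum.remove[of _ k]) (auto simp: D_def)
            then have "cmod (?R n k) = cmod (\<Sum>l\<in>{..<n} - {k}. a l * complex_of_real (A (\<sigma> k) (\<sigma> l)) / complex_of_real (D k))"
              by simp
            also have "\<dots> \<le> (\<Sum>l\<in>{..<n} - {k}. (1 / d) * (A (\<sigma> k) (\<sigma> l) * \<bar>cmod (a l)\<bar>))"
            proof (rule sum_norm_le)
              fix l
              have "cmod (a l * complex_of_real (A (\<sigma> k) (\<sigma> l)) / complex_of_real (D k))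
                = (A (\<sigma> k) (\<sigma> l) * cmod (a l)) / D k"
                using pos D(2)[of k] by (simp add: norm_mult norm_divide)
              also have "\<dots> \<le> (A (\<sigma> k) (\<sigma> l) * cmod (a l)) / d"
                using pos D[of k] d by (intro divide_left_mono) auto
              finally show "cmod (a l * complex_of_real (A (\<sigma> k) (\<sigma> l)) / complex_of_real (D k))
                \<le> (1 / d) * (A (\<sigma> k) (\<sigma> l) * \<bar>cmod (a l)\<bar>)" by simp
            qed
            finally show ?thesis unfolding sum_distrib_left .
          qed
          have "pnorm p {..<N} (\<lambda>k. cmod (?R n k))
              \<le> pnorm p {..<N} (\<lambda>k. (1 / d) * (\<Sum>l\<in>{..<n} - {k}. A (\<sigma> k) (\<sigma> l) * \<bar>cmod (a l)\<bar>))"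
          proof (rule pnorm_mono[OF p0])
            fix k assume "k \<in> {..<N}"
            then have "k < N" by simp
            from bd[OF this] show "\<bar>cmod (?R n k)\<bar>
                \<le> \<bar>(1 / d) * (\<Sum>l\<in>{..<n} - {k}. A (\<sigma> k) (\<sigma> l) * \<bar>cmod (a l)\<bar>)\<bar>"
              unfolding abs_norm_cancel by (rule order_trans[OF _ abs_ge_self])
          qed
          also have "\<dots> = (1 / d) * pnorm p {..<N} (\<lambda>k. \<Sum>l\<in>{..<n} - {k}. A (\<sigma> k) (\<sigma> l) * \<bar>cmod (a l)\<bar>)"
            using d by (subst pnorm_scale[OF p0]) simp
          also have "\<dots> \<le> (1 / d) * (d / 2 * pnorm p {..<n} (\<lambda>l. cmod (a l)))"
            using d by (intro mult_left_mono off[rule_format]) simp_all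
          also have "\<dots> = pnorm p {..<n} (\<lambda>l. cmod (a l)) / 2" using d by simp
          also have "\<dots> \<le> lp_norm p a / 2" using pnorm_le_lp_norm[OF p a, of "{..<n}"] by simp
          finally show ?thesis .
        qed
        then show "\<exists>M. \<forall>n\<ge>M. pnorm p {..<N} (\<lambda>k. cmod (?R n k)) \<le> lp_norm p a / 2" by blast
      qed
    qed
  qed simp
  have Ub: "bounded_operator (lp_space p) (lp_norm p) (lp_space p) (lp_norm p) U"
    unfolding bounded_operator_def
  proof (intro conjI ballI allI)
    show "U \<in> lp_space p \<rightarrow> lp_space p" using U by blast
    show "\<exists>K. \<forall>a\<in>lp_space p. lp_norm p (U a) \<le> K * lp_norm p a"
      using U by (intro exI[of _ "1/2"]) simp
    show "U (a + e) = U a + U e" if "a \<in> lp_space p" "e \<in> lp_space p" for a e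
      using bounded_operatorD(2)[OF M that] by (simp add: U_def)
    show "U (z *\<^sub>C a) = z *\<^sub>C U a" if "a \<in> lp_space p" for z a
      using bounded_operatorD(3)[OF M that] by (simp add: U_def cvs.scale_right_diff_distrib)
  qed
  have half: "lp_norm p (U a) \<le> lp_norm p a / 2" if "a \<in> lp_space p" for a using U[OF that] by simp
  have "\<exists>V. bounded_operator (lp_space p) (lp_norm p) (lp_space p) (lp_norm p) V \<and>
     (\<forall>a\<in>lp_space p. V (a - U a) = a)"
    using p Ub by (rule lp_neumann_left_inverse) (rule half)
  then obtain V where V: "bounded_operator (lp_space p) (lp_norm p) (lp_space p) (lp_norm p) V"
    and VU: "\<forall>a\<in>lp_space p. V (a - U a) = a"
    by (elim exE conjE)
  have "bounded_operator X nX (lp_space p) (lp_norm p) (\<lambda>x. V (S x))"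
    using Sb V lp_norm_nonneg by (rule bounded_operator_comp)
  moreover have "V (S (T (J a))) = a" if "a \<in> lp_space p" for a
  proof -
    have "a - U a = S (T (J a))" by (simp add: U_def)
    then show ?thesis using VU that by metis
  qed
  ultimately show ?thesis
    using J by (intro exI[of _ J] exI[of _ "\<lambda>x. V (S x)"] conjI ballI)
qed

section \<open>Compact operators are strictly singular\<close>

sublocale schatten \<subseteq> carrier: banach_carrier C nC
proof unfold_locales
  fix x y assume x: "x \<in> C" and y: "y \<in> C"
  show "nC (x + y) \<le> nC x + nC y" using schatten_add[OF x y] by simp
next
  show "nC x = 0 \<Longrightarrow> x = 0" if "x \<in> C" for x using that by (rule schatten_norm_eq_0)
  show "nC (a *\<^sub>C x) = cmod a * nC x" if "x \<in> C" for a x using that by (rule schatten_scaleC)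
  interpret normed_carrier C nC
    by unfold_locales (auto simp: subspace_schatten schatten_add schatten_scaleC schatten_norm_eq_0)
  fix x :: "nat \<Rightarrow> 'h \<Rightarrow> 'h"
  assume "\<And>n. x n \<in> C" "norm_Cauchy x"
  then show "\<exists>y\<in>C. (\<lambda>n. nC (x n - y)) \<longlonglongrightarrow> 0"
    unfolding norm_Cauchy_def by (intro schatten_complete) auto
qed (auto simp: subspace_schatten)

context schatten
begin

text \<open>Given finitely many unit vectors, take \<open>n\<close> such that compression to \<open>P\<^sub>n\<close> hardly changes them, and
  a unit vector of \<open>E\<close> in the common kernel of the finitely many functionals that make up this
  compression. Compressing the difference shows that the new vector is far from the old ones.\<close>

lemma separated_sequence:
  assumes E: "E \<subseteq> C" "cvs.subspace E" "\<not> finite_dimensional E"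
  shows "\<exists>x. \<forall>k::nat. x k \<in> E \<and> nC (x k) = 1 \<and> (\<forall>j<k. 1/2 \<le> nC (x k - x j))"
proof (rule dependent_wellorder_choice)
  show "(r \<in> E \<and> nC r = 1 \<and> (\<forall>j<k. 1/2 \<le> nC (r - f j))) = (r \<in> E \<and> nC r = 1 \<and> (\<forall>j<k. 1/2 \<le> nC (r - g j)))"
    if "\<And>j. j < k \<Longrightarrow> f j = g j" for r f g and k :: nat
    using that by simp
  fix k :: nat and f
  assume f: "\<And>j. j < k \<Longrightarrow> f j \<in> E \<and> nC (f j) = 1 \<and> (\<forall>i<j. 1/2 \<le> nC (f j - f i))"
  have fC: "f j \<in> C" if "j < k" for j using f[OF that] E by blast
  have "\<forall>\<^sub>F n in sequentially. nC (f j - compression n (f j)) < 1/2" if "j < k" for j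
    using order_tendstoD(2)[OF compression_tendsto[OF fC[OF that]], of "1/2"] by simp
  then have "\<forall>\<^sub>F n in sequentially. \<forall>j\<in>{..<k}. nC (f j - compression n (f j)) < 1/2"
    by (intro eventually_ball_finite) auto
  then obtain n where n: "\<And>j. j < k \<Longrightarrow> nC (f j - compression n (f j)) < 1/2"
    unfolding eventually_sequentially by (meson lessThan_iff order_refl)
  have "\<exists>x\<in>E. x \<noteq> 0 \<and> (\<forall>i\<in>{..<n} \<times> {..<n}. cinner (b (fst i)) (x (b (snd i))) = 0)"
    by (rule common_kernel_nonzero[OF _ _ E(2,3)])
      (auto simp: clinear_def cinner_add_right cinner_scaleC_right scaleC_fun_def scaleC_complex_def)
  then obtain x where x: "x \<in> E" "x \<noteq> 0" "\<forall>i\<in>{..<n} \<times> {..<n}. cinner (b (fst i)) (x (b (snd i))) = 0"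
    by blast
  have xC: "x \<in> C" using x E by blast
  have nx: "nC x \<noteq> 0" using schatten_norm_eq_0[OF xC] x(2) by blast
  define r where "r = complex_of_real (1 / nC x) *\<^sub>C x"
  have rE: "r \<in> E" unfolding r_def using E(2) x(1) by (rule cvs.subspace_scale)
  have rC: "r \<in> C" using rE E by blast
  have nr: "nC r = 1" using nx by (simp add: r_def schatten_scaleC[OF xC] norm_divide)
  have "compression n x = 0"
    unfolding compression_def using x(3) by (intro sum.neutral ballI) auto
  then have comp: "compression n r = 0" by (simp add: r_def compression_scaleC)
  have "1/2 \<le> nC (r - f j)" if j: "j < k" for j
  proof -
    have "nC (f j) \<le> nC (f j - compression n (f j)) + nC (compression n (f j))"
      using carrier.norm_triangle[OF schatten_diff[OF fC[OF j] compression_schatten] compression_schatten,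
          of n "f j" n "f j"] by simp
    then have "1/2 \<le> nC (compression n (f j))" using n[OF j] f[OF j] by simp
    also have "compression n (f j) = compression n (f j - r)"
      by (simp add: clinear_diff[OF compression_clinear] comp)
    also have "nC \<dots> \<le> nC (f j - r)" by (intro norm_compression_le schatten_diff fC[OF j] rC)
    also have "\<dots> = nC (r - f j)" using carrier.norm_minus_commute[OF fC[OF j] rC] .
    finally show ?thesis .
  qed
  then show "\<exists>r. r \<in> E \<and> nC r = 1 \<and> (\<forall>j<k. 1/2 \<le> nC (r - f j))" using rE nr by blast
qed

theorem compact_imp_strictly_singular:
  assumes T: "compact_operator C nC C nC T"
  shows "strictly_singular C nC C nC T"
  unfolding strictly_singular_def
proof (intro conjI notI)
  show Tb: "bounded_operator C nC C nC T" using T by (simp add: compact_operator_def)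
  assume "\<exists>E. closed_inf_dim_subspace C nC E \<and> isomorphism E nC (T ` E) nC T"
  then obtain E where E: "E \<subseteq> C" "cvs.subspace E" "\<not> finite_dimensional E"
    and iso: "isomorphism E nC (T ` E) nC T" by (auto simp: closed_inf_dim_subspace_def)
  have inj: "inj_on T E" and inv: "bounded_operator (T ` E) nC E nC (inv_into E T)"
    using iso by (auto simp: isomorphism_def bij_betw_def)
  obtain K where K: "0 < K" "\<forall>y\<in>T ` E. nC (inv_into E T y) \<le> K * nC y"
    using bounded_operator_bound[OF inv] by auto
  have low: "nC x \<le> K * nC (T x)" if "x \<in> E" for x
    using K that inj by force
  obtain x where sep: "\<forall>k::nat. x k \<in> E \<and> nC (x k) = 1 \<and> (\<forall>j<k. 1/2 \<le> nC (x k - x j))"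
    using separated_sequence[OF E] by (elim exE)
  then have x: "\<And>k. x k \<in> E" "\<And>k. nC (x k) = 1" "\<And>k j. j < k \<Longrightarrow> 1/2 \<le> nC (x k - x j)"
    by simp_all
  have xC: "x k \<in> C" for k using x(1) E by blast
  have x1: "nC (x k) \<le> 1" for k using x(2) by simp
  obtain r where r: "strict_mono r" "carrier.norm_Cauchy (\<lambda>n. T (x (r n)))"
    using carrier.compact_operator_subseq[of T x, OF T xC x1] by (elim exE conjE)
  have "0 < 1 / (2 * K)" using K by simp
  then obtain N where N: "\<forall>m\<ge>N. \<forall>n\<ge>N. nC (T (x (r m)) - T (x (r n))) < 1 / (2 * K)"
    using r(2) unfolding carrier.norm_Cauchy_def by blast
  have "nC (T (x (r (Suc N))) - T (x (r N))) < 1 / (2 * K)" using N by simp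
  moreover have "T (x (r (Suc N))) - T (x (r N)) = T (x (r (Suc N)) - x (r N))"
    using bounded_operator_diff[OF Tb subspace_schatten xC xC] by simp
  moreover have "1/2 \<le> nC (x (r (Suc N)) - x (r N))"
    using r(1) by (intro x(3)) (simp add: strict_mono_def)
  moreover have "nC (x (r (Suc N)) - x (r N)) \<le> K * nC (T (x (r (Suc N)) - x (r N)))"
    by (intro low cvs.subspace_diff[OF E(2)] x(1))
  ultimately have "1/2 < K * (1 / (2 * K))"
    using K by (smt (verit) mult_strict_left_mono)
  then show False using K by simp
qed

end

section \<open>The quadratic form of a positive operator\<close>

locale positive_schatten_operator = schatten b p for b :: "nat \<Rightarrow> 'h::chilbert_space" and p +
  fixes T :: "('h \<Rightarrow> 'h) \<Rightarrow> ('h \<Rightarrow> 'h)"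
  assumes positive: "T \<in> positive_operators p"
begin

lemma bounded_T: "bounded_operator C nC C nC T"
  using positive by (simp add: positive_operators_def)

lemmas T_mem = bounded_operatorD(1)[OF bounded_T]
  and T_add = bounded_operatorD(2)[OF bounded_T]
  and T_scale = bounded_operatorD(3)[OF bounded_T]
  and T_diff = bounded_operator_diff[OF bounded_T subspace_schatten]
  and T_sum = bounded_operator_sum[OF bounded_T subspace_schatten]

lemma rank_one_mem: "rank_one v u \<in> C"
  using schatten_rank_one by blast

lemma cinner_T_rank_one_nonneg: "cinner e (T (rank_one g g) e) \<in> \<real>\<^sub>\<ge>\<^sub>0"
proof -
  have "cinner x (rank_one g g x) \<in> \<real>\<^sub>\<ge>\<^sub>0" for x
  proof -
    have "cinner x (rank_one g g x) = cinner g x * cnj (cinner g x)"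
      using cinner_commute[of x g] by (simp add: rank_one_def cinner_scaleC_right)
    also have "\<dots> = complex_of_real ((cmod (cinner g x))\<^sup>2)" by (rule complex_norm_square[symmetric])
    finally show ?thesis by (simp del: of_real_power)
  qed
  then have "rank_one g g \<in> schatten_cone p" by (simp add: schatten_cone_def rank_one_mem)
  then show ?thesis using positive by (auto simp: positive_operators_def schatten_cone_def)
qed

text \<open>A quadratic form in \<open>g\<close> for fixed \<open>e\<close> and in \<open>e\<close> for fixed \<open>g\<close>. Positivity of \<open>T\<close> says
  that it is nonnegative.\<close>

definition qform :: "'h \<Rightarrow> 'h \<Rightarrow> real" where
  "qform g e = Re (cinner e (T (rank_one g g) e))"

lemma qform_nonneg: "0 \<le> qform g e"
  unfolding qform_def by (rule nonneg_Reals_complexD(2)[OF cinner_T_rank_one_nonneg])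

lemma cinner_T_rank_one: "cinner e (T (rank_one g g) e) = complex_of_real (qform g e)"
  unfolding qform_def by (rule nonneg_Reals_complexD(3)[OF cinner_T_rank_one_nonneg])

lemma qform_scale: "qform (c *\<^sub>C g) e = (cmod c)\<^sup>2 * qform g e"
proof -
  have "rank_one (c *\<^sub>C g) (c *\<^sub>C g) = (c * cnj c) *\<^sub>C rank_one g g"
    by (auto simp: rank_one_def fun_eq_iff scaleC_fun_def cinner_scaleC_left scaleC_scaleC mult_ac)
  also have "c * cnj c = complex_of_real ((cmod c)\<^sup>2)" by (rule complex_norm_square[symmetric])
  finally have eq: "rank_one (c *\<^sub>C g) (c *\<^sub>C g) = complex_of_real ((cmod c)\<^sup>2) *\<^sub>C rank_one g g" .
  have "T (rank_one (c *\<^sub>C g) (c *\<^sub>C g)) = complex_of_real ((cmod c)\<^sup>2) *\<^sub>C T (rank_one g g)"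
    unfolding eq by (rule T_scale[OF rank_one_mem])
  from fun_cong[OF this, of e]
  have Te: "T (rank_one (c *\<^sub>C g) (c *\<^sub>C g)) e = complex_of_real ((cmod c)\<^sup>2) *\<^sub>C T (rank_one g g) e"
    unfolding scaleC_fun_def .
  have "cinner e (T (rank_one (c *\<^sub>C g) (c *\<^sub>C g)) e)
      = complex_of_real ((cmod c)\<^sup>2) * cinner e (T (rank_one g g) e)"
    unfolding Te by (rule cinner_scaleC_right)
  then have "complex_of_real (qform (c *\<^sub>C g) e) = complex_of_real ((cmod c)\<^sup>2 * qform g e)"
    unfolding cinner_T_rank_one by (simp only: of_real_mult)
  then show ?thesis by (simp only: of_real_eq_iff)
qed

text \<open>The parallelogram identity, in which the term for \<open>g - h\<close> is dropped because it is nonnegative.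
  This is the control of the off-diagonal corners in the domain of \<open>T\<close>.\<close>

lemma qform_add_le: "qform (g + h) e \<le> 2 * qform g e + 2 * qform h e"
proof -
  have "rank_one (g + h) (g + h) + rank_one (g - h) (g - h) = 2 *\<^sub>C rank_one g g + 2 *\<^sub>C rank_one h h"
  proof
    fix x
    have two: "(2 * z) *\<^sub>C y = z *\<^sub>C y + z *\<^sub>C y" for z and y :: 'h
      by (simp only: mult_2 scaleC_add_left)
    show "(rank_one (g + h) (g + h) + rank_one (g - h) (g - h)) x = (2 *\<^sub>C rank_one g g + 2 *\<^sub>C rank_one h h) x"
      by (simp add: rank_one_def scaleC_fun_def two cinner_add_left cinner_diff_left scaleC_add_right
          scaleC_add_left cvs.scale_right_diff_distrib cvs.scale_left_diff_distrib)
  qed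
  then have "T (rank_one (g + h) (g + h) + rank_one (g - h) (g - h))
     = T (2 *\<^sub>C rank_one g g + 2 *\<^sub>C rank_one h h)" by (rule arg_cong)
  then have "T (rank_one (g + h) (g + h)) + T (rank_one (g - h) (g - h))
     = 2 *\<^sub>C T (rank_one g g) + 2 *\<^sub>C T (rank_one h h)"
    by (simp only: T_add[OF rank_one_mem rank_one_mem] T_scale[OF rank_one_mem]
        T_add[OF carrier.scale_mem[OF rank_one_mem] carrier.scale_mem[OF rank_one_mem]])
  then have "(T (rank_one (g + h) (g + h)) + T (rank_one (g - h) (g - h))) e
     = (2 *\<^sub>C T (rank_one g g) + 2 *\<^sub>C T (rank_one h h)) e" by (rule fun_cong)
  then have "cinner e (T (rank_one (g + h) (g + h)) e) + cinner e (T (rank_one (g - h) (g - h)) e)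
     = 2 * cinner e (T (rank_one g g) e) + 2 * cinner e (T (rank_one h h) e)"
    by (simp add: scaleC_fun_def flip: cinner_add_right cinner_scaleC_right)
  then have "complex_of_real (qform (g + h) e + qform (g - h) e) = complex_of_real (2 * qform g e + 2 * qform h e)"
    by (simp add: cinner_T_rank_one)
  then have "qform (g + h) e + qform (g - h) e = 2 * qform g e + 2 * qform h e" by (simp only: of_real_eq_iff)
  then show ?thesis using qform_nonneg[of "g - h" e] by linarith
qed

lemma qform_sum_le: "qform (\<Sum>a<m. x a) e \<le> 2 ^ m * (\<Sum>a<m. qform (x a) e)"
proof (induction m)
  case 0
  have "rank_one 0 0 = (0 :: 'h \<Rightarrow> 'h)" by (auto simp: rank_one_def)
  then show ?case using bounded_operator_zero[OF bounded_T subspace_schatten] by (simp add: qform_def)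
next
  case (Suc m)
  have "qform (\<Sum>a<Suc m. x a) e \<le> 2 * qform (\<Sum>a<m. x a) e + 2 * qform (x m) e" using qform_add_le by simp
  also have "\<dots> \<le> 2 * (2 ^ m * (\<Sum>a<m. qform (x a) e)) + 2 * qform (x m) e" using Suc by simp
  also have "\<dots> \<le> 2 * (2 ^ m * (\<Sum>a<m. qform (x a) e)) + 2 * (2 ^ m * qform (x m) e)"
    using qform_nonneg[of "x m" e] mult_right_mono[of 1 "2 ^ m" "qform (x m) e"] by simp
  finally show ?case by (simp add: algebra_simps)
qed

lemma qform_tendsto:
  assumes g: "g \<longlonglongrightarrow> g0" and e: "e \<longlonglongrightarrow> e0"
  shows "(\<lambda>n. qform (g n) (e n)) \<longlonglongrightarrow> qform g0 e0"
proof -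
  obtain K where K: "0 < K" "\<forall>x\<in>C. nC (T x) \<le> K * nC x"
    using bounded_operator_bound[OF bounded_T] by auto
  let ?R = "\<lambda>n. rank_one (g n) (g n)" and ?S = "rank_one g0 g0"
  have "(\<lambda>n. cinner (e n) (T (?R n) (e n)) - cinner (e n) (T ?S (e n))) \<longlonglongrightarrow> 0"
  proof (rule Lim_null_comparison)
    have "cmod (cinner (e n) (T (?R n) (e n)) - cinner (e n) (T ?S (e n)))
      \<le> K * (norm (g n - g0) * norm (g n) + norm g0 * norm (g n - g0)) * norm (e n) * norm (e n)" for n
    proof -
      have RR: "?R n - ?S \<in> C" by (intro schatten_diff rank_one_mem)
      have eq: "?R n - ?S = rank_one (g n - g0) (g n) + rank_one g0 (g n - g0)"
        by (auto simp: fun_eq_iff rank_one_def cvs.scale_right_diff_distrib cvs.scale_left_diff_distrib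
            cinner_diff_left)
      have "nC (?R n - ?S) \<le> nC (rank_one (g n - g0) (g n)) + nC (rank_one g0 (g n - g0))"
        unfolding eq by (rule carrier.norm_triangle[OF rank_one_mem rank_one_mem])
      also have "\<dots> \<le> norm (g n - g0) * norm (g n) + norm g0 * norm (g n - g0)"
        using schatten_rank_one by (intro add_mono) auto
      finally have 1: "nC (?R n - ?S) \<le> norm (g n - g0) * norm (g n) + norm g0 * norm (g n - g0)" .
      have "cinner (e n) (T (?R n) (e n)) - cinner (e n) (T ?S (e n)) = cinner (e n) (T (?R n - ?S) (e n))"
        using T_diff[OF rank_one_mem rank_one_mem] by (simp add: cinner_diff_right)
      then have "cmod (cinner (e n) (T (?R n) (e n)) - cinner (e n) (T ?S (e n)))
          \<le> nC (T (?R n - ?S)) * norm (e n) * norm (e n)"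
        using cinner_schatten_le[OF T_mem[OF RR]] by simp
      also have "\<dots> \<le> (K * nC (?R n - ?S)) * norm (e n) * norm (e n)"
        using K RR by (intro mult_right_mono) auto
      also have "\<dots> \<le> K * (norm (g n - g0) * norm (g n) + norm g0 * norm (g n - g0)) * norm (e n) * norm (e n)"
        using K 1 by (intro mult_right_mono mult_left_mono) auto
      finally show ?thesis .
    qed
    then show "\<forall>\<^sub>F n in sequentially. cmod (cinner (e n) (T (?R n) (e n)) - cinner (e n) (T ?S (e n)))
      \<le> K * (norm (g n - g0) * norm (g n) + norm g0 * norm (g n - g0)) * norm (e n) * norm (e n)"
      by (intro always_eventually allI)
    have "(\<lambda>n. K * (norm (g n - g0) * norm (g n) + norm g0 * norm (g n - g0)) * norm (e n) * norm (e n))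
      \<longlonglongrightarrow> K * (norm (g0 - g0) * norm g0 + norm g0 * norm (g0 - g0)) * norm e0 * norm e0"
      by (intro tendsto_intros g e)
    then show "(\<lambda>n. K * (norm (g n - g0) * norm (g n) + norm g0 * norm (g n - g0)) * norm (e n) * norm (e n))
      \<longlonglongrightarrow> 0" by simp
  qed
  moreover have "(\<lambda>n. cinner (e n) (T ?S (e n))) \<longlonglongrightarrow> cinner e0 (T ?S e0)"
  proof -
    have "bounded_linear (T ?S)"
      using schatten_compact[OF T_mem[OF rank_one_mem]] by (simp add: compact_hilbert_operator_def)
    from bounded_linear.tendsto[OF this e] show ?thesis by (rule tendsto_cinner[OF e])
  qed
  ultimately have "(\<lambda>n. cinner (e n) (T (?R n) (e n)) - cinner (e n) (T ?S (e n)) + cinner (e n) (T ?S (e n)))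
    \<longlonglongrightarrow> 0 + cinner e0 (T ?S e0)" by (rule tendsto_add)
  then show ?thesis unfolding qform_def by (intro tendsto_Re) simp
qed

lemma cinner_T_combination:
  assumes "finite I"
  shows "cinner e (T (\<Sum>i\<in>I. complex_of_real (s i) *\<^sub>C rank_one (g i) (g i)) e)
     = complex_of_real (\<Sum>i\<in>I. s i * qform (g i) e)"
  using T_sum[where I = I and a = "\<lambda>i. complex_of_real (s i)" and x = "\<lambda>i. rank_one (g i) (g i)",
      OF rank_one_mem]
  by (simp add: sum_fun_apply cinner_sum_right scaleC_fun_def cinner_scaleC_right cinner_T_rank_one)

text \<open>The operators \<open>\<Sum>\<^sub>i s\<^sub>i g\<^sub>i g\<^sub>i\<^sup>*\<close> are positive operators of norm at most 1 in the corner of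
  \<open>I - P\<^sub>m\<close>, and the vectors \<open>e\<^sub>j\<close> test the compression of their images to the corner of
  \<open>I - P\<^sub>n\<close>. For positive images diagonal pairings suffice, by the Cauchy-Schwarz inequality.\<close>

definition small_at :: "real \<Rightarrow> nat \<Rightarrow> nat \<Rightarrow> bool" where
  "small_at \<epsilon> m n \<longleftrightarrow> (\<forall>N M s g e. bessel {..<N::nat} g \<longrightarrow> bessel {..<M::nat} e \<longrightarrow>
     (\<forall>i<N. proj b m (g i) = 0) \<longrightarrow> (\<forall>j<M. proj b n (e j) = 0) \<longrightarrow>
     (\<forall>i. 0 \<le> s i) \<longrightarrow> pnorm p {..<N} s \<le> 1 \<longrightarrow>
     pnorm p {..<M} (\<lambda>j. \<Sum>i<N. s i * qform (g i) (e j)) \<le> \<epsilon>)"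

lemma small_atD:
  assumes "small_at \<epsilon> m n" "bessel {..<N::nat} g" "bessel {..<M::nat} e"
    "\<And>i. i < N \<Longrightarrow> proj b m (g i) = 0" "\<And>j. j < M \<Longrightarrow> proj b n (e j) = 0"
    "\<And>i. 0 \<le> s i" "pnorm p {..<N} s \<le> 1"
  shows "pnorm p {..<M} (\<lambda>j. \<Sum>i<N. s i * qform (g i) (e j)) \<le> \<epsilon>"
  using assms unfolding small_at_def by (elim allE impE) auto

section \<open>Smallness in the corners implies compactness\<close>

lemma proj_eq_0_mono: "n \<le> k \<Longrightarrow> proj b k x = 0 \<Longrightarrow> proj b n x = 0"
proof -
  assume "n \<le> k" "proj b k x = 0"
  then have "proj b n x = proj b n (proj b k x)" using proj_proj[OF ortho, of n k x] by (simp add: min_def)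
  then show ?thesis using \<open>proj b k x = 0\<close> clinear_zero[OF proj_clinear[of b n]] by simp
qed

lemma qform_tail:
  assumes e: "bessel {..<M::nat} e" and en: "\<And>j. j < M \<Longrightarrow> proj b n (e j) = 0"
  shows "pnorm p {..<M} (\<lambda>j. qform g (e j)) \<le> nC (T (rank_one g g) - compression n (T (rank_one g g)))"
proof -
  define y where "y = T (rank_one g g)"
  have y: "y \<in> C" unfolding y_def by (intro T_mem rank_one_mem)
  have "pnorm p {..<M} (\<lambda>j. qform g (e j)) = pnorm p {..<M} (\<lambda>j. cmod (cinner (e j) ((y - compression n y) (e j))))"
  proof (rule pnorm_cong)
    fix j assume "j \<in> {..<M}"
    then have "compression n y (e j) = 0"
      using en[of j] clinear_zero[OF proj_clinear[of b n]] clinear_zero[OF schatten_clinear[OF y]]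
      by (simp add: compression_apply[OF schatten_clinear[OF y]])
    then have "cinner (e j) ((y - compression n y) (e j)) = complex_of_real (qform g (e j))"
      by (simp add: y_def cinner_T_rank_one)
    then show "\<bar>qform g (e j)\<bar> = \<bar>cmod (cinner (e j) ((y - compression n y) (e j)))\<bar>" by simp
  qed
  also have "\<dots> \<le> nC (y - compression n y)"
    by (intro schatten_pairing_le schatten_diff y compression_schatten e)
  finally show ?thesis by (simp add: y_def)
qed

text \<open>Removes the restriction on the domain. Split \<open>g = P\<^sub>m g + (g - P\<^sub>m g)\<close>; the first part contributes
  at most a fixed multiple of the \<open>m\<close> operators \<open>T(b\<^sub>a b\<^sub>a\<^sup>*)\<close>, whose compressions to the corner
  of \<open>I - P\<^sub>n\<close> tend to 0.\<close>

lemma small_at_zero: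
  assumes H: "\<And>\<epsilon>. 0 < \<epsilon> \<Longrightarrow> \<exists>m n. small_at \<epsilon> m n" and \<epsilon>: "0 < \<epsilon>"
  shows "\<exists>n. small_at \<epsilon> 0 n"
proof -
  have p0: "0 < p" using p by simp
  obtain m n1 where sm: "small_at (\<epsilon> / 4) m n1" using H[of "\<epsilon> / 4"] \<epsilon> by auto
  \<comment> \<open>The head of the splitting then contributes \<open>2 \<cdot> 2\<^sup>m m \<delta> \<le> \<epsilon> / 2\<close>.\<close>
  define \<delta> where "\<delta> = \<epsilon> / (4 * 2 ^ m * (real m + 1))"
  have \<delta>: "0 < \<delta>" using \<epsilon> by (simp add: \<delta>_def)
  have \<delta>m: "2 ^ m * (real m * \<delta>) \<le> \<epsilon> / 4"
  proof -
    have "2 ^ m * (real m * \<delta>) = (\<epsilon> / 4) * (real m / (real m + 1))" by (simp add: \<delta>_def)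
    also have "\<dots> \<le> (\<epsilon> / 4) * 1" using \<epsilon> by (intro mult_left_mono) auto
    finally show ?thesis by simp
  qed
  let ?y = "\<lambda>a. T (rank_one (b a) (b a))"
  have "\<forall>\<^sub>F n in sequentially. nC (?y a - compression n (?y a)) < \<delta>" for a
    by (rule order_tendstoD(2)[OF compression_tendsto[OF T_mem[OF rank_one_mem]] \<delta>])
  then have "\<forall>\<^sub>F n in sequentially. \<forall>a\<in>{..<m}. nC (?y a - compression n (?y a)) < \<delta>"
    by (intro eventually_ball_finite) auto
  then have "\<forall>\<^sub>F n in sequentially. n1 \<le> n \<and> (\<forall>a\<in>{..<m}. nC (?y a - compression n (?y a)) < \<delta>)"
    by (intro eventually_conj eventually_ge_at_top)
  from eventually_happens'[OF sequentially_bot this]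
  obtain n where "n1 \<le> n" "\<forall>a\<in>{..<m}. nC (?y a - compression n (?y a)) < \<delta>"
    by (elim exE conjE)
  then have n: "n1 \<le> n" "\<And>a. a < m \<Longrightarrow> nC (?y a - compression n (?y a)) < \<delta>"
    by simp_all
  have "small_at \<epsilon> 0 n"
    unfolding small_at_def
  proof (intro allI impI)
    fix N M s g e
    assume g: "bessel {..<N::nat} g" and e: "bessel {..<M::nat} e"
      and "\<forall>i<N. proj b 0 (g i) = 0" and en: "\<forall>j<M. proj b n (e j) = 0"
      and s0: "\<forall>i. 0 \<le> s i" and s1: "pnorm p {..<N} s \<le> 1"
    define h where "h i = g i - proj b m (g i)" for i
    have h: "bessel {..<N} h" unfolding h_def using ortho g by (rule bessel_diff_proj)
    have hm: "proj b m (h i) = 0" for i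
      by (simp add: h_def clinear_diff[OF proj_clinear] proj_proj[OF ortho])
    have en1: "proj b n1 (e j) = 0" if "j < M" for j using n(1) en that proj_eq_0_mono by blast
    have tail: "pnorm p {..<M} (\<lambda>j. \<Sum>i<N. s i * qform (h i) (e j)) \<le> \<epsilon> / 4"
      using s0 by (intro small_atD[OF sm h e hm en1 _ s1]) auto
    have head: "pnorm p {..<M} (\<lambda>j. qform (b a) (e j)) \<le> \<delta>" if "a < m" for a
      using qform_tail[OF e, of n "b a"] en n(2)[OF that] by simp
    have nb: "(norm (b a))\<^sup>2 \<le> 1" for a
      using bessel_norm_le[OF bessel_orthosys[OF ortho, of "{a}"], of a] by (simp add: power_le_one)
    have "(\<Sum>i<N. s i * (cmod (cinner (b a) (g i)))\<^sup>2) \<le> 1" for a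
    proof -
      have "s i \<le> 1" if "i < N" for i
        using abs_le_pnorm[OF p0, of "{..<N}" i s] that s1 by simp
      then have "(\<Sum>i<N. s i * (cmod (cinner (b a) (g i)))\<^sup>2) \<le> (\<Sum>i<N. 1 * (cmod (cinner (b a) (g i)))\<^sup>2)"
        by (intro sum_mono mult_right_mono) auto
      also have "\<dots> = (\<Sum>i<N. (cmod (cinner (g i) (b a)))\<^sup>2)"
        by (intro sum.cong) (auto simp: cinner_commute[of "b a" "g _"])
      also have "\<dots> \<le> 1" using besselD[OF g, of "b a"] nb[of a] by simp
      finally show ?thesis .
    qed
    note coeff = this
    have pt: "(\<Sum>i<N. s i * qform (g i) x) \<le> 2 * (2 ^ m * (\<Sum>a<m. qform (b a) x)) + 2 * (\<Sum>i<N. s i * qform (h i) x)" for x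
    proof -
      have 1: "qform (g i) x \<le> 2 * (2 ^ m * (\<Sum>a<m. (cmod (cinner (b a) (g i)))\<^sup>2 * qform (b a) x)) + 2 * qform (h i) x" for i
      proof -
        have "qform (g i) x = qform (proj b m (g i) + h i) x" by (simp add: h_def)
        also have "\<dots> \<le> 2 * qform (proj b m (g i)) x + 2 * qform (h i) x" by (rule qform_add_le)
        also have "qform (proj b m (g i)) x \<le> 2 ^ m * (\<Sum>a<m. qform (cinner (b a) (g i) *\<^sub>C b a) x)"
          unfolding proj_def by (rule qform_sum_le)
        finally show ?thesis by (simp add: qform_scale)
      qed
      have "(\<Sum>i<N. s i * qform (g i) x) \<le> (\<Sum>i<N. s i * (2 * (2 ^ m * (\<Sum>a<m. (cmod (cinner (b a) (g i)))\<^sup>2 * qform (b a) x)) + 2 * qform (h i) x))"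
        using s0 1 by (intro sum_mono mult_left_mono) auto
      also have "\<dots> = 2 * (2 ^ m * (\<Sum>i<N. \<Sum>a<m. s i * (cmod (cinner (b a) (g i)))\<^sup>2 * qform (b a) x)) + 2 * (\<Sum>i<N. s i * qform (h i) x)"
        by (simp add: sum.distrib sum_distrib_left distrib_left mult_ac)
      also have "(\<Sum>i<N. \<Sum>a<m. s i * (cmod (cinner (b a) (g i)))\<^sup>2 * qform (b a) x)
          = (\<Sum>a<m. (\<Sum>i<N. s i * (cmod (cinner (b a) (g i)))\<^sup>2) * qform (b a) x)"
        by (subst sum.swap) (simp add: sum_distrib_right)
      also have "2 * (2 ^ m * (\<Sum>a<m. (\<Sum>i<N. s i * (cmod (cinner (b a) (g i)))\<^sup>2) * qform (b a) x))
          \<le> 2 * (2 ^ m * (\<Sum>a<m. 1 * qform (b a) x))"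
        using coeff qform_nonneg by (intro mult_left_mono sum_mono mult_right_mono) auto
      finally show ?thesis by simp
    qed
    have nn: "0 \<le> (\<Sum>i<N. s i * qform (g i) x)" for x using s0 qform_nonneg by (intro sum_nonneg) auto
    have "pnorm p {..<M} (\<lambda>j. \<Sum>i<N. s i * qform (g i) (e j))
        \<le> pnorm p {..<M} (\<lambda>j. 2 * (2 ^ m * (\<Sum>a<m. qform (b a) (e j))) + 2 * (\<Sum>i<N. s i * qform (h i) (e j)))"
    proof (rule pnorm_mono[OF p0])
      fix j
      show "\<bar>\<Sum>i<N. s i * qform (g i) (e j)\<bar> \<le>
          \<bar>2 * (2 ^ m * (\<Sum>a<m. qform (b a) (e j))) + 2 * (\<Sum>i<N. s i * qform (h i) (e j))\<bar>"
        using pt[of "e j"] nn[of "e j"] by linarith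
    qed
    also have "\<dots> \<le> pnorm p {..<M} (\<lambda>j. 2 * (2 ^ m * (\<Sum>a<m. qform (b a) (e j))))
        + pnorm p {..<M} (\<lambda>j. 2 * (\<Sum>i<N. s i * qform (h i) (e j)))"
      by (intro pnorm_triangle p) simp
    also have "\<dots> = 2 * (2 ^ m * pnorm p {..<M} (\<lambda>j. \<Sum>a<m. qform (b a) (e j)))
        + 2 * pnorm p {..<M} (\<lambda>j. \<Sum>i<N. s i * qform (h i) (e j))"
      by (simp add: pnorm_scale[OF p0])
    also have "\<dots> \<le> 2 * (2 ^ m * (real m * \<delta>)) + 2 * (\<epsilon> / 4)"
    proof (intro add_mono mult_left_mono tail)
      have "pnorm p {..<M} (\<lambda>j. \<Sum>a<m. qform (b a) (e j)) \<le> (\<Sum>a<m. pnorm p {..<M} (\<lambda>j. qform (b a) (e j)))"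
        by (intro pnorm_sum_le p) auto
      also have "\<dots> \<le> (\<Sum>a<m. \<delta>)" using head by (intro sum_mono) auto
      finally show "pnorm p {..<M} (\<lambda>j. \<Sum>a<m. qform (b a) (e j)) \<le> real m * \<delta>" by simp
    qed auto
    also have "\<dots> \<le> \<epsilon>" using \<delta>m by simp
    finally show "pnorm p {..<M} (\<lambda>j. \<Sum>i<N. s i * qform (g i) (e j)) \<le> \<epsilon>" .
  qed
  then show ?thesis by blast
qed

text \<open>The geometric mean in the Cauchy-Schwarz inequality is replaced by weighted arithmetic means,
  to which the triangle inequality of the p-norm applies. The parameter \<open>t\<close> balances a small
  \<open>\<alpha>\<close> against a bounded \<open>\<beta>\<close>.\<close>

lemma positive_pairing_le:
  assumes y: "clinear y" and pos: "\<And>x. cinner x (y x) \<in> \<real>\<^sub>\<ge>\<^sub>0" and t: "0 < t" and J: "finite J"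
    and g: "pnorm p J (\<lambda>j. Re (cinner (g j) (y (g j)))) \<le> \<alpha>"
    and f: "pnorm p J (\<lambda>j. Re (cinner (f j) (y (f j)))) \<le> \<beta>"
  shows "pnorm p J (\<lambda>j. cmod (cinner (g j) (y (f j)))) \<le> (t * \<alpha> + \<beta> / t) / 2"
proof -
  have p0: "0 < p" using p by simp
  have le: "cmod (cinner x (y z)) \<le> (t / 2) * Re (cinner x (y x)) + (1 / (2 * t)) * Re (cinner z (y z))" for x z
  proof -
    define a where "a = Re (cinner x (y x))"
    define c where "c = Re (cinner z (y z))"
    have a0: "0 \<le> a" "0 \<le> c" using nonneg_Reals_complexD(2)[OF pos] by (auto simp: a_def c_def)
    have "(cmod (cinner x (y z)))\<^sup>2 \<le> a * c"
      unfolding a_def c_def by (rule positive_form_Cauchy_Schwarz[OF y pos])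
    also have "\<dots> \<le> ((t / 2) * a + (1 / (2 * t)) * c)\<^sup>2"
    proof -
      have "((t / 2) * a + (1 / (2 * t)) * c)\<^sup>2 - a * c = ((t / 2) * a - (1 / (2 * t)) * c)\<^sup>2"
        using t by (simp add: power2_eq_square field_simps)
      then show ?thesis using zero_le_power2[of "(t / 2) * a - (1 / (2 * t)) * c"] by linarith
    qed
    finally have square: "(cmod (cinner x (y z)))\<^sup>2 \<le> ((t / 2) * a + (1 / (2 * t)) * c)\<^sup>2" .
    have "0 \<le> (t / 2) * a + (1 / (2 * t)) * c" using a0 t by simp
    from power2_le_imp_le[OF square this] show ?thesis unfolding a_def c_def .
  qed
  have "pnorm p J (\<lambda>j. cmod (cinner (g j) (y (f j))))
      \<le> pnorm p J (\<lambda>j. (t / 2) * Re (cinner (g j) (y (g j))) + (1 / (2 * t)) * Re (cinner (f j) (y (f j))))"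
  proof (rule pnorm_mono[OF p0])
    fix j
    show "\<bar>cmod (cinner (g j) (y (f j)))\<bar>
        \<le> \<bar>(t / 2) * Re (cinner (g j) (y (g j))) + (1 / (2 * t)) * Re (cinner (f j) (y (f j)))\<bar>"
      unfolding abs_norm_cancel by (rule order_trans[OF le abs_ge_self])
  qed
  also have "\<dots> \<le> pnorm p J (\<lambda>j. (t / 2) * Re (cinner (g j) (y (g j))))
      + pnorm p J (\<lambda>j. (1 / (2 * t)) * Re (cinner (f j) (y (f j))))"
    by (intro pnorm_triangle p J)
  also have "\<dots> = (t / 2) * pnorm p J (\<lambda>j. Re (cinner (g j) (y (g j))))
      + (1 / (2 * t)) * pnorm p J (\<lambda>j. Re (cinner (f j) (y (f j))))"
    using t by (simp only: pnorm_scale[OF p0]) simp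
  also have "\<dots> \<le> (t / 2) * \<alpha> + (1 / (2 * t)) * \<beta>" using t by (intro add_mono mult_left_mono g f) auto
  also have "\<dots> = (t * \<alpha> + \<beta> / t) / 2" using t by (simp add: field_simps)
  finally show ?thesis .
qed

text \<open>Control of the off-diagonal corners in the range of \<open>T\<close>: the error \<open>y - P y P\<close> consists of
  \<open>(I - P) y\<close> and \<open>P y (I - P)\<close>, and both pair a small corner with a bounded one.\<close>

lemma compression_error_positive:
  assumes sm: "small_at \<epsilon> 0 n" and K: "\<And>x. x \<in> C \<Longrightarrow> nC (T x) \<le> K * nC x" "0 < K" and t: "0 < t" and \<epsilon>: "0 < \<epsilon>"
    and h: "bessel {..<N::nat} h" and s0: "\<And>i. 0 \<le> s i" and s1: "pnorm p {..<N} s \<le> 1"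
  defines "y \<equiv> T (\<Sum>i<N. complex_of_real (s i) *\<^sub>C rank_one (h i) (h i))"
  shows "nC (y - compression n y) \<le> t * \<epsilon> + K / t"
proof -
  have p0: "0 < p" using p by simp
  define x where "x = (\<Sum>i<N. complex_of_real (s i) *\<^sub>C rank_one (h i) (h i))"
  have x: "x \<in> C" "nC x \<le> 1"
  proof -
    have "pnorm p {..<N} (\<lambda>i. cmod (complex_of_real (s i))) = pnorm p {..<N} s" by (intro pnorm_cong) simp
    then show "x \<in> C" "nC x \<le> 1"
      using schatten_bessel_sum[OF h h, of "\<lambda>i. complex_of_real (s i)"] s1 by (auto simp: x_def)
  qed
  have yx: "y = T x" by (simp add: y_def x_def)
  have yC: "y \<in> C" unfolding yx by (rule T_mem[OF x(1)])
  have nC_y: "nC y \<le> K"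
  proof -
    have "nC y \<le> K * nC x" unfolding yx by (rule K(1)[OF x(1)])
    also have "\<dots> \<le> K * 1" using x K by (intro mult_left_mono) auto
    finally show ?thesis by simp
  qed
  note lin = schatten_clinear[OF yC]
  have form: "cinner e (y e) = complex_of_real (\<Sum>i<N. s i * qform (h i) e)" for e
    unfolding y_def by (rule cinner_T_combination) simp
  have pos: "cinner e (y e) \<in> \<real>\<^sub>\<ge>\<^sub>0" for e
  proof -
    have "0 \<le> (\<Sum>i<N. s i * qform (h i) e)" using s0 qform_nonneg by (intro sum_nonneg) auto
    then show ?thesis unfolding form by (simp del: of_real_sum)
  qed
  have Re_form: "Re (cinner e (y e)) = (\<Sum>i<N. s i * qform (h i) e)" for e unfolding form by (rule Re_complex_of_real)
  have all: "pnorm p {..<k} (\<lambda>j. Re (cinner (f j) (y (f j)))) \<le> K" if f: "bessel {..<k::nat} f" for k f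
  proof -
    have "pnorm p {..<k} (\<lambda>j. Re (cinner (f j) (y (f j)))) \<le> pnorm p {..<k} (\<lambda>j. cmod (cinner (f j) (y (f j))))"
      using p0 by (intro pnorm_mono) (auto intro: abs_Re_le_cmod)
    also have "\<dots> \<le> nC y" by (rule schatten_pairing_le[OF yC f f])
    finally show ?thesis using nC_y by simp
  qed
  have tail: "pnorm p {..<k} (\<lambda>j. Re (cinner (f j - proj b n (f j)) (y (f j - proj b n (f j))))) \<le> \<epsilon>"
    if f: "bessel {..<k::nat} f" for k f
    unfolding Re_form
    by (rule small_atD[OF sm h bessel_diff_proj[OF ortho f] _ _ s0 s1])
      (auto simp: proj_def[of b 0] clinear_diff[OF proj_clinear] proj_proj[OF ortho])
  \<comment> \<open>The first half of the error is estimated with parameter \<open>t\<close>, the second, in which the corners have exchanged their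
    roles, with \<open>1 / t\<close>.\<close>
  have "y - compression n y \<in> C \<and> nC (y - compression n y) \<le> t * \<epsilon> + K / t"
  proof (rule schattenI)
    show "compact_hilbert_operator (y - compression n y)"
      by (intro schatten_compact schatten_diff yC compression_schatten)
    show "0 \<le> t * \<epsilon> + K / t" using t \<epsilon> K by simp
    fix k and e f :: "nat \<Rightarrow> 'h" assume e: "bessel {..<k} e" and f: "bessel {..<k} f"
    define e' where "e' j = e j - proj b n (e j)" for j
    define f' where "f' j = f j - proj b n (f j)" for j
    have split: "cinner (e j) ((y - compression n y) (f j)) = cinner (e' j) (y (f j)) + cinner (proj b n (e j)) (y (f' j))" for j
      by (simp add: compression_apply[OF lin] e'_def f'_def clinear_diff[OF lin] cinner_diff_left
          cinner_diff_right proj_selfadjoint)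
    have "pnorm p {..<k} (\<lambda>j. cmod (cinner (e j) ((y - compression n y) (f j))))
      \<le> pnorm p {..<k} (\<lambda>j. cmod (cinner (e' j) (y (f j))) + cmod (cinner (proj b n (e j)) (y (f' j))))"
      unfolding split using p0 by (intro pnorm_mono) (auto intro: norm_triangle_ineq)
    also have "\<dots> \<le> pnorm p {..<k} (\<lambda>j. cmod (cinner (e' j) (y (f j))))
        + pnorm p {..<k} (\<lambda>j. cmod (cinner (proj b n (e j)) (y (f' j))))"
      by (intro pnorm_triangle p) simp
    also have "\<dots> \<le> (t * \<epsilon> + K / t) / 2 + ((1 / t) * K + \<epsilon> / (1 / t)) / 2"
    proof (rule add_mono)
      show "pnorm p {..<k} (\<lambda>j. cmod (cinner (e' j) (y (f j)))) \<le> (t * \<epsilon> + K / t) / 2"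
        using tail[OF e] all[OF f] t by (intro positive_pairing_le[OF lin pos]) (auto simp: e'_def)
      show "pnorm p {..<k} (\<lambda>j. cmod (cinner (proj b n (e j)) (y (f' j)))) \<le> ((1 / t) * K + \<epsilon> / (1 / t)) / 2"
        using tail[OF f] all[OF bessel_proj[OF ortho e]] t
        by (intro positive_pairing_le[OF lin pos]) (auto simp: f'_def)
    qed
    also have "\<dots> = t * \<epsilon> + K / t"
    proof -
      have eq: "(1 / t) * K = K / t" "\<epsilon> / (1 / t) = t * \<epsilon>" by simp_all
      show ?thesis unfolding eq by (simp only: add.commute[of "K / t"] field_sum_of_halves)
    qed
    finally show "pnorm p {..<k} (\<lambda>j. cmod (cinner (e j) ((y - compression n y) (f j)))) \<le> t * \<epsilon> + K / t" .
  qed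
  then show ?thesis by simp
qed

text \<open>Finite rank operators are combinations of four positive ones by polarisation, and they are dense.\<close>

lemma uniform_compression:
  assumes H: "\<And>\<epsilon>. 0 < \<epsilon> \<Longrightarrow> \<exists>m n. small_at \<epsilon> m n" and \<eta>: "0 < \<eta>"
  shows "\<exists>n. \<forall>x\<in>C. nC x \<le> 1 \<longrightarrow> nC (T x - compression n (T x)) \<le> \<eta>"
proof -
  have p0: "0 < p" using p by simp
  obtain K where K: "0 < K" "\<forall>x\<in>C. nC (T x) \<le> K * nC x"
    using bounded_operator_bound[OF bounded_T] by auto
  \<comment> \<open>The four positive parts contribute at most \<open>2 r\<close> each, the approximation another \<open>2 r\<close>.\<close>
  define r where "r = \<eta> / 10"
  have r: "0 < r" using \<eta> by (simp add: r_def)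
  define t where "t = K / r"
  have t: "0 < t" using r K by (simp add: t_def)
  have rt: "0 < r / t" using r t by simp
  obtain n where sm: "small_at (r / t) 0 n" using small_at_zero[OF H rt] by blast
  define R where "R x = T x - compression n (T x)" for x
  have RC: "R x \<in> C" if "x \<in> C" for x
    unfolding R_def by (intro schatten_diff T_mem that compression_schatten)
  have R_le: "nC (R x) \<le> 2 * nC (T x)" if "x \<in> C" for x
  proof -
    have "nC (R x) \<le> nC (T x) + nC (0 - compression n (T x))"
      using carrier.norm_triangle[OF T_mem[OF that] schatten_diff[OF schatten_zero compression_schatten], of n "T x"]
      by (simp add: R_def)
    also have "nC (0 - compression n (T x)) = nC (compression n (T x))"
      using carrier.norm_minus_commute[OF schatten_zero compression_schatten] by simp
    also have "\<dots> \<le> nC (T x)" by (rule norm_compression_le[OF T_mem[OF that]])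
    finally show ?thesis by simp
  qed
  have Rb: "bounded_operator C nC C nC R"
    unfolding bounded_operator_def
  proof (intro conjI ballI allI exI[of _ "2 * K"])
    show "R \<in> C \<rightarrow> C" using RC by blast
    show "R (x + y) = R x + R y" if "x \<in> C" "y \<in> C" for x y
      by (simp add: R_def T_add[OF that] compression_add)
    show "R (a *\<^sub>C x) = a *\<^sub>C R x" if "x \<in> C" for a x
      by (simp add: R_def T_scale[OF that] compression_scaleC cvs.scale_right_diff_distrib)
    show "nC (R x) \<le> 2 * K * nC x" if "x \<in> C" for x
    proof -
      have "nC (R x) \<le> 2 * nC (T x)" by (rule R_le[OF that])
      also have "\<dots> \<le> 2 * (K * nC x)" using K that by (intro mult_left_mono) auto
      finally show ?thesis by simp
    qed
  qed
  have positive_part: "nC (R (\<Sum>i<N. complex_of_real (s i) *\<^sub>C rank_one (h i) (h i))) \<le> 2 * r"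
    if "bessel {..<N::nat} h" "\<And>i. 0 \<le> s i" "pnorm p {..<N} s \<le> 1" for N h s
  proof -
    have "nC (R (\<Sum>i<N. complex_of_real (s i) *\<^sub>C rank_one (h i) (h i))) \<le> t * (r / t) + K / t"
      unfolding R_def by (rule compression_error_positive[OF sm _ K(1) t rt that]) (use K in blast)
    also have "\<dots> = 2 * r" using t r K by (simp add: t_def)
    finally show ?thesis .
  qed
  have "nC (R x) \<le> \<eta>" if x: "x \<in> C" and x1: "nC x \<le> 1" for x
  proof -
    have "0 < r / K" using r K by simp
    from schatten_finite_rank_approx[OF x this]
    obtain N s u v where u: "bessel {..<N::nat} u" and v: "bessel {..<N} v" and s0: "\<forall>i. 0 \<le> s i"
      and s1: "pnorm p {..<N} s \<le> nC x"
      and close: "nC (x - (\<Sum>i<N. complex_of_real (s i) *\<^sub>C rank_one (v i) (u i))) \<le> r / K"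
      by (elim exE conjE)
    define z where "z = (\<Sum>i<N. complex_of_real (s i) *\<^sub>C rank_one (v i) (u i))"
    define h where "h k i = (1/2) *\<^sub>C (v i + (\<i> ^ k) *\<^sub>C u i)" for k i
    define w where "w k = (\<Sum>i<N. complex_of_real (s i) *\<^sub>C rank_one (h k i) (h k i))" for k
    have h: "bessel {..<N} (h k)" for k
      unfolding h_def using u v by (rule bessel_half_sum) (simp add: norm_power)
    have wC: "w k \<in> C" for k unfolding w_def by (rule schatten_bessel_sum[OF h h, THEN conjunct1])
    have zw: "z = (\<Sum>k<4::nat. (\<i> ^ k) *\<^sub>C w k)"
    proof -
      have "z = (\<Sum>i<N. complex_of_real (s i) *\<^sub>C (\<Sum>k<4::nat. (\<i> ^ k) *\<^sub>C rank_one (h k i) (h k i)))"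
        unfolding z_def h_def by (intro sum.cong refl arg_cong[where f = "scaleC _"] rank_one_polarisation)
      also have "\<dots> = (\<Sum>k<4::nat. \<Sum>i<N. complex_of_real (s i) *\<^sub>C (\<i> ^ k) *\<^sub>C rank_one (h k i) (h k i))"
        unfolding cvs.scale_sum_right by (rule sum.swap)
      also have "\<dots> = (\<Sum>k<4::nat. (\<i> ^ k) *\<^sub>C w k)"
        unfolding w_def cvs.scale_sum_right by (intro sum.cong refl) (simp add: scaleC_scaleC mult.commute)
      finally show ?thesis .
    qed
    have zC: "z \<in> C" unfolding zw by (intro schatten_sum carrier.scale_mem wC)
    have "R z = (\<Sum>k<4::nat. (\<i> ^ k) *\<^sub>C R (w k))"
      unfolding zw by (rule bounded_operator_sum[OF Rb subspace_schatten wC])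
    then have "nC (R z) \<le> (\<Sum>k<4::nat. nC ((\<i> ^ k) *\<^sub>C R (w k)))"
      using schatten_norm_sum_le[of "{..<4::nat}" "\<lambda>k. (\<i> ^ k) *\<^sub>C R (w k)"] carrier.scale_mem[OF RC[OF wC]]
      by simp
    also have "\<dots> = (\<Sum>k<4::nat. nC (R (w k)))"
      by (intro sum.cong refl) (simp add: schatten_scaleC[OF RC[OF wC]] norm_power)
    also have "\<dots> \<le> (\<Sum>k<4::nat. 2 * r)"
    proof (rule sum_mono)
      fix k :: nat
      show "nC (R (w k)) \<le> 2 * r"
        unfolding w_def using h s0 s1 x1 by (intro positive_part) auto
    qed
    finally have 1: "nC (R z) \<le> 8 * r" by simp
    have xz: "x - z \<in> C" by (rule schatten_diff[OF x zC])
    have "nC (R (x - z)) \<le> 2 * r"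
    proof -
      have "nC (R (x - z)) \<le> 2 * nC (T (x - z))" by (rule R_le[OF xz])
      also have "\<dots> \<le> 2 * (K * nC (x - z))" using K xz by simp
      also have "\<dots> \<le> 2 * (K * (r / K))"
        using K close by (intro mult_left_mono) (auto simp: z_def)
      finally show ?thesis using K by simp
    qed
    moreover have "nC (R x) \<le> nC (R (x - z)) + nC (R z)"
    proof -
      have "R x = R (x - z) + R z" using bounded_operator_diff[OF Rb subspace_schatten x zC] by simp
      then show ?thesis using carrier.norm_triangle[OF RC[OF xz] RC[OF zC]] by simp
    qed
    ultimately show ?thesis using 1 by (simp add: r_def)
  qed
  then show ?thesis unfolding R_def by blast
qed

text \<open>Bolzano-Weierstrass for countably many coordinates, by a diagonal sequence.\<close>

lemma coefficient_subsequence: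
  fixes z :: "nat \<Rightarrow> nat \<Rightarrow> nat \<Rightarrow> complex"
  assumes bound: "\<And>k a c. cmod (z k a c) \<le> K"
  shows "\<exists>r. strict_mono r \<and> (\<forall>a c. convergent (\<lambda>k. z (r k) a c))"
proof -
  define P where "P n r \<longleftrightarrow> convergent (\<lambda>k. z (r k) (fst (prod_decode n)) (snd (prod_decode n)))" for n and r :: "nat \<Rightarrow> nat"
  interpret subseqs P
  proof
    fix n and s :: "nat \<Rightarrow> nat" assume "strict_mono s"
    have "bounded (range (\<lambda>k. z (s k) (fst (prod_decode n)) (snd (prod_decode n))))"
      using bound by (auto simp: bounded_iff)
    from bounded_imp_convergent_subsequence[OF this]
    obtain l r where "strict_mono r" "((\<lambda>k. z (s k) (fst (prod_decode n)) (snd (prod_decode n))) \<circ> r) \<longlonglongrightarrow> l"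
      by (elim exE conjE)
    then show "\<exists>r. strict_mono r \<and> P n (s \<circ> r)" by (auto simp: P_def o_def convergent_def)
  qed
  have conv: "convergent (\<lambda>k. z (diagseq k) a c)" for a c
  proof -
    \<comment> \<open>The index of the coordinate \<open>(a, c)\<close> in the diagonal enumeration.\<close>
    define n where "n = prod_encode (a, c)"
    have "P n (diagseq \<circ> (+) (Suc n))"
    proof (rule diagseq_holds)
      fix r s :: "nat \<Rightarrow> nat" and n
      assume "strict_mono r" "P n s"
      then show "P n (s \<circ> r)"
        unfolding P_def using convergent_subseq_convergent[of "\<lambda>k. z (s k) (fst (prod_decode n)) (snd (prod_decode n))" r]
        by (simp add: o_def)
    qed
    then have "convergent (\<lambda>k. z (diagseq (k + Suc n)) a c)"
      by (simp add: P_def n_def o_def add.commute)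
    then show ?thesis using convergent_ignore_initial_segment[of "\<lambda>k. z (diagseq k) a c" "Suc n"] by simp
  qed
  show ?thesis using subseq_diagseq conv by (intro exI[of _ diagseq]) simp
qed

text \<open>A subsequence along which all matrix entries of \<open>T x\<^sub>k\<close> converge is a Cauchy sequence in norm,
  because a compression involves only finitely many entries and approximates \<open>T x\<^sub>k\<close> uniformly.\<close>

theorem small_at_imp_compact:
  assumes H: "\<And>\<epsilon>. 0 < \<epsilon> \<Longrightarrow> \<exists>m n. small_at \<epsilon> m n"
  shows "compact_operator C nC C nC T"
proof (rule carrier.compact_operatorI[OF bounded_T])
  fix x :: "nat \<Rightarrow> 'h \<Rightarrow> 'h" assume x: "\<And>n. x n \<in> C" "\<And>n. nC (x n) \<le> 1"
  obtain K where K: "0 < K" "\<forall>x\<in>C. nC (T x) \<le> K * nC x"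
    using bounded_operator_bound[OF bounded_T] by auto
  define y where "y k = T (x k)" for k
  have yC: "y k \<in> C" for k unfolding y_def by (intro T_mem x)
  have nb: "norm (b a) \<le> 1" for a
    using bessel_norm_le[OF bessel_orthosys[OF ortho, of "{a}"], of a] by simp
  have "cmod (cinner (b a) (y k (b c))) \<le> K" for k a c
  proof -
    have "cmod (cinner (b a) (y k (b c))) \<le> nC (y k) * norm (b a) * norm (b c)"
      by (rule cinner_schatten_le[OF yC])
    also have "\<dots> \<le> K * 1 * 1"
    proof (intro mult_mono nb)
      have "nC (y k) \<le> K * nC (x k)" using K x by (simp add: y_def)
      also have "\<dots> \<le> K * 1" using K x by (intro mult_left_mono) auto
      finally show "nC (y k) \<le> K" by simp
    qed (use K in auto)
    finally show ?thesis by simp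
  qed
  then have "\<exists>r. strict_mono r \<and> (\<forall>a c. convergent (\<lambda>k. cinner (b a) (y (r k) (b c))))"
    by (rule coefficient_subsequence)
  then obtain r where r: "strict_mono r" and conv: "\<forall>a c. convergent (\<lambda>k. cinner (b a) (y (r k) (b c)))"
    by (elim exE conjE)
  have "carrier.norm_Cauchy (\<lambda>k. y (r k))"
    unfolding carrier.norm_Cauchy_def
  proof (intro allI impI)
    fix e :: real assume e: "0 < e"
    then have e4: "0 < e / 4" by simp
    have "\<exists>n. \<forall>x\<in>C. nC x \<le> 1 \<longrightarrow> nC (T x - compression n (T x)) \<le> e / 4"
      by (rule uniform_compression[OF _ e4]) (rule H)
    then obtain n where n: "\<forall>x\<in>C. nC x \<le> 1 \<longrightarrow> nC (T x - compression n (T x)) \<le> e / 4" by (elim exE)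
    define d where "d = e / (4 * (real n * real n + 1))"
    have d: "0 < d" using e by (simp add: d_def add_nonneg_pos)
    have "\<exists>N. \<forall>k\<ge>N. \<forall>l\<ge>N. cmod (cinner (b a) (y (r k) (b c)) - cinner (b a) (y (r l) (b c))) < d" for a c
      using conv convergent_Cauchy[of "\<lambda>k. cinner (b a) (y (r k) (b c))"] d by (simp add: Cauchy_iff)
    then obtain N where N: "\<And>a c k l. N a c \<le> k \<Longrightarrow> N a c \<le> l \<Longrightarrow>
        cmod (cinner (b a) (y (r k) (b c)) - cinner (b a) (y (r l) (b c))) < d"
      by metis
    define M where "M = (\<Sum>a<n. \<Sum>c<n. N a c)"
    have NM: "N a c \<le> M" if "a < n" "c < n" for a c
    proof -
      have "N a c \<le> (\<Sum>c<n. N a c)" using that by (intro member_le_sum) auto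
      also have "\<dots> \<le> M" unfolding M_def using that by (intro member_le_sum[where f = "\<lambda>a. \<Sum>c<n. N a c"]) auto
      finally show ?thesis .
    qed
    have "nC (y (r k) - y (r l)) < e" if kl: "M \<le> k" "M \<le> l" for k l
    proof -
      define q where "q = y (r k) - y (r l)"
      have qC: "q \<in> C" unfolding q_def by (intro schatten_diff yC)
      have "nC (compression n q) \<le> (\<Sum>a<n. \<Sum>c<n. d)"
      proof -
        have mem: "cinner (b a) (q (b c)) *\<^sub>C rank_one (b a) (b c) \<in> C" for a c
          by (intro carrier.scale_mem rank_one_mem)
        have "nC (compression n q) \<le> (\<Sum>a<n. nC (\<Sum>c<n. cinner (b a) (q (b c)) *\<^sub>C rank_one (b a) (b c)))"
          unfolding compression_def by (intro schatten_norm_sum_le schatten_sum mem)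
        also have "\<dots> \<le> (\<Sum>a<n. \<Sum>c<n. nC (cinner (b a) (q (b c)) *\<^sub>C rank_one (b a) (b c)))"
          by (intro sum_mono schatten_norm_sum_le mem)
        also have "\<dots> \<le> (\<Sum>a<n. \<Sum>c<n. d)"
        proof (intro sum_mono)
          fix a c assume ac: "a \<in> {..<n}" "c \<in> {..<n}"
          have "nC (rank_one (b a) (b c)) \<le> 1"
            using schatten_rank_one[of "b a" "b c"] nb[of a] nb[of c] mult_mono[of "norm (b a)" 1 "norm (b c)" 1] by simp
          moreover have "cmod (cinner (b a) (q (b c))) \<le> d"
            using N[of a c k l] NM[of a c] ac kl by (simp add: q_def cinner_diff_right)
          ultimately have "cmod (cinner (b a) (q (b c))) * nC (rank_one (b a) (b c)) \<le> d * 1"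
            using d by (intro mult_mono) auto
          then show "nC (cinner (b a) (q (b c)) *\<^sub>C rank_one (b a) (b c)) \<le> d"
            by (simp add: schatten_scaleC[OF rank_one_mem])
        qed
        finally show ?thesis .
      qed
      also have "(\<Sum>a<n. \<Sum>c<n. d) = (real n * real n) * d" by simp
      also have "\<dots> \<le> (real n * real n + 1) * d" using d by (intro mult_right_mono) auto
      also have "\<dots> = e / 4"
      proof -
        have "real n * real n + 1 \<noteq> 0" by (smt (verit) zero_le_mult_iff of_nat_0_le_iff)
        moreover have "q * (e / (4 * q)) = e / 4" if "q \<noteq> 0" for q :: real using that by simp
        ultimately show ?thesis unfolding d_def by blast
      qed
      finally have 1: "nC (compression n q) \<le> e / 4" .
      have err: "nC (y k - compression n (y k)) \<le> e / 4" for k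
        using n x by (simp add: y_def)
      define u where "u k = y (r k) - compression n (y (r k))" for k
      have uC: "u k \<in> C" for k unfolding u_def by (intro schatten_diff yC compression_schatten)
      have eq: "q = (u k - u l) + compression n q"
        by (simp add: q_def u_def clinear_diff[OF compression_clinear])
      have "nC q \<le> nC (u k - u l) + nC (compression n q)"
        using carrier.norm_triangle[OF schatten_diff[OF uC uC] compression_schatten, of k l n q]
        by (simp flip: eq)
      also have "nC (u k - u l) \<le> nC (u k - 0) + nC (0 - u l)"
        by (rule carrier.norm_triangle_diff[OF uC schatten_zero uC])
      also have "\<dots> = nC (u k) + nC (u l)"
        using carrier.norm_minus_commute[OF schatten_zero uC, of l] by simp
      also have "\<dots> \<le> e / 4 + e / 4" unfolding u_def by (intro add_mono err)
      finally have "nC q < e" using 1 e by linarith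
      then show ?thesis by (simp only: q_def)
    qed
    then show "\<exists>N. \<forall>m\<ge>N. \<forall>n\<ge>N. nC (y (r m) - y (r n)) < e" by blast
  qed
  then show "\<exists>r. strict_mono r \<and> carrier.norm_Cauchy (\<lambda>n. T (x (r n)))"
    using r unfolding y_def by blast
qed

section \<open>Blocks fixed by a noncompact positive operator\<close>

text \<open>A failure of \<open>small_at\<close> at \<open>m\<close>, witnessed between the projections \<open>P\<^sub>m\<close> and \<open>P\<^sub>r\<close>.\<close>

definition fixed_block ::
    "real \<Rightarrow> nat \<Rightarrow> nat \<Rightarrow> nat \<Rightarrow> nat \<Rightarrow> (nat \<Rightarrow> real) \<Rightarrow> (nat \<Rightarrow> 'h) \<Rightarrow> (nat \<Rightarrow> 'h) \<Rightarrow> bool" where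
  "fixed_block \<epsilon> m r N M s g e \<longleftrightarrow> m < r \<and> bessel {..<N} g \<and> bessel {..<M} e \<and>
     (\<forall>i<N. proj b m (g i) = 0 \<and> proj b r (g i) = g i) \<and>
     (\<forall>j<M. proj b m (e j) = 0 \<and> proj b r (e j) = e j) \<and>
     (\<forall>i. 0 \<le> s i) \<and> pnorm p {..<N} s \<le> 1 \<and>
     \<epsilon> < pnorm p {..<M} (\<lambda>j. \<Sum>i<N. s i * qform (g i) (e j))"

text \<open>The witnesses can be truncated by \<open>P\<^sub>r\<close> with large \<open>r\<close>, since the form is continuous.\<close>

lemma fixed_block_exists:
  assumes "\<not> small_at \<epsilon> m m"
  shows "\<exists>r N M s g e. fixed_block \<epsilon> m r N M s g e"
proof -
  have p0: "0 < p" using p by simp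
  obtain N M s g e where g: "bessel {..<N::nat} g" and e: "bessel {..<M::nat} e"
    and gm: "\<forall>i<N. proj b m (g i) = 0" and em: "\<forall>j<M. proj b m (e j) = 0"
    and s0: "\<forall>i. 0 \<le> s i" and s1: "pnorm p {..<N} s \<le> 1"
    and large: "\<epsilon> < pnorm p {..<M} (\<lambda>j. \<Sum>i<N. s i * qform (g i) (e j))"
    using assms unfolding small_at_def not_all not_imp not_le by (elim exE conjE)
  have "(\<lambda>r. pnorm p {..<M} (\<lambda>j. \<Sum>i<N. s i * qform (proj b r (g i)) (proj b r (e j))))
      \<longlonglongrightarrow> pnorm p {..<M} (\<lambda>j. \<Sum>i<N. s i * qform (g i) (e j))"
    by (intro tendsto_pnorm p0 tendsto_sum tendsto_mult tendsto_const qform_tendsto proj_tendsto) simp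
  then have "\<forall>\<^sub>F r in sequentially. \<epsilon> < pnorm p {..<M} (\<lambda>j. \<Sum>i<N. s i * qform (proj b r (g i)) (proj b r (e j)))"
    using large by (rule order_tendstoD(1))
  then have "\<forall>\<^sub>F r in sequentially. m < r \<and>
      \<epsilon> < pnorm p {..<M} (\<lambda>j. \<Sum>i<N. s i * qform (proj b r (g i)) (proj b r (e j)))"
    by (intro eventually_conj eventually_gt_at_top)
  from eventually_happens'[OF sequentially_bot this]
  obtain r where r: "m < r"
      "\<epsilon> < pnorm p {..<M} (\<lambda>j. \<Sum>i<N. s i * qform (proj b r (g i)) (proj b r (e j)))"
    by (elim exE conjE)
  have "proj b m (proj b r x) = proj b m x" "proj b r (proj b r x) = proj b r x" for x
    using r(1) by (simp_all add: proj_proj[OF ortho] min_def)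
  then have "fixed_block \<epsilon> m r N M s (\<lambda>i. proj b r (g i)) (\<lambda>j. proj b r (e j))"
    unfolding fixed_block_def
    using r gm em s0 s1 bessel_proj[OF ortho g, of r] bessel_proj[OF ortho e, of r] by simp
  then show ?thesis by (intro exI)
qed

text \<open>The gliding hump. Successive blocks start where the previous one ends, so their Bessel families
  combine. The blocks are \<open>c\<^sub>k = \<Sum>\<^sub>i s\<^sub>k\<^sub>i g\<^sub>k\<^sub>i g\<^sub>k\<^sub>i\<^sup>*\<close>, and \<open>\<phi>\<^sub>k\<close> combines the diagonal
  pairings with the vectors \<open>e\<^sub>k\<^sub>j\<close> by norming weights.\<close>

theorem not_small_at_imp_factorisation:
  assumes \<epsilon>: "0 < \<epsilon>" and ns: "\<And>m. \<not> small_at \<epsilon> m m"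
  shows "\<exists>J L. bounded_operator (lp_space p) (lp_norm p) C nC J \<and>
     bounded_operator C nC (lp_space p) (lp_norm p) L \<and> (\<forall>a\<in>lp_space p. L (T (J a)) = a)"
proof -
  have p0: "0 < p" using p by simp
  have "\<forall>m. \<exists>r N M s g e. fixed_block \<epsilon> m r N M s g e" using fixed_block_exists[OF ns] by blast
  then obtain R N0 M0 s0 g0 e0 where blk0: "\<And>m. fixed_block \<epsilon> m (R m) (N0 m) (M0 m) (s0 m) (g0 m) (e0 m)"
    by metis
  define m where "m k = (R ^^ k) 0" for k
  define N where "N k = N0 (m k)" for k
  define M where "M k = M0 (m k)" for k
  define s where "s k = s0 (m k)" for k
  define g where "g k = g0 (m k)" for k
  define e where "e k = e0 (m k)" for k
  have blk: "fixed_block \<epsilon> (m k) (m (Suc k)) (N k) (M k) (s k) (g k) (e k)" for k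
    using blk0[of "m k"] by (simp add: m_def N_def M_def s_def g_def e_def)
  have mono: "mono m"
    using blk by (intro strict_mono_mono) (simp add: strict_mono_Suc_iff fixed_block_def)
  have g: "bessel {..<N k} (g k)" and e: "bessel {..<M k} (e k)" and s: "\<And>i. 0 \<le> s k i" "pnorm p {..<N k} (s k) \<le> 1"
    and large: "\<epsilon> < pnorm p {..<M k} (\<lambda>j. \<Sum>i<N k. s k i * qform (g k i) (e k j))" for k
    using blk[of k] by (simp_all add: fixed_block_def)
  have gS: "bessel (Sigma F (\<lambda>k. {..<N k})) (\<lambda>(k, i). g k i)" if "finite F" for F
    using blk that by (intro bessel_Sigma[OF ortho mono _ g]) (auto simp: fixed_block_def)
  have eS: "bessel (Sigma F (\<lambda>k. {..<M k})) (\<lambda>(k, j). e k j)" if "finite F" for F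
    using blk that by (intro bessel_Sigma[OF ortho mono _ e]) (auto simp: fixed_block_def)
  define a where "a k j = (\<Sum>i<N k. s k i * qform (g k i) (e k j))" for k j
  have a_eq: "a k = (\<lambda>j. \<Sum>i<N k. s k i * qform (g k i) (e k j))" for k by (rule ext) (rule a_def)
  have a0: "0 \<le> a k j" for k j unfolding a_def using s qform_nonneg by (intro sum_nonneg) auto
  have "\<exists>w. (\<forall>j. 0 \<le> w j) \<and> (\<Sum>j<M k. w j * a k j) = pnorm p {..<M k} (a k) \<and>
     (\<forall>z. (\<Sum>j<M k. w j * \<bar>z j\<bar>) \<le> pnorm p {..<M k} z)" for k
    using large[of k] \<epsilon> a0 by (intro norming_weights p) (auto simp: a_def)
  then have "\<forall>k. \<exists>w. (\<forall>j. 0 \<le> w j) \<and> (\<Sum>j<M k. w j * a k j) = pnorm p {..<M k} (a k) \<and>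
     (\<forall>z. (\<Sum>j<M k. w j * \<bar>z j\<bar>) \<le> pnorm p {..<M k} z)" by (rule allI)
  from choice[OF this] obtain w where "\<forall>k. (\<forall>j. 0 \<le> w k j) \<and> (\<Sum>j<M k. w k j * a k j) = pnorm p {..<M k} (a k) \<and>
     (\<forall>z. (\<Sum>j<M k. w k j * \<bar>z j\<bar>) \<le> pnorm p {..<M k} z)" by (elim exE)
  then have w0: "0 \<le> w k j" and wa: "(\<Sum>j<M k. w k j * a k j) = pnorm p {..<M k} (a k)"
    and wz: "(\<Sum>j<M k. w k j * \<bar>z j\<bar>) \<le> pnorm p {..<M k} z" for k j z by simp_all
  define c where "c k = (\<Sum>i<N k. complex_of_real (s k i) *\<^sub>C rank_one (g k i) (g k i))" for k
  define \<phi> where "\<phi> k y = (\<Sum>j<M k. complex_of_real (w k j) * cinner (e k j) (y (e k j)))" for k and y :: "'h \<Rightarrow> 'h"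
  define A where "A k l = (\<Sum>j<M k. w k j * (\<Sum>i<N l. s l i * qform (g l i) (e k j)))" for k l
  show ?thesis
  proof (rule carrier.positive_blocks_factorisation[where c = c and \<phi> = \<phi> and A = A and d = \<epsilon>, OF p bounded_T])
    show "c k \<in> C" for k
      unfolding c_def by (rule schatten_bessel_sum[OF g g, THEN conjunct1])
    show "nC (\<Sum>k\<in>F. z k *\<^sub>C c k) \<le> pnorm p F (\<lambda>k. cmod (z k))" if F: "finite F" for F z
    proof -
      have "(\<Sum>k\<in>F. z k *\<^sub>C c k) = (\<Sum>k\<in>F. \<Sum>i<N k. (z k * complex_of_real (s k i)) *\<^sub>C rank_one (g k i) (g k i))"
        unfolding c_def cvs.scale_sum_right by (simp only: scaleC_scaleC)
      also have "\<dots> = (\<Sum>q\<in>Sigma F (\<lambda>k. {..<N k}). (z (fst q) * complex_of_real (s (fst q) (snd q))) *\<^sub>C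
          rank_one ((\<lambda>(k, i). g k i) q) ((\<lambda>(k, i). g k i) q))"
        using F by (subst sum.Sigma) (auto simp: case_prod_unfold)
      finally have eq: "(\<Sum>k\<in>F. z k *\<^sub>C c k) = (\<Sum>q\<in>Sigma F (\<lambda>k. {..<N k}). (z (fst q) * complex_of_real (s (fst q) (snd q))) *\<^sub>C
          rank_one ((\<lambda>(k, i). g k i) q) ((\<lambda>(k, i). g k i) q))" .
      have "nC (\<Sum>k\<in>F. z k *\<^sub>C c k) \<le> pnorm p (Sigma F (\<lambda>k. {..<N k})) (\<lambda>q. cmod (z (fst q) * complex_of_real (s (fst q) (snd q))))"
        unfolding eq by (rule schatten_bessel_sum[OF gS[OF F] gS[OF F], THEN conjunct2])
      also have "\<dots> = pnorm p (Sigma F (\<lambda>k. {..<N k})) (\<lambda>(k, i). cmod (z k) * s k i)"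
        using s(1) by (intro pnorm_cong) (auto simp: norm_mult)
      also have "\<dots> = pnorm p F (\<lambda>k. pnorm p {..<N k} (\<lambda>i. cmod (z k) * s k i))"
        by (rule pnorm_Sigma[OF p0 F]) simp
      also have "\<dots> \<le> pnorm p F (\<lambda>k. cmod (z k))"
      proof (rule pnorm_mono[OF p0])
        fix k
        have "pnorm p {..<N k} (\<lambda>i. cmod (z k) * s k i) = cmod (z k) * pnorm p {..<N k} (s k)"
          by (simp add: pnorm_scale[OF p0])
        also have "\<dots> \<le> cmod (z k)" using s(2)[of k] by (simp add: mult_left_le)
        finally show "\<bar>pnorm p {..<N k} (\<lambda>i. cmod (z k) * s k i)\<bar> \<le> \<bar>cmod (z k)\<bar>" by simp
      qed
      finally show ?thesis .
    qed
    show "\<phi> k (x + y) = \<phi> k x + \<phi> k y" for k x y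
      by (simp add: \<phi>_def cinner_add_right distrib_left sum.distrib)
    show "\<phi> k (z *\<^sub>C x) = z * \<phi> k x" for k z x
      by (simp add: \<phi>_def scaleC_fun_def cinner_scaleC_right sum_distrib_left mult_ac)
    show "pnorm p F (\<lambda>k. cmod (\<phi> k x)) \<le> nC x" if F: "finite F" and x: "x \<in> C" for F x
    proof -
      have "pnorm p F (\<lambda>k. cmod (\<phi> k x)) \<le> pnorm p F (\<lambda>k. pnorm p {..<M k} (\<lambda>j. cmod (cinner (e k j) (x (e k j)))))"
      proof (rule pnorm_mono[OF p0])
        fix k
        have "cmod (\<phi> k x) \<le> (\<Sum>j<M k. w k j * \<bar>cmod (cinner (e k j) (x (e k j)))\<bar>)"
          unfolding \<phi>_def using w0 by (intro sum_norm_le) (simp add: norm_mult)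
        also have "\<dots> \<le> pnorm p {..<M k} (\<lambda>j. cmod (cinner (e k j) (x (e k j))))" by (rule wz)
        finally show "\<bar>cmod (\<phi> k x)\<bar> \<le> \<bar>pnorm p {..<M k} (\<lambda>j. cmod (cinner (e k j) (x (e k j))))\<bar>" by simp
      qed
      also have "\<dots> = pnorm p (Sigma F (\<lambda>k. {..<M k})) (\<lambda>(k, j). cmod (cinner (e k j) (x (e k j))))"
        by (rule pnorm_Sigma[OF p0 F, symmetric]) simp
      also have "\<dots> = pnorm p (Sigma F (\<lambda>k. {..<M k})) (\<lambda>q. cmod (cinner ((\<lambda>(k, j). e k j) q) (x ((\<lambda>(k, j). e k j) q))))"
        by (intro pnorm_cong) auto
      also have "\<dots> \<le> nC x" by (rule schatten_pairing_le[OF x eS[OF F] eS[OF F]])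
      finally show ?thesis .
    qed
    show "\<phi> k (T (c l)) = complex_of_real (A k l)" for k l
      unfolding \<phi>_def c_def A_def cinner_T_combination[OF finite_lessThan] by (simp only: of_real_sum of_real_mult)
    show "0 \<le> A k l" for k l
      unfolding A_def using w0 s(1) qform_nonneg by (intro sum_nonneg mult_nonneg_nonneg)
    show "0 < \<epsilon>" by (rule \<epsilon>)
    show "\<epsilon> \<le> A k k" for k
      using large[of k] wa[of k] by (simp add: A_def a_eq)
  qed
qed

theorem not_compact_imp_fixes_complemented_lp:
  assumes "\<not> compact_operator C nC C nC T"
  shows "\<exists>E. closed_inf_dim_subspace C nC E \<and> isomorphic E nC (lp_space p) (lp_norm p) \<and>
     isomorphism E nC (T ` E) nC T \<and> complemented C nC E \<and> complemented C nC (T ` E)"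
proof -
  have "\<not> (\<forall>\<epsilon>>0. \<exists>m n. small_at \<epsilon> m n)" using small_at_imp_compact assms by blast
  then obtain \<epsilon> where \<epsilon>: "0 < \<epsilon>" "\<And>m n. \<not> small_at \<epsilon> m n" by blast
  obtain J L where J: "bounded_operator (lp_space p) (lp_norm p) C nC J"
    and L: "bounded_operator C nC (lp_space p) (lp_norm p) L"
    and LTJ: "\<forall>a\<in>lp_space p. L (T (J a)) = a"
    using not_small_at_imp_factorisation[OF \<epsilon>] by (elim exE conjE)
  show ?thesis
    using p bounded_T J L by (rule carrier.factorisation_fixes_complemented_lp) (use LTJ in blast)
qed

end

theorem theorem4p10:
  fixes p :: real
    and T :: "('h::chilbert_space \<Rightarrow> 'h) \<Rightarrow> ('h \<Rightarrow> 'h)"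
  assumes "separable_space (euclidean :: 'h topology)"
    and "\<not> finite_dimensional (UNIV :: 'h set)"
    and "1 \<le> p"
    and "T \<in> positive_operators p"
  defines "C \<equiv> schatten_space p :: ('h \<Rightarrow> 'h) set"
    and "nC \<equiv> schatten_norm p :: ('h \<Rightarrow> 'h) \<Rightarrow> real"
  shows "(compact_operator C nC C nC T \<longleftrightarrow> strictly_singular C nC C nC T) \<and>
    (strictly_singular C nC C nC T \<longleftrightarrow>
      \<not> (\<exists>E. closed_inf_dim_subspace C nC E \<and>
            isomorphic E nC (lp_space p) (lp_norm p) \<and>
            isomorphism E nC (T ` E) nC T \<and>
            complemented C nC E \<and>
            complemented C nC (T ` E)))"
proof -
  obtain b :: "nat \<Rightarrow> 'h" where b: "hilbert_basis b"
    using separable_imp_hilbert_basis[OF assms(1)] by blast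
  interpret hilbert_basis b by (rule b)
  interpret positive_schatten_operator b p T
    by unfold_locales (use assms in auto)
  have "compact_operator C nC C nC T \<Longrightarrow> strictly_singular C nC C nC T"
    unfolding C_def nC_def by (rule compact_imp_strictly_singular)
  moreover have "strictly_singular C nC C nC T \<Longrightarrow>
      \<not> (\<exists>E. closed_inf_dim_subspace C nC E \<and> isomorphic E nC (lp_space p) (lp_norm p) \<and>
            isomorphism E nC (T ` E) nC T \<and> complemented C nC E \<and> complemented C nC (T ` E))"
    unfolding strictly_singular_def by blast
  moreover have "\<not> compact_operator C nC C nC T \<Longrightarrow>
      \<exists>E. closed_inf_dim_subspace C nC E \<and> isomorphic E nC (lp_space p) (lp_norm p) \<and>
            isomorphism E nC (T ` E) nC T \<and> complemented C nC E \<and> complemented C nC (T ` E)"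
    unfolding C_def nC_def by (rule not_compact_imp_fixes_complemented_lp)
  ultimately show ?thesis by blast
qed

end
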